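(* Let $M$ be a smooth manifold and $(P,\theta,F,Z_a,\xi^a)$ $(a=1,\dots,h)$ a generalized almost contact structure of codimension $h$ on $M$ such that, for every $x\in M$, $-1$ is not an eigenvalue of $(\sharp_P\circ\flat_\theta)_x:T_xM\to T_xM$. Then the structure is normal if and only if all the following conditions hold (for all indices $a,b$, all $\alpha\in\Omega^1(M)$ and all vector fields $X,Y,Z$ on $M$): $$[P,P]=0,\qquad R_{(P,F)}=0,$$ $$L_{Z_a}P=0,\quad L_{Z_a}\theta=0,\quad L_{\sharp_P\alpha}\xi^a=0,\quad[Z_a,Z_b]=0,$$ $$\mathcal{N}_F(X,Y)=\sharp_P(i(X\wedge Y)d\theta)-\sum_{a=1}^h(d\xi^a(X,Y))Z_a,$$ $$d\theta_F(X,Y,Z)=\sum_{Cycl(X,Y,Z)}d\theta(FX,Y,Z).$$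
   Context: All objects are $C^\infty$. For a bivector field $P$, $\sharp_P:T^*M\to TM$ is defined by $\beta(\sharp_P\alpha)=P(\alpha,\beta)$; for a $2$-form $\theta$, $\flat_\theta(X)=i(X)\theta=\theta(X,\cdot)$. $i(X\wedge Y)\Theta=\Theta(X,Y,\cdot)$ for a $3$-form $\Theta$, and $d\xi(X,Y)=X\xi(Y)-Y\xi(X)-\xi([X,Y])$. $[P,P]$ is the Schouten-Nijenhuis bracket. A generalized almost contact structure of codimension $h$ on $M$ is a system $(P,\theta,F,Z_a,\xi^a)$, $a=1,\dots,h$, with $P$ a bivector field, $\theta$ a $2$-form, $F$ a $(1,1)$-tensor field, $Z_a$ vector fields and $\xi^a$ $1$-forms, satisfying $$P(\alpha\circ F,\beta)=P(\alpha,\beta\circ F),\quad\theta(FX,Y)=\theta(X,FY),$$ $$F(Z_a)=0,\ \ \xi^a\circ F=0,\ \ i(Z_a)\theta=0,\ \ i(\xi^a)P=0,\ \ \xi^a(Z_b)=\delta^a_b,$$ $$F^2=-Id-\sharp_P\circ\flat_\theta+\sum_{a=1}^h\xi^a\otimes Z_a.$$ Let $\mathbf{T}_h^{big}M=(TM\times\mathbb{R}^h)\oplus(T^*M\times\mathbb{R}^h)$. The conditions $P(\alpha\circ F,\beta)=P(\alpha,\beta\circ F)$, $\theta(FX,Y)=\theta(X,FY)$, $F(Z_a)=0$, $\xi^a\circ F=0$, $i(Z_a)\theta=0$, $i(\xi^a)P=0$, $\xi^a(Z_b)=\delta^a_b$, $F^2=-Id-\sharp_P\circ\flat_\theta+\sum_{a=1}^h\xi^a\otimes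 Z_a$ defining a generalized almost contact structure say that the endomorphism $$\Phi\big((X,u)\oplus(\alpha,v)\big)=\Big(FX+\sharp_P\alpha-\sum_av_aZ_a,\ (\alpha(Z_a))_a\Big)\oplus\Big(\flat_\theta X-\sum_au^a\xi^a-\alpha\circ F,\ (\xi^a(X))_a\Big)$$ of $\mathbf{T}_h^{big}M$ satisfies $\Phi^2=-Id$; it is skew-symmetric for the metric $G=\tfrac12(\alpha_2(X_1)+\alpha_1(X_2)+u_1\cdot v_2+u_2\cdot v_1)$. The structure is called normal if the $\sqrt{-1}$-eigenbundle of $\Phi$ in $\mathbf{T}_h^{big}M\otimes\mathbb{C}$ has its sections closed under the ($\mathbb{C}$-linear extension of the) untwisted stable Courant bracket $$[(X_1,u_1)\oplus(\alpha_1,v_1),(X_2,u_2)\oplus(\alpha_2,v_2)]=([X_1,X_2],X_1u_2-X_2u_1)\oplus\Big(L_{X_1}\alpha_2-L_{X_2}\alpha_1+\tfrac12d(\alpha_1(X_2)-\alpha_2(X_1))+\tfrac12(u_2\cdot dv_1+v_2\cdot du_1-u_1\cdot dv_2-v_1\cdot du_2),\ X_1v_2-X_2v_1\Big)$$ (equivalently, the Nijenhuis torsion of $\Phi$ for this bracket vanishes). Further notation: the Nijenhuis tensor is $\mathcal{N}_F(X,Y)=[FX,FY]-F[X,FY]-F[FX,Y]+F^2[X,Y]$; the Schouten concomitant is $R_{(P,F)}(\alpha,X)=\sharp_P(L_X(\alpha\circ F)-L_{FX}\alpha)-(L_{\sharp_P\alpha}F)(X)$; $\theta_F$ is the $2$-form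 $\theta_F(X,Y)=\theta(FX,Y)$; $\sum_{Cycl}$ denotes the sum over cyclic permutations. *)

theory Defs
  imports "HOL-Analysis.Analysis" "HOL-Library.Function_Algebras"
begin

text \<open>Tangent vectors, covectors, tensors and tensor fields are all functions below. Together
  with the pointwise addition of \<^theory>\<open>HOL-Library.Function_Algebras\<close> this makes them elements
  of real vector spaces.\<close>

instantiation "fun" :: (type, real_vector) real_vector
begin

definition "c *\<^sub>R f = (\<lambda>x. c *\<^sub>R f x)"

instance
  by standard (simp_all add: scaleR_fun_def fun_eq_iff scaleR_add_right scaleR_add_left)

end

text \<open>The linear maps \<open>V \<rightarrow> W\<close>, extended by \<open>0\<close> outside \<open>V\<close>, so that two of them
  are equal as functions iff they agree on \<open>V\<close>.\<close>

definition Lin :: "'v::real_vector set \<Rightarrow> 'w::real_vector set \<Rightarrow> ('v \<Rightarrow> 'w) set" where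
  "Lin V W = {f. (\<forall>x\<in>V. f x \<in> W) \<and>
     (\<forall>x\<in>V. \<forall>y\<in>V. f (x + y) = f x + f y) \<and> (\<forall>c. \<forall>x\<in>V. f (c *\<^sub>R x) = c *\<^sub>R f x) \<and>
     (\<forall>x. x \<notin> V \<longrightarrow> f x = 0)}"

definition Alt2 :: "'v::real_vector set \<Rightarrow> ('v \<Rightarrow> 'v \<Rightarrow> real) set" where
  "Alt2 V = {\<omega> \<in> Lin V (Lin V UNIV). \<forall>x\<in>V. \<omega> x x = 0}"

definition Alt3 :: "'v::real_vector set \<Rightarrow> ('v \<Rightarrow> 'v \<Rightarrow> 'v \<Rightarrow> real) set" where
  "Alt3 V = {\<tau> \<in> Lin V (Alt2 V). \<forall>x\<in>V. \<tau> x x = 0}"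

definition eigenvalue_on :: "'v::real_vector set \<Rightarrow> ('v \<Rightarrow> 'v) \<Rightarrow> real \<Rightarrow> bool" where
  "eigenvalue_on V f c \<longleftrightarrow> (\<exists>v\<in>V. v \<noteq> 0 \<and> f v = c *\<^sub>R v)"

primrec Ck_on :: "nat \<Rightarrow> 'e::real_normed_vector set \<Rightarrow> ('e \<Rightarrow> 'f::real_normed_vector) \<Rightarrow> bool" where
  "Ck_on 0 S f \<longleftrightarrow> continuous_on S f"
| "Ck_on (Suc k) S f \<longleftrightarrow>
     (\<forall>x\<in>S. f differentiable (at x)) \<and> (\<forall>w. Ck_on k S (\<lambda>x. frechet_derivative f (at x) w))"

text \<open>Only used for open \<open>S\<close> in a finite-dimensional space, where it is the usual notion.\<close>

definition smooth_on :: "'e::real_normed_vector set \<Rightarrow> ('e \<Rightarrow> 'f::real_normed_vector) \<Rightarrow> bool" where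
  "smooth_on S f \<longleftrightarrow> (\<forall>k. Ck_on k S f)"

text \<open>The manifold is the type \<^typ>\<open>'a\<close>; it is Hausdorff and second countable by its type
  classes in the theorem. The charts take values in a finite-dimensional Euclidean space \<^typ>\<open>'e\<close>.
  The class \<^class>\<open>euclidean_space\<close> is not used for it because it excludes dimension \<open>0\<close>.
  Completeness (class \<^class>\<open>banach\<close>) is automatic in finite dimension.\<close>

type_synonym ('a, 'e) atlas = "('a set \<times> ('a \<Rightarrow> 'e)) set"

definition smooth_atlas ::
  "('a::{t2_space,second_countable_topology}, 'e::{real_inner,banach}) atlas \<Rightarrow> bool" where
  "smooth_atlas A \<longleftrightarrow>
     (\<exists>B::'e set. finite B \<and> span B = UNIV) \<and>
     (\<Union>(U, \<phi>)\<in>A. U) = UNIV \<and>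
     (\<forall>(U, \<phi>)\<in>A. open U \<and> open (\<phi> ` U) \<and> homeomorphism U (\<phi> ` U) \<phi> (inv_into U \<phi>)) \<and>
     (\<forall>(U, \<phi>)\<in>A. \<forall>(V, \<psi>)\<in>A. smooth_on (\<phi> ` (U \<inter> V)) (\<psi> \<circ> inv_into U \<phi>))"

definition smooth_fun :: "('a, 'e::real_normed_vector) atlas \<Rightarrow> ('a \<Rightarrow> real) \<Rightarrow> bool" where
  "smooth_fun A f \<longleftrightarrow> (\<forall>(U, \<phi>)\<in>A. smooth_on (\<phi> ` U) (f \<circ> inv_into U \<phi>))"

type_synonym 'a tvec = "('a \<Rightarrow> real) \<Rightarrow> real"
type_synonym 'a covec = "'a tvec \<Rightarrow> real"
type_synonym 'a vfield = "'a \<Rightarrow> 'a tvec"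
type_synonym 'a form1 = "'a \<Rightarrow> 'a covec"
type_synonym 'a form2 = "'a \<Rightarrow> 'a tvec \<Rightarrow> 'a tvec \<Rightarrow> real"
type_synonym 'a bivec = "'a \<Rightarrow> 'a covec \<Rightarrow> 'a covec \<Rightarrow> real"
type_synonym 'a trivec = "'a \<Rightarrow> 'a covec \<Rightarrow> 'a covec \<Rightarrow> 'a covec \<Rightarrow> real"
type_synonym 'a endo = "'a \<Rightarrow> 'a tvec \<Rightarrow> 'a tvec"

text \<open>\<open>T\<^sub>pM\<close>: the derivations at \<open>p\<close> of the algebra of smooth functions, extended by \<open>0\<close> to
  non-smooth functions.\<close>

definition tangent :: "('a, 'e::real_normed_vector) atlas \<Rightarrow> 'a \<Rightarrow> 'a tvec set" where
  "tangent A p = {v \<in> Lin {f. smooth_fun A f} UNIV.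
     \<forall>f g. smooth_fun A f \<longrightarrow> smooth_fun A g \<longrightarrow> v (f * g) = f p * v g + g p * v f}"

definition cotangent :: "('a, 'e::real_normed_vector) atlas \<Rightarrow> 'a \<Rightarrow> 'a covec set" where
  "cotangent A p = Lin (tangent A p) UNIV"

text \<open>Pointwise application of fields: \<open>\<alpha> \<odot> X\<close> is \<open>\<alpha>(X)\<close>, \<open>F \<odot> X\<close> is \<open>FX\<close>,
  \<open>\<theta> \<odot> X\<close> is \<open>i(X)\<theta>\<close>, \<open>\<theta> \<odot> X \<odot> Y\<close> is \<open>\<theta>(X,Y)\<close>.\<close>

definition ev :: "('a \<Rightarrow> 'b \<Rightarrow> 'c) \<Rightarrow> ('a \<Rightarrow> 'b) \<Rightarrow> 'a \<Rightarrow> 'c" (infixl \<open>\<odot>\<close> 90) where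
  "s \<odot> t = (\<lambda>p. s p (t p))"

definition deriv_along :: "'a vfield \<Rightarrow> ('a \<Rightarrow> real) \<Rightarrow> 'a \<Rightarrow> real" (infixr \<open>\<triangleright>\<close> 85) where
  "X \<triangleright> f = (\<lambda>p. X p f)"

definition fscale :: "('a \<Rightarrow> real) \<Rightarrow> ('a \<Rightarrow> 'b::real_vector) \<Rightarrow> 'a \<Rightarrow> 'b" (infixr \<open>\<cdot>\<close> 80) where
  "f \<cdot> s = (\<lambda>p. f p *\<^sub>R s p)"

definition vector_field :: "('a, 'e::real_normed_vector) atlas \<Rightarrow> 'a vfield \<Rightarrow> bool" where
  "vector_field A X \<longleftrightarrow> (\<forall>p. X p \<in> tangent A p) \<and> (\<forall>f. smooth_fun A f \<longrightarrow> smooth_fun A (X \<triangleright> f))"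

definition one_form :: "('a, 'e::real_normed_vector) atlas \<Rightarrow> 'a form1 \<Rightarrow> bool" where
  "one_form A \<alpha> \<longleftrightarrow> (\<forall>p. \<alpha> p \<in> cotangent A p) \<and>
     (\<forall>X. vector_field A X \<longrightarrow> smooth_fun A (\<alpha> \<odot> X))"

definition two_form :: "('a, 'e::real_normed_vector) atlas \<Rightarrow> 'a form2 \<Rightarrow> bool" where
  "two_form A \<theta> \<longleftrightarrow> (\<forall>p. \<theta> p \<in> Alt2 (tangent A p)) \<and>
     (\<forall>X Y. vector_field A X \<longrightarrow> vector_field A Y \<longrightarrow> smooth_fun A (\<theta> \<odot> X \<odot> Y))"

definition bivector_field :: "('a, 'e::real_normed_vector) atlas \<Rightarrow> 'a bivec \<Rightarrow> bool" where
  "bivector_field A P \<longleftrightarrow> (\<forall>p. P p \<in> Alt2 (cotangent A p)) \<and>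
     (\<forall>\<alpha> \<beta>. one_form A \<alpha> \<longrightarrow> one_form A \<beta> \<longrightarrow> smooth_fun A (P \<odot> \<alpha> \<odot> \<beta>))"

definition trivector_field :: "('a, 'e::real_normed_vector) atlas \<Rightarrow> 'a trivec \<Rightarrow> bool" where
  "trivector_field A T \<longleftrightarrow> (\<forall>p. T p \<in> Alt3 (cotangent A p)) \<and>
     (\<forall>\<alpha> \<beta> \<gamma>. one_form A \<alpha> \<longrightarrow> one_form A \<beta> \<longrightarrow> one_form A \<gamma> \<longrightarrow> smooth_fun A (T \<odot> \<alpha> \<odot> \<beta> \<odot> \<gamma>))"

definition endo_field :: "('a, 'e::real_normed_vector) atlas \<Rightarrow> 'a endo \<Rightarrow> bool" where
  "endo_field A F \<longleftrightarrow> (\<forall>p. F p \<in> Lin (tangent A p) (tangent A p)) \<and>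
     (\<forall>X. vector_field A X \<longrightarrow> vector_field A (F \<odot> X))"

text \<open>Well defined because \<open>T\<^sub>pM\<close> is finite-dimensional.\<close>

definition sharp :: "('a, 'e::real_normed_vector) atlas \<Rightarrow> 'a bivec \<Rightarrow> 'a \<Rightarrow> 'a covec \<Rightarrow> 'a tvec" where
  "sharp A P p \<alpha> = (THE v. v \<in> tangent A p \<and> (\<forall>\<beta>\<in>cotangent A p. \<beta> v = P p \<alpha> \<beta>))"

definition flat :: "'a form2 \<Rightarrow> 'a \<Rightarrow> 'a tvec \<Rightarrow> 'a covec" where
  "flat \<theta> p v = (\<lambda>w. \<theta> p v w)"

definition form_comp :: "'a form1 \<Rightarrow> 'a endo \<Rightarrow> 'a form1" where
  "form_comp \<alpha> F = (\<lambda>p. \<alpha> p \<circ> F p)"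

definition form2_comp :: "'a form2 \<Rightarrow> 'a endo \<Rightarrow> 'a form2" where
  "form2_comp \<theta> F = (\<lambda>p v w. \<theta> p (F p v) w)"

definition lie_bracket :: "'a vfield \<Rightarrow> 'a vfield \<Rightarrow> 'a vfield" where
  "lie_bracket X Y = (\<lambda>p f. X p (Y \<triangleright> f) - Y p (X \<triangleright> f))"

definition dfun :: "('a, 'e::real_normed_vector) atlas \<Rightarrow> ('a \<Rightarrow> real) \<Rightarrow> 'a form1" where
  "dfun A f = (\<lambda>p v. if v \<in> tangent A p then v f else 0)"

definition d1 :: "'a form1 \<Rightarrow> 'a vfield \<Rightarrow> 'a vfield \<Rightarrow> 'a \<Rightarrow> real" where
  "d1 \<xi> X Y = X \<triangleright> (\<xi> \<odot> Y) - Y \<triangleright> (\<xi> \<odot> X) - \<xi> \<odot> lie_bracket X Y"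

definition d2 :: "'a form2 \<Rightarrow> 'a vfield \<Rightarrow> 'a vfield \<Rightarrow> 'a vfield \<Rightarrow> 'a \<Rightarrow> real" where
  "d2 \<theta> X Y Z = X \<triangleright> (\<theta> \<odot> Y \<odot> Z) + Y \<triangleright> (\<theta> \<odot> Z \<odot> X) + Z \<triangleright> (\<theta> \<odot> X \<odot> Y)
     - \<theta> \<odot> lie_bracket X Y \<odot> Z - \<theta> \<odot> lie_bracket Y Z \<odot> X - \<theta> \<odot> lie_bracket Z X \<odot> Y"

text \<open>Meaningful only for operators \<open>\<Phi>\<close> that are linear over the smooth functions; these are exactly
  the operators that come from a \<open>1\<close>-form.\<close>

definition form_of :: "('a, 'e::real_normed_vector) atlas \<Rightarrow> ('a vfield \<Rightarrow> 'a \<Rightarrow> real) \<Rightarrow> 'a form1" where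
  "form_of A \<Phi> = (THE \<gamma>. one_form A \<gamma> \<and> (\<forall>Z. vector_field A Z \<longrightarrow> \<gamma> \<odot> Z = \<Phi> Z))"

definition contr_d2 ::
  "('a, 'e::real_normed_vector) atlas \<Rightarrow> 'a form2 \<Rightarrow> 'a vfield \<Rightarrow> 'a vfield \<Rightarrow> 'a form1" where
  "contr_d2 A \<theta> X Y = form_of A (d2 \<theta> X Y)"

definition lie_form :: "('a, 'e::real_normed_vector) atlas \<Rightarrow> 'a vfield \<Rightarrow> 'a form1 \<Rightarrow> 'a form1" where
  "lie_form A X \<alpha> = form_of A (\<lambda>Y. X \<triangleright> (\<alpha> \<odot> Y) - \<alpha> \<odot> lie_bracket X Y)"

definition lie_form2 :: "'a vfield \<Rightarrow> 'a form2 \<Rightarrow> 'a vfield \<Rightarrow> 'a vfield \<Rightarrow> 'a \<Rightarrow> real" where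
  "lie_form2 X \<theta> Y Z = X \<triangleright> (\<theta> \<odot> Y \<odot> Z) - \<theta> \<odot> lie_bracket X Y \<odot> Z - \<theta> \<odot> Y \<odot> lie_bracket X Z"

definition lie_bivec :: "('a, 'e::real_normed_vector) atlas \<Rightarrow> 'a vfield \<Rightarrow> 'a bivec \<Rightarrow>
    'a form1 \<Rightarrow> 'a form1 \<Rightarrow> 'a \<Rightarrow> real" where
  "lie_bivec A X P \<alpha> \<beta> = X \<triangleright> (P \<odot> \<alpha> \<odot> \<beta>) - P \<odot> lie_form A X \<alpha> \<odot> \<beta> - P \<odot> \<alpha> \<odot> lie_form A X \<beta>"

definition lie_endo :: "'a vfield \<Rightarrow> 'a endo \<Rightarrow> 'a vfield \<Rightarrow> 'a vfield" where
  "lie_endo X F Y = lie_bracket X (F \<odot> Y) - F \<odot> lie_bracket X Y"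

definition nijenhuis :: "'a endo \<Rightarrow> 'a vfield \<Rightarrow> 'a vfield \<Rightarrow> 'a vfield" where
  "nijenhuis F X Y = lie_bracket (F \<odot> X) (F \<odot> Y) - F \<odot> lie_bracket X (F \<odot> Y)
     - F \<odot> lie_bracket (F \<odot> X) Y + F \<odot> (F \<odot> lie_bracket X Y)"

definition schouten_concomitant :: "('a, 'e::real_normed_vector) atlas \<Rightarrow> 'a bivec \<Rightarrow> 'a endo \<Rightarrow>
    'a form1 \<Rightarrow> 'a vfield \<Rightarrow> 'a vfield" where
  "schouten_concomitant A P F \<alpha> X =
     sharp A P \<odot> (lie_form A X (form_comp \<alpha> F) - lie_form A (F \<odot> X) \<alpha>)
     - lie_endo (sharp A P \<odot> \<alpha>) F X"

text \<open>The Schouten-Nijenhuis bracket of two bivector fields is the trivector field determined by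
  the rule
  \<open>[X\<^sub>1 \<and> X\<^sub>2, Y\<^sub>1 \<and> Y\<^sub>2] = \<Sum>\<^sub>i\<^sub>,\<^sub>j (-1)\<^sup>i\<^sup>+\<^sup>j [X\<^sub>i,Y\<^sub>j] \<and> X\<^sub>i\<^sub>' \<and> Y\<^sub>j\<^sub>'\<close>
  (\<open>i'\<close>, \<open>j'\<close> the complementary indices), bilinearity, and locality. Bivector fields are locally
  finite sums of decomposable ones.\<close>

definition wedge2 :: "'a tvec \<Rightarrow> 'a tvec \<Rightarrow> 'a covec \<Rightarrow> 'a covec \<Rightarrow> real" where
  "wedge2 v w \<alpha> \<beta> = \<alpha> v * \<beta> w - \<alpha> w * \<beta> v"

definition wedge3 :: "'a tvec \<Rightarrow> 'a tvec \<Rightarrow> 'a tvec \<Rightarrow> 'a covec \<Rightarrow> 'a covec \<Rightarrow> 'a covec \<Rightarrow> real" where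
  "wedge3 u v w \<alpha> \<beta> \<gamma> = \<alpha> u * wedge2 v w \<beta> \<gamma> - \<alpha> v * wedge2 u w \<beta> \<gamma> + \<alpha> w * wedge2 u v \<beta> \<gamma>"

definition decomposes_on :: "('a, 'e::real_normed_vector) atlas \<Rightarrow> 'a set \<Rightarrow> 'a bivec \<Rightarrow>
    nat \<Rightarrow> (nat \<Rightarrow> 'a vfield) \<Rightarrow> (nat \<Rightarrow> 'a vfield) \<Rightarrow> bool" where
  "decomposes_on A U P n X X' \<longleftrightarrow>
     (\<forall>i<n. vector_field A (X i) \<and> vector_field A (X' i)) \<and>
     (\<forall>p\<in>U. \<forall>\<alpha>\<in>cotangent A p. \<forall>\<beta>\<in>cotangent A p. P p \<alpha> \<beta> = (\<Sum>i<n. wedge2 (X i p) (X' i p) \<alpha> \<beta>))"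

definition schouten_bracket ::
  "('a::topological_space, 'e::real_normed_vector) atlas \<Rightarrow> 'a bivec \<Rightarrow> 'a bivec \<Rightarrow> 'a trivec" where
  "schouten_bracket A P Q = (THE T. trivector_field A T \<and>
     (\<forall>U n X X' m Y Y'. open U \<longrightarrow> decomposes_on A U P n X X' \<longrightarrow> decomposes_on A U Q m Y Y' \<longrightarrow>
       (\<forall>p\<in>U. \<forall>\<alpha>\<in>cotangent A p. \<forall>\<beta>\<in>cotangent A p. \<forall>\<gamma>\<in>cotangent A p.
         T p \<alpha> \<beta> \<gamma> = (\<Sum>i<n. \<Sum>j<m.
             wedge3 (lie_bracket (X i) (Y j) p) (X' i p) (Y' j p) \<alpha> \<beta> \<gamma>
           - wedge3 (lie_bracket (X i) (Y' j) p) (X' i p) (Y j p) \<alpha> \<beta> \<gamma>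
           - wedge3 (lie_bracket (X' i) (Y j) p) (X i p) (Y' j p) \<alpha> \<beta> \<gamma>
           + wedge3 (lie_bracket (X' i) (Y' j) p) (X i p) (Y j p) \<alpha> \<beta> \<gamma>))))"

definition gen_almost_contact :: "('a, 'e::real_normed_vector) atlas \<Rightarrow> nat \<Rightarrow> 'a bivec \<Rightarrow> 'a form2 \<Rightarrow>
    'a endo \<Rightarrow> (nat \<Rightarrow> 'a vfield) \<Rightarrow> (nat \<Rightarrow> 'a form1) \<Rightarrow> bool" where
  "gen_almost_contact A h P \<theta> F Z \<xi> \<longleftrightarrow>
     bivector_field A P \<and> two_form A \<theta> \<and> endo_field A F \<and>
     (\<forall>a\<in>{1..h}. vector_field A (Z a) \<and> one_form A (\<xi> a)) \<and>
     (\<forall>p. \<forall>\<alpha>\<in>cotangent A p. \<forall>\<beta>\<in>cotangent A p. P p (\<alpha> \<circ> F p) \<beta> = P p \<alpha> (\<beta> \<circ> F p)) \<and>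
     (\<forall>p. \<forall>v\<in>tangent A p. \<forall>w\<in>tangent A p. \<theta> p (F p v) w = \<theta> p v (F p w)) \<and>
     (\<forall>a\<in>{1..h}. F \<odot> Z a = 0 \<and> form_comp (\<xi> a) F = 0 \<and> \<theta> \<odot> Z a = 0 \<and> P \<odot> \<xi> a = 0) \<and>
     (\<forall>a\<in>{1..h}. \<forall>b\<in>{1..h}. \<forall>p. \<xi> a p (Z b p) = (if a = b then 1 else 0)) \<and>
     (\<forall>p. \<forall>v\<in>tangent A p.
        F p (F p v) = - v - sharp A P p (flat \<theta> p v) + (\<Sum>a\<in>{1..h}. \<xi> a p v *\<^sub>R Z a p))"

text \<open>A section \<open>((X,u),(\<alpha>,v))\<close> of \<open>(TM \<times> \<real>\<^sup>h) \<oplus> (T\<^sup>*M \<times> \<real>\<^sup>h)\<close>. The components of \<open>u\<close> and \<open>v\<close>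
  are indexed by \<open>{1..h}\<close> (\<open>h = 0\<close> is allowed) and put to \<open>0\<close> elsewhere.\<close>

type_synonym 'a bsec = "('a vfield \<times> (nat \<Rightarrow> 'a \<Rightarrow> real)) \<times> ('a form1 \<times> (nat \<Rightarrow> 'a \<Rightarrow> real))"

definition big_section :: "('a, 'e::real_normed_vector) atlas \<Rightarrow> nat \<Rightarrow> 'a bsec \<Rightarrow> bool" where
  "big_section A h = (\<lambda>((X, u), (\<alpha>, v)). vector_field A X \<and> one_form A \<alpha> \<and>
     (\<forall>a\<in>{1..h}. smooth_fun A (u a) \<and> smooth_fun A (v a)) \<and> (\<forall>a. a \<notin> {1..h} \<longrightarrow> u a = 0 \<and> v a = 0))"

definition big_Phi :: "('a, 'e::real_normed_vector) atlas \<Rightarrow> nat \<Rightarrow> 'a bivec \<Rightarrow> 'a form2 \<Rightarrow>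
    'a endo \<Rightarrow> (nat \<Rightarrow> 'a vfield) \<Rightarrow> (nat \<Rightarrow> 'a form1) \<Rightarrow> 'a bsec \<Rightarrow> 'a bsec" where
  "big_Phi A h P \<theta> F Z \<xi> = (\<lambda>((X, u), (\<alpha>, v)).
     ((F \<odot> X + sharp A P \<odot> \<alpha> - (\<Sum>a\<in>{1..h}. v a \<cdot> Z a),
       \<lambda>a. if a \<in> {1..h} then \<alpha> \<odot> Z a else 0),
      (flat \<theta> \<odot> X - (\<Sum>a\<in>{1..h}. u a \<cdot> \<xi> a) - form_comp \<alpha> F,
       \<lambda>a. if a \<in> {1..h} then \<xi> a \<odot> X else 0)))"

definition courant :: "('a, 'e::real_normed_vector) atlas \<Rightarrow> nat \<Rightarrow> 'a bsec \<Rightarrow> 'a bsec \<Rightarrow> 'a bsec" where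
  "courant A h = (\<lambda>((X\<^sub>1, u\<^sub>1), (\<alpha>\<^sub>1, v\<^sub>1)) ((X\<^sub>2, u\<^sub>2), (\<alpha>\<^sub>2, v\<^sub>2)).
     ((lie_bracket X\<^sub>1 X\<^sub>2, \<lambda>a. X\<^sub>1 \<triangleright> u\<^sub>2 a - X\<^sub>2 \<triangleright> u\<^sub>1 a),
      (lie_form A X\<^sub>1 \<alpha>\<^sub>2 - lie_form A X\<^sub>2 \<alpha>\<^sub>1 + (1/2) *\<^sub>R dfun A (\<alpha>\<^sub>1 \<odot> X\<^sub>2 - \<alpha>\<^sub>2 \<odot> X\<^sub>1)
        + (1/2) *\<^sub>R (\<Sum>a\<in>{1..h}. u\<^sub>2 a \<cdot> dfun A (v\<^sub>1 a) + v\<^sub>2 a \<cdot> dfun A (u\<^sub>1 a)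
                               - u\<^sub>1 a \<cdot> dfun A (v\<^sub>2 a) - v\<^sub>1 a \<cdot> dfun A (u\<^sub>2 a)),
       \<lambda>a. X\<^sub>1 \<triangleright> v\<^sub>2 a - X\<^sub>2 \<triangleright> v\<^sub>1 a)))"

text \<open>Sections of the complexified bundle are pairs \<open>(e,e')\<close> standing for \<open>e + \<surd>-1 e'\<close>.\<close>

definition courant_C :: "('a, 'e::real_normed_vector) atlas \<Rightarrow> nat \<Rightarrow>
    'a bsec \<times> 'a bsec \<Rightarrow> 'a bsec \<times> 'a bsec \<Rightarrow> 'a bsec \<times> 'a bsec" where
  "courant_C A h = (\<lambda>(e\<^sub>1, e\<^sub>1') (e\<^sub>2, e\<^sub>2').
     (courant A h e\<^sub>1 e\<^sub>2 - courant A h e\<^sub>1' e\<^sub>2', courant A h e\<^sub>1 e\<^sub>2' + courant A h e\<^sub>1' e\<^sub>2))"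

definition times_i :: "'a bsec \<times> 'a bsec \<Rightarrow> 'a bsec \<times> 'a bsec" where
  "times_i = (\<lambda>(e, e'). (- e', e))"

definition i_eigensections :: "('a, 'e::real_normed_vector) atlas \<Rightarrow> nat \<Rightarrow>
    ('a bsec \<Rightarrow> 'a bsec) \<Rightarrow> ('a bsec \<times> 'a bsec) set" where
  "i_eigensections A h \<Phi> = {(e, e'). big_section A h e \<and> big_section A h e' \<and>
     (\<Phi> e, \<Phi> e') = times_i (e, e')}"

definition normal_structure :: "('a, 'e::real_normed_vector) atlas \<Rightarrow> nat \<Rightarrow> 'a bivec \<Rightarrow> 'a form2 \<Rightarrow>
    'a endo \<Rightarrow> (nat \<Rightarrow> 'a vfield) \<Rightarrow> (nat \<Rightarrow> 'a form1) \<Rightarrow> bool" where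
  "normal_structure A h P \<theta> F Z \<xi> \<longleftrightarrow>
     (\<forall>s\<in>i_eigensections A h (big_Phi A h P \<theta> F Z \<xi>).
      \<forall>t\<in>i_eigensections A h (big_Phi A h P \<theta> F Z \<xi>).
        courant_C A h s t \<in> i_eigensections A h (big_Phi A h P \<theta> F Z \<xi>))"

end

theory Submission
  imports Defs
begin

text \<open>On pairs of sections, normality says that the Nijenhuis torsion of \<open>\<Phi>\<close> vanishes, because the
  \<open>\<surd>-1\<close>-eigensections are the sections \<open>e - \<surd>-1 \<Phi>e\<close>. Paired with a third section, the torsion is the
  trilinear expression \<open>T(e\<^sub>1,e\<^sub>2,e\<^sub>3)\<close> built from \<open>\<langle>[e\<^sub>1,e\<^sub>2],e\<^sub>3\<rangle>\<close>. The Courant bracket fails to be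
  compatible with the pairing only by derivatives of pairings, and these cancel in \<open>T\<close> as \<open>\<Phi>\<close> is
  skew and \<open>\<Phi>\<^sup>2 = -Id\<close>. Hence \<open>T\<close> is totally skew, so it is linear over functions in each slot and
  vanishes iff it does on vector fields, \<open>1\<close>-forms and the constant sections of the two copies of
  \<open>\<real>\<^sup>h\<close>. Up to order this gives twenty triples. On nine of them \<open>T\<close> is zero, eight give the eight
  conditions of the theorem, and the other three say \<open>L\<^sub>Z \<xi> = 0\<close>, \<open>L\<^sub>Z F = 0\<close> and
  \<open>d\<xi>(FX,Y) + d\<xi>(X,FY) = 0\<close>. The last three follow from the eight: contracting the formula
  for the Nijenhuis tensor of \<open>F\<close> with \<open>\<xi>\<close> gives \<open>d\<xi>(FX,FY) = d\<xi>(X,Y)\<close>, and \<open>V = (L\<^sub>Z F)Y\<close> satisfies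
  \<open>FV = 0\<close> and \<open>\<xi>(V) = 0\<close>, so that \<open>\<sharp>\<flat>V = -V\<close> and \<open>V = 0\<close> by the hypothesis on the eigenvalues.\<close>

section \<open>Smooth functions on Euclidean spaces\<close>

text \<open>The identities of the overview presuppose that the objects in them exist.
  \<open>sharp\<close>, \<open>form_of\<close> (hence Lie derivatives of forms and contractions of
  d\<theta>) and \<open>schouten_bracket\<close> are definite descriptions, and tangent vectors are
  derivations of global functions. What gives the descriptions a meaning is a local frame of
  globally defined fields: it extends vectors and covectors to fields, shows that a function-linear
  operator depends only on values at a point, and splits a bivector field into decomposable ones.
  That the cut-off coordinate fields span all derivations is Hadamard's lemma, and cutting off
  requires bump functions; hence the calculus at the start. The Schouten bracket is prescribed
  through decompositions, which are far from unique. Every prescribed sum is shown to be twice the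
  Jacobi expression of P, in which no decomposition occurs; this settles both the consistency of the
  rule and the meaning of [P,P] = 0. From there on no chart is used: fields and sections are
  compared by pairing them with test objects.\<close>

lemma Ck_on_cong:
  assumes "open S" "Ck_on k S f" "\<And>x. x \<in> S \<Longrightarrow> f x = g x"
  shows "Ck_on k S g"
  using assms(2,3)
proof (induction k arbitrary: f g)
  case 0
  then show ?case by (simp cong: continuous_on_cong)
next
  case (Suc k)
  have d: "f differentiable (at x)" if "x \<in> S" for x using Suc.prems(1) that by simp
  have g: "g differentiable (at x)" if "x \<in> S" for x
    using d[OF that] has_derivative_transform_within_open[of f _ x UNIV S g, OF _ \<open>open S\<close> that Suc.prems(2)]
    unfolding differentiable_def by blast
  have "Ck_on k S (\<lambda>x. frechet_derivative g (at x) w)" for w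
  proof (rule Suc.IH)
    show "Ck_on k S (\<lambda>x. frechet_derivative f (at x) w)" using Suc.prems(1) by simp
    show "frechet_derivative f (at x) w = frechet_derivative g (at x) w" if "x \<in> S" for x
      using frechet_derivative_transform_within_open[OF d[OF that] \<open>open S\<close> that Suc.prems(2)] by simp
  qed
  then show ?case using g by simp
qed

lemma Ck_on_SucD: "Ck_on (Suc k) S f \<Longrightarrow> Ck_on k S f"
proof (induction k arbitrary: f)
  case 0
  then show ?case
    by (auto simp: continuous_on_eq_continuous_at intro!: continuous_at_imp_continuous_on
        differentiable_imp_continuous_within)
next
  case (Suc k)
  then show ?case by simp
qed

lemma Ck_on_subset: "Ck_on k S f \<Longrightarrow> T \<subseteq> S \<Longrightarrow> Ck_on k T f"
  by (induction k arbitrary: f) (auto intro: continuous_on_subset)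

text \<open>Derivatives are taken in the whole space and not within S, so each condition can be
  checked on any open neighbourhood of the point.\<close>

lemma Ck_on_local:
  assumes "\<And>x. x \<in> S \<Longrightarrow> \<exists>T. open T \<and> x \<in> T \<and> Ck_on k T f"
  shows "Ck_on k S f"
  using assms
proof (induction k arbitrary: f)
  case 0
  show ?case unfolding Ck_on.simps
  proof (intro continuous_at_imp_continuous_on ballI)
    fix x assume "x \<in> S"
    with 0 obtain T where "open T" "x \<in> T" "Ck_on 0 T f" by meson
    then show "isCont f x" by (simp add: continuous_on_eq_continuous_at)
  qed
next
  case (Suc k)
  have "Ck_on k S (\<lambda>x. frechet_derivative f (at x) w)" for w
    by (rule Suc.IH) (metis Suc.prems Ck_on.simps(2))
  moreover have "\<forall>x\<in>S. f differentiable (at x)" using Suc.prems by force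
  ultimately show ?case by simp
qed

text \<open>On an open set a derivative found by the usual rules may replace the chosen
  \<open>frechet_derivative\<close>, also inside all further derivatives. The closure properties
  below are inductions through this rule.\<close>

lemma Ck_on_SucI:
  assumes "open S" "\<And>x. x \<in> S \<Longrightarrow> (f has_derivative f' x) (at x)" "\<And>w. Ck_on k S (\<lambda>x. f' x w)"
  shows "Ck_on (Suc k) S f"
proof -
  have "f' x = frechet_derivative f (at x)" if "x \<in> S" for x
    by (rule frechet_derivative_at) (rule assms(2)[OF that])
  then have "Ck_on k S (\<lambda>x. frechet_derivative f (at x) w)" for w
    by (intro Ck_on_cong[OF \<open>open S\<close> assms(3)]) simp
  then show ?thesis using assms(2) by (auto simp: differentiable_def)
qed

lemma Ck_on_has_derivative:
  "Ck_on (Suc k) S f \<Longrightarrow> x \<in> S \<Longrightarrow> (f has_derivative frechet_derivative f (at x)) (at x)"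
  by (simp add: frechet_derivative_works)

lemma Ck_on_const: "open S \<Longrightarrow> Ck_on k S (\<lambda>x. c)"
proof (induction k arbitrary: c)
  case (Suc k)
  show ?case by (rule Ck_on_SucI[where f'="\<lambda>x w. 0"]) (use Suc in auto)
qed simp

lemma Ck_on_add:
  "open S \<Longrightarrow> Ck_on k S f \<Longrightarrow> Ck_on k S g \<Longrightarrow> Ck_on k S (\<lambda>x. f x + g x)"
proof (induction k arbitrary: f g)
  case 0
  then show ?case by (simp add: continuous_on_add)
next
  case (Suc k)
  show ?case
    by (rule Ck_on_SucI[OF Suc.prems(1) has_derivative_add[OF Ck_on_has_derivative Ck_on_has_derivative]])
       (use Suc in auto)
qed

text \<open>The product rule yields two terms of the same shape, with one factor differentiated in
  each, so the induction has to vary both factors.\<close>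

lemma Ck_on_bilinear:
  assumes "bounded_bilinear pr" "open S"
  shows "Ck_on k S f \<Longrightarrow> Ck_on k S g \<Longrightarrow> Ck_on k S (\<lambda>x. pr (f x) (g x))"
proof (induction k arbitrary: f g)
  case 0
  then show ?case by (simp add: bounded_bilinear.continuous_on[OF assms(1)])
next
  case (Suc k)
  note fg = Suc.prems[THEN Ck_on_SucD]
  show ?case
    by (rule Ck_on_SucI[OF \<open>open S\<close> bounded_bilinear.FDERIV[OF assms(1) Ck_on_has_derivative Ck_on_has_derivative]])
       (use Suc fg in \<open>auto intro!: Ck_on_add \<open>open S\<close>\<close>)
qed

lemma Ck_on_bounded_linear:
  assumes "bounded_linear L" "open S"
  shows "Ck_on k S L"
proof (cases k)
  case 0
  then show ?thesis using assms by (simp add: linear_continuous_on)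
next
  case (Suc k)
  show ?thesis unfolding Suc
    by (rule Ck_on_SucI[where f'="\<lambda>x. L"])
       (use assms in \<open>auto intro: Ck_on_const bounded_linear_imp_has_derivative\<close>)
qed

lemma Ck_on_sum:
  "open S \<Longrightarrow> (\<And>i. i \<in> I \<Longrightarrow> Ck_on k S (f i)) \<Longrightarrow> Ck_on k S (\<lambda>x. \<Sum>i\<in>I. f i x)"
  by (induction I rule: infinite_finite_induct) (simp_all add: Ck_on_const Ck_on_add)

text \<open>The coordinate expansion is what the chain rule needs, since \<^const>\<open>Ck_on\<close> only speaks of
  derivatives in fixed directions.\<close>

definition onb :: "'e::real_inner set \<Rightarrow> bool" where
  "onb B \<longleftrightarrow> finite B \<and> (\<forall>b\<in>B. \<forall>c\<in>B. b \<bullet> c = (if b = c then 1 else 0)) \<and>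
     (\<forall>x. (\<Sum>b\<in>B. (x \<bullet> b) *\<^sub>R b) = x)"

section \<open>Orthonormal bases and the chain rule\<close>

text \<open>Normalize an orthogonal spanning set after removing 0. The defect of the expansion of a
  vector is orthogonal to all generators, hence to itself. In dimension 0 the basis is
  empty.\<close>

lemma onb_exists:
  assumes "finite (B0::'e::real_inner set)" "span B0 = UNIV"
  shows "\<exists>B::'e set. onb B"
proof -
  obtain C :: "'e set" where C: "finite C" "span C = UNIV" "pairwise orthogonal C"
    using basis_orthogonal[OF assms(1)] assms(2) by auto
  define B where "B = (\<lambda>x. x /\<^sub>R norm x) ` (C - {0})"
  have fin: "finite B" using C unfolding B_def by simp
  have orth: "b \<bullet> c = (if b = c then 1 else 0)" if bc: "b \<in> B" "c \<in> B" for b c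
  proof -
    obtain x y where xy: "x \<in> C" "x \<noteq> 0" "b = x /\<^sub>R norm x" "y \<in> C" "y \<noteq> 0" "c = y /\<^sub>R norm y"
      using bc unfolding B_def by auto
    show ?thesis
    proof (cases "b = c")
      case True
      then show ?thesis using xy by (simp add: power2_norm_eq_inner[symmetric] power2_eq_square)
    next
      case False
      then have "x \<noteq> y" using xy by auto
      then have "x \<bullet> y = 0" using C(3) xy by (auto simp: pairwise_def orthogonal_def)
      then show ?thesis using False xy by simp
    qed
  qed
  have "(\<Sum>b\<in>B. (x \<bullet> b) *\<^sub>R b) = x" for x
  proof -
    define y where "y = x - (\<Sum>b\<in>B. (x \<bullet> b) *\<^sub>R b)"
    have yb: "y \<bullet> b = 0" if "b \<in> B" for b
    proof -
      have "(\<Sum>a\<in>B. (x \<bullet> a) * (a \<bullet> b)) = (\<Sum>a\<in>B. if a = b then x \<bullet> b else 0)"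
        by (rule sum.cong) (use orth that in auto)
      then show ?thesis using that fin by (simp add: y_def inner_diff_left inner_sum_left sum.delta)
    qed
    have "y \<bullet> c = 0" if "c \<in> C" for c
    proof (cases "c = 0")
      case False
      then have "y \<bullet> (c /\<^sub>R norm c) = 0" using that by (intro yb) (auto simp: B_def)
      then show ?thesis using False by simp
    qed simp
    then have C0: "\<And>c. c \<in> C \<Longrightarrow> y \<bullet> c = 0" .
    have "y \<bullet> z = 0" if "z \<in> span C" for z
      using that by (induction rule: span_induct_alt) (auto simp: inner_add_right C0)
    then have "y \<bullet> y = 0" using C(2) by blast
    then show ?thesis by (simp add: y_def)
  qed
  then show ?thesis using fin orth unfolding onb_def by blast
qed

text \<open>Serves compositions whose inner function is real-valued, as in
  \<open>bump_ball\<close>.\<close>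

lemma onb_real: "onb {1::real}"
  by (simp add: onb_def)

lemma onb_linear:
  assumes "onb B" "linear L"
  shows "L x = (\<Sum>b\<in>B. (x \<bullet> b) *\<^sub>R L b)"
proof -
  have "L x = L (\<Sum>b\<in>B. (x \<bullet> b) *\<^sub>R b)" using assms by (simp add: onb_def)
  then show ?thesis by (simp add: linear_sum[OF assms(2)] linear_scale[OF assms(2)])
qed

lemma Ck_on_compose:
  fixes g :: "'d::real_normed_vector \<Rightarrow> 'e::real_inner" and f :: "'e \<Rightarrow> 'f::real_normed_vector"
  assumes B: "onb (B::'e set)" and "open S" "open T"
  shows "Ck_on k S g \<Longrightarrow> Ck_on k T f \<Longrightarrow> g ` S \<subseteq> T \<Longrightarrow> Ck_on k S (\<lambda>x. f (g x))"
proof (induction k arbitrary: f)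
  case 0
  then show ?case by (auto intro: continuous_on_compose2)
next
  case (Suc k)
  let ?f' = "\<lambda>y. frechet_derivative f (at y)" and ?g' = "\<lambda>y. frechet_derivative g (at y)"
  have f': "(f has_derivative ?f' (g x)) (at (g x))" if "x \<in> S" for x
    using Suc.prems that by (intro Ck_on_has_derivative[of k T]) auto
  have "((\<lambda>x. f (g x)) has_derivative (\<lambda>w. ?f' (g x) (?g' x w))) (at x)" if "x \<in> S" for x
    using has_derivative_compose[OF Ck_on_has_derivative[OF Suc.prems(1) that] f'[OF that]] .
  moreover have "?f' (g x) v = (\<Sum>b\<in>B. (v \<bullet> b) *\<^sub>R ?f' (g x) b)" if "x \<in> S" for x v
    by (rule onb_linear[OF B has_derivative_linear[OF f'[OF that]]])
  ultimately have "((\<lambda>x. f (g x)) has_derivative (\<lambda>w. \<Sum>b\<in>B. (?g' x w \<bullet> b) *\<^sub>R ?f' (g x) b)) (at x)"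
    if "x \<in> S" for x using that by simp
  then show ?case
  proof (rule Ck_on_SucI[OF \<open>open S\<close>])
    fix w
    have "Ck_on k S (\<lambda>x. ?f' (g x) b)" for b
      using Suc.prems by (intro Suc.IH) (auto intro: Ck_on_SucD)
    moreover have "Ck_on k S (\<lambda>x. ?g' x w \<bullet> b)" for b
      using Suc.prems by (intro Ck_on_bilinear[OF bounded_bilinear_inner \<open>open S\<close>] Ck_on_const) (auto simp: \<open>open S\<close>)
    ultimately show "Ck_on k S (\<lambda>x. \<Sum>b\<in>B. (?g' x w \<bullet> b) *\<^sub>R ?f' (g x) b)"
      by (intro Ck_on_sum \<open>open S\<close> Ck_on_bilinear[OF bounded_bilinear_scaleR])
  qed
qed

section \<open>Closure properties of smooth functions\<close>

lemma smooth_on_cong: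
  "open S \<Longrightarrow> smooth_on S f \<Longrightarrow> (\<And>x. x \<in> S \<Longrightarrow> f x = g x) \<Longrightarrow> smooth_on S g"
  unfolding smooth_on_def using Ck_on_cong by blast

lemma smooth_on_subset: "smooth_on S f \<Longrightarrow> T \<subseteq> S \<Longrightarrow> smooth_on T f"
  unfolding smooth_on_def using Ck_on_subset by blast

lemma smooth_on_local:
  "(\<And>x. x \<in> S \<Longrightarrow> \<exists>T. open T \<and> x \<in> T \<and> smooth_on T f) \<Longrightarrow> smooth_on S f"
  unfolding smooth_on_def using Ck_on_local by (metis (no_types, lifting))

lemma smooth_on_const: "open S \<Longrightarrow> smooth_on S (\<lambda>x. c)"
  by (simp add: smooth_on_def Ck_on_const)

lemma smooth_on_add:
  "open S \<Longrightarrow> smooth_on S f \<Longrightarrow> smooth_on S g \<Longrightarrow> smooth_on S (\<lambda>x. f x + g x)"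
  by (simp add: smooth_on_def Ck_on_add)

lemma smooth_on_mult:
  fixes f g :: "'e::real_normed_vector \<Rightarrow> real"
  shows "open S \<Longrightarrow> smooth_on S f \<Longrightarrow> smooth_on S g \<Longrightarrow> smooth_on S (\<lambda>x. f x * g x)"
  by (simp add: smooth_on_def Ck_on_bilinear[OF bounded_bilinear_mult])

lemma smooth_on_inner:
  fixes f g :: "'e::real_normed_vector \<Rightarrow> 'f::real_inner"
  shows "open S \<Longrightarrow> smooth_on S f \<Longrightarrow> smooth_on S g \<Longrightarrow> smooth_on S (\<lambda>x. f x \<bullet> g x)"
  by (simp add: smooth_on_def Ck_on_bilinear[OF bounded_bilinear_inner])

lemma smooth_on_bounded_linear: "bounded_linear L \<Longrightarrow> open S \<Longrightarrow> smooth_on S L"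
  by (simp add: smooth_on_def Ck_on_bounded_linear)

lemma smooth_on_ident: "open S \<Longrightarrow> smooth_on S (\<lambda>x. x)"
  by (intro smooth_on_bounded_linear bounded_linear_ident)

lemma smooth_on_minus:
  fixes f g :: "'e::real_normed_vector \<Rightarrow> real"
  assumes "open S" "smooth_on S f" "smooth_on S g"
  shows "smooth_on S (\<lambda>x. f x - g x)"
  using smooth_on_add[OF assms(1,2) smooth_on_mult[OF assms(1) smooth_on_const[OF assms(1), of "-1"] assms(3)]]
  by simp

lemma smooth_on_compose:
  fixes g :: "'d::real_normed_vector \<Rightarrow> 'e::real_inner"
  shows "onb (B::'e set) \<Longrightarrow> open S \<Longrightarrow> open T \<Longrightarrow> smooth_on S g \<Longrightarrow> smooth_on T f \<Longrightarrow> g ` S \<subseteq> T \<Longrightarrow>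
    smooth_on S (\<lambda>x. f (g x))"
  unfolding smooth_on_def using Ck_on_compose by blast

lemma smooth_on_derivative:
  "smooth_on S f \<Longrightarrow> smooth_on S (\<lambda>x. frechet_derivative f (at x) w)"
  unfolding smooth_on_def by (metis Ck_on.simps(2))

lemma smooth_on_has_derivative:
  "smooth_on S f \<Longrightarrow> x \<in> S \<Longrightarrow> (f has_derivative frechet_derivative f (at x)) (at x)"
  unfolding smooth_on_def by (blast intro: Ck_on_has_derivative)

lemma smooth_on_continuous_on: "smooth_on S f \<Longrightarrow> continuous_on S f"
  unfolding smooth_on_def by (metis Ck_on.simps(1))

section \<open>Integrals with a parameter and Hadamard's lemma\<close>

text \<open>Differentiation under the integral sign. By the chain rule each derivative in x brings
  out one factor t, which is why the induction carries the weight \<open>t ^ m\<close>.\<close>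

lemma Ck_on_integral:
  fixes f :: "'e::{real_inner,banach} \<Rightarrow> real"
  assumes B: "onb (B::'e set)"
  shows "smooth_on (ball c r) f \<Longrightarrow> Ck_on k (ball c r) (\<lambda>x. integral {0..1} (\<lambda>t. t ^ m * f (c + t *\<^sub>R (x - c))))"
proof (induction k arbitrary: f m)
  have seg: "c + t *\<^sub>R (x - c) \<in> ball c r" if "x \<in> ball c r" "t \<in> {0..1}" for x t
  proof -
    have "\<bar>t\<bar> * norm (x - c) \<le> 1 * norm (x - c)" using that by (intro mult_right_mono) auto
    then show ?thesis using that by (auto simp: dist_norm norm_minus_commute)
  qed
  have contf: "continuous_on (ball c r \<times> cbox 0 1) (\<lambda>(x, t). t ^ m * g (c + t *\<^sub>R (x - c)))"
    if "smooth_on (ball c r) g" for g :: "'e \<Rightarrow> real" and m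
    unfolding split_beta
    by (intro continuous_intros continuous_on_compose2[OF smooth_on_continuous_on[OF that]])
       (use seg in auto)
  {
    case 0
    then show ?case using integral_continuous_on_param[OF contf[OF 0]] by simp
  next
    case (Suc k)
    let ?D = "\<lambda>y. frechet_derivative f (at y)"
    \<comment> \<open>The derivative in x as a bounded linear map, assembled from the basis: its
      continuity in (x, t) then reduces to that of finitely many directional derivatives.\<close>
    define F where "F x t = (\<Sum>b\<in>B. (t ^ Suc m * ?D (c + t *\<^sub>R (x - c)) b) *\<^sub>R blinfun_inner_left b)" for x t
    have F_apply: "F x t w = t ^ Suc m * ?D (c + t *\<^sub>R (x - c)) w" if "x \<in> ball c r" "t \<in> {0..1}" for x t w
    proof -
      have "linear (?D (c + t *\<^sub>R (x - c)))"
        using has_derivative_linear[OF smooth_on_has_derivative[OF Suc.prems seg[OF that]]] .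
      from onb_linear[OF B this, of w] show ?thesis
        by (simp add: F_def blinfun.sum_left blinfun.scaleR_left sum_distrib_left mult_ac inner_commute)
    qed
    have d: "((\<lambda>x. t ^ m * f (c + t *\<^sub>R (x - c))) has_derivative F x t) (at x within ball c r)"
      if "x \<in> ball c r" "t \<in> cbox 0 1" for x t
    proof -
      have t: "t \<in> {0..1}" using that by simp
      have "linear (?D (c + t *\<^sub>R (x - c)))"
        using has_derivative_linear[OF smooth_on_has_derivative[OF Suc.prems seg[OF that(1) t]]] .
      then have Fx: "blinfun_apply (F x t) = (\<lambda>w. t ^ m * ?D (c + t *\<^sub>R (x - c)) (t *\<^sub>R w))"
        using F_apply[OF that(1) t] by (auto simp: linear_scale)
      have d1: "((\<lambda>x. c + t *\<^sub>R (x - c)) has_derivative (\<lambda>w. t *\<^sub>R w)) (at x within ball c r)"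
        by (auto intro!: derivative_eq_intros)
      show ?thesis unfolding Fx
        by (rule has_derivative_mult_right[OF has_derivative_compose[where g=f,
            OF d1 smooth_on_has_derivative[OF Suc.prems seg[OF that(1) t]]]])
    qed
    have "continuous_on (ball c r \<times> cbox 0 1) (\<lambda>(x, t). t ^ Suc m * ?D (c + t *\<^sub>R (x - c)) b)" for b
      by (rule contf) (rule smooth_on_derivative[OF Suc.prems])
    then have contF: "continuous_on (ball c r \<times> cbox 0 1) (\<lambda>(x, t). F x t)"
      unfolding F_def split_beta
      by (intro continuous_on_sum continuous_on_scaleR continuous_on_const)
    have int: "(\<lambda>t. t ^ m * f (c + t *\<^sub>R (x - c))) integrable_on cbox 0 1" if "x \<in> ball c r" for x
    proof (rule integrable_continuous)
      have "continuous_on (cbox 0 1) (\<lambda>t. case (x, t) of (x, t) \<Rightarrow> t ^ m * f (c + t *\<^sub>R (x - c)))"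
        by (rule continuous_on_compose2[OF contf[OF Suc.prems]]) (use that in \<open>auto intro!: continuous_intros\<close>)
      then show "continuous_on (cbox 0 1) (\<lambda>t. t ^ m * f (c + t *\<^sub>R (x - c)))" by simp
    qed
    have deriv: "((\<lambda>x. integral (cbox 0 1) (\<lambda>t. t ^ m * f (c + t *\<^sub>R (x - c)))) has_derivative
        integral (cbox 0 1) (F x)) (at x)" if "x \<in> ball c r" for x
      using leibniz_rule[OF d int contF that convex_ball] that at_within_open[OF that open_ball] by simp
    have intF: "F x integrable_on cbox 0 1" if "x \<in> ball c r" for x
    proof (rule integrable_continuous)
      have "continuous_on (cbox 0 1) (\<lambda>t. case (x, t) of (x, t) \<Rightarrow> F x t)"
        by (rule continuous_on_compose2[OF contF]) (use that in \<open>auto intro!: continuous_intros\<close>)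
      then show "continuous_on (cbox 0 1) (F x)" by simp
    qed
    show ?case
    proof (rule Ck_on_SucI[OF open_ball])
      show "((\<lambda>x. integral {0..1} (\<lambda>t. t ^ m * f (c + t *\<^sub>R (x - c)))) has_derivative
        integral (cbox 0 1) (F x)) (at x)" if "x \<in> ball c r" for x using deriv[OF that] by simp
      fix w
      have "blinfun_apply (integral (cbox 0 1) (F x)) w =
          integral {0..1} (\<lambda>t. t ^ Suc m * ?D (c + t *\<^sub>R (x - c)) w)" if "x \<in> ball c r" for x
      proof -
        have "blinfun_apply (integral (cbox 0 1) (F x)) w = integral (cbox 0 1) (\<lambda>t. F x t w)"
          by (rule blinfun_apply_integral[OF intF[OF that]])
        also have "\<dots> = integral {0..1} (\<lambda>t. t ^ Suc m * ?D (c + t *\<^sub>R (x - c)) w)"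
          by (simp only: interval_cbox[symmetric] box_real)
             (rule integral_cong, rule F_apply[OF that])
        finally show ?thesis .
      qed
      then show "Ck_on k (ball c r) (\<lambda>x. blinfun_apply (integral (cbox 0 1) (F x)) w)"
        by (intro Ck_on_cong[OF open_ball Suc.IH[OF smooth_on_derivative[OF Suc.prems], of "Suc m" w]]) simp
    qed
  }
qed

text \<open>By the fundamental theorem of calculus \<open>f x - f c\<close> is the integral of the
  derivative of f along the segment from c to x, and \<open>g b\<close> is the mean over that
  segment of the derivative in direction b.\<close>

lemma hadamard:
  fixes f :: "'e::{real_inner,banach} \<Rightarrow> real"
  assumes B: "onb (B::'e set)" and f: "smooth_on (ball c r) f"
  obtains g where "\<And>b. smooth_on (ball c r) (g b)"
    "\<And>b. g b c = frechet_derivative f (at c) b"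
    "\<And>x. x \<in> ball c r \<Longrightarrow> f x = f c + (\<Sum>b\<in>B. ((x - c) \<bullet> b) * g b x)"
proof
  let ?D = "\<lambda>y. frechet_derivative f (at y)"
  let ?g = "\<lambda>b x. integral {0..1} (\<lambda>t. ?D (c + t *\<^sub>R (x - c)) b)"
  show "smooth_on (ball c r) (?g b)" for b
    using Ck_on_integral[OF B smooth_on_derivative[OF f], of _ 0 b] by (simp add: smooth_on_def)
  show "?g b c = ?D c b" for b by simp
  fix x assume x: "x \<in> ball c r"
  have seg: "c + t *\<^sub>R (x - c) \<in> ball c r" if "t \<in> {0..1}" for t
  proof -
    have "\<bar>t\<bar> * norm (x - c) \<le> 1 * norm (x - c)" using that by (intro mult_right_mono) auto
    then show ?thesis using x by (auto simp: dist_norm norm_minus_commute)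
  qed
  have D: "(f has_derivative ?D (c + t *\<^sub>R (x - c))) (at (c + t *\<^sub>R (x - c)))" if "t \<in> {0..1}" for t
    by (rule smooth_on_has_derivative[OF f seg[OF that]])
  have "((\<lambda>t. f (c + t *\<^sub>R (x - c))) has_vector_derivative ?D (c + t *\<^sub>R (x - c)) (x - c)) (at t within {0..1})"
    if "t \<in> {0..1}" for t
  proof -
    have "((\<lambda>t. c + t *\<^sub>R (x - c)) has_derivative (\<lambda>s. s *\<^sub>R (x - c))) (at t within {0..1})"
      by (auto intro!: derivative_eq_intros)
    from has_derivative_compose[where g=f, OF this D[OF that]] show ?thesis
      unfolding has_vector_derivative_def using linear_scale[OF has_derivative_linear[OF D[OF that]]] by simp
  qed
  then have "((\<lambda>t. ?D (c + t *\<^sub>R (x - c)) (x - c)) has_integral f (c + 1 *\<^sub>R (x - c)) - f (c + 0 *\<^sub>R (x - c))) {0..1}"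
    by (intro fundamental_theorem_of_calculus) auto
  then have "f x - f c = integral {0..1} (\<lambda>t. ?D (c + t *\<^sub>R (x - c)) (x - c))"
    by (simp add: integral_unique)
  also have "\<dots> = integral {0..1} (\<lambda>t. \<Sum>b\<in>B. ((x - c) \<bullet> b) * ?D (c + t *\<^sub>R (x - c)) b)"
    by (rule integral_cong) (use onb_linear[OF B has_derivative_linear[OF D]] in simp)
  also have "\<dots> = (\<Sum>b\<in>B. ((x - c) \<bullet> b) * ?g b x)"
  proof -
    have "continuous_on {0..1} (\<lambda>t. ?D (c + t *\<^sub>R (x - c)) b)" for b
      by (rule continuous_on_compose2[OF smooth_on_continuous_on[OF smooth_on_derivative[OF f]]])
         (use seg in \<open>auto intro!: continuous_intros\<close>)
    then have "(\<lambda>t. ((x - c) \<bullet> b) * ?D (c + t *\<^sub>R (x - c)) b) integrable_on {0..1}" for b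
      by (intro integrable_continuous_interval continuous_intros)
    then show ?thesis using B by (subst integral_sum) (auto simp: onb_def)
  qed
  finally show "f x = f c + (\<Sum>b\<in>B. ((x - c) \<bullet> b) * ?g b x)" by simp
qed

section \<open>Bump functions and compact balls\<close>

text \<open>The products of a polynomial in 1/t with exp(-1/t), continued by 0, are closed under
  differentiation, so one induction proves them all smooth at 0.\<close>

definition flat_exp :: "real poly \<Rightarrow> real \<Rightarrow> real" where
  "flat_exp p t = (if t > 0 then poly p (1 / t) * exp (- (1 / t)) else 0)"

lemma poly_exp_tendsto_0: "((\<lambda>x::real. poly p x * exp (- x)) \<longlongrightarrow> 0) at_top"
proof -
  have "((\<lambda>x. \<Sum>i\<le>degree p. coeff p i * (x ^ i / exp x)) \<longlongrightarrow> (\<Sum>i\<le>degree p. coeff p i * 0)) at_top"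
    by (intro tendsto_sum tendsto_mult tendsto_const tendsto_power_div_exp_0)
  then show ?thesis
    by (simp add: poly_altdef exp_minus field_simps sum_divide_distrib)
qed

text \<open>The factor \<open>[:0, 0, 1:]\<close> is the square of 1/t from the chain rule, read as
  a polynomial in 1/t. At 0 the right difference quotient is x p(x) exp(-x) with x = 1/t, whence
  \<open>pCons 0 p\<close>.\<close>

lemma flat_exp_derivative:
  "(flat_exp p has_real_derivative flat_exp ([:0, 0, 1:] * (p - pderiv p)) t) (at t)"
proof (cases "t > 0 \<or> t < 0")
  case True
  then show ?thesis
  proof
    assume t: "t > 0"
    have "((\<lambda>t. poly p (1 / t) * exp (- (1 / t))) has_real_derivative
        flat_exp ([:0, 0, 1:] * (p - pderiv p)) t) (at t)"
      using t by (auto intro!: derivative_eq_intros simp: flat_exp_def power2_eq_square field_simps)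
    then show ?thesis
      by (rule has_field_derivative_transform_within_open[of _ _ _ "{0<..}"])
         (use t in \<open>auto simp: flat_exp_def\<close>)
  next
    assume t: "t < 0"
    have "((\<lambda>t. 0) has_real_derivative flat_exp ([:0, 0, 1:] * (p - pderiv p)) t) (at t)"
      using t by (auto simp: flat_exp_def)
    then show ?thesis
      by (rule has_field_derivative_transform_within_open[of _ _ _ "{..<0}"])
         (use t in \<open>auto simp: flat_exp_def\<close>)
  qed
next
  case False
  then have t: "t = 0" by simp
  have l: "((\<lambda>y. (flat_exp p y - flat_exp p 0) / (y - 0)) \<longlongrightarrow> 0) (at_left 0)"
    by (rule tendsto_eventually) (auto simp: flat_exp_def eventually_at_filter intro!: always_eventually)
  have "((\<lambda>y. poly (pCons 0 p) (inverse y) * exp (- inverse y)) \<longlongrightarrow> 0) (at_right (0::real))"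
    by (rule filterlim_compose[OF poly_exp_tendsto_0 filterlim_inverse_at_top_right])
  then have r: "((\<lambda>y. (flat_exp p y - flat_exp p 0) / (y - 0)) \<longlongrightarrow> 0) (at_right 0)"
    by (rule Lim_transform_eventually)
       (auto simp: flat_exp_def eventually_at_filter field_simps intro!: always_eventually)
  show ?thesis
    unfolding t has_field_derivative_iff using filterlim_split_at[OF l r] by (simp add: flat_exp_def)
qed

lemma smooth_on_flat_exp: "smooth_on UNIV (flat_exp p)"
  unfolding smooth_on_def
proof
  show "Ck_on k UNIV (flat_exp p)" for k
  proof (induction k arbitrary: p)
    case 0
    show ?case
      by (auto intro!: continuous_at_imp_continuous_on DERIV_isCont[OF flat_exp_derivative])
  next
    case (Suc k)
    show ?case
    proof (rule Ck_on_SucI)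
      show "(flat_exp p has_derivative (\<lambda>w. flat_exp ([:0, 0, 1:] * (p - pderiv p)) x * w)) (at x)" for x
        using flat_exp_derivative[of p x] unfolding has_field_derivative_def .
    qed (auto intro!: Ck_on_bilinear[OF bounded_bilinear_mult] Suc.IH Ck_on_const)
  qed
qed

text \<open>The function b is positive inside the ball of radius r and 0 outside. The subtracted
  quotient is 0 where b exceeds half its value at the centre and 1 where b vanishes. Its denominator
  is a constant, so smoothness is immediate.\<close>

lemma bump_ball:
  fixes c :: "'e::real_inner"
  assumes "0 < r"
  obtains \<rho> :: "'e \<Rightarrow> real" and s where "smooth_on UNIV \<rho>" "0 < s" "s \<le> r"
    "\<And>x. x \<in> ball c s \<Longrightarrow> \<rho> x = 1" "\<And>x. x \<notin> ball c r \<Longrightarrow> \<rho> x = 0"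
proof -
  let ?g = "flat_exp 1"
  define b where "b x = ?g (r\<^sup>2 - (x - c) \<bullet> (x - c))" for x
  define \<rho> where "\<rho> x = 1 - ?g (b c / 2 - b x) * inverse (?g (b c / 2))" for x
  have bc: "b c > 0" using assms by (simp add: b_def flat_exp_def)
  have D: "smooth_on UNIV (\<lambda>x::'e. r\<^sup>2 - (x - c) \<bullet> (x - c))"
    using smooth_on_minus[OF open_UNIV smooth_on_const[OF open_UNIV]
        smooth_on_inner[OF open_UNIV
          smooth_on_add[OF open_UNIV smooth_on_ident[OF open_UNIV] smooth_on_const[OF open_UNIV, of "- c"]]
          smooth_on_add[OF open_UNIV smooth_on_ident[OF open_UNIV] smooth_on_const[OF open_UNIV, of "- c"]]]]
    by simp
  have sb: "smooth_on UNIV b"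
    unfolding b_def by (rule smooth_on_compose[OF onb_real _ _ D smooth_on_flat_exp]) auto
  have "smooth_on UNIV (\<lambda>x. b c / 2 - b x)"
    by (intro smooth_on_minus smooth_on_const sb open_UNIV)
  from smooth_on_compose[OF onb_real _ _ this smooth_on_flat_exp]
  have "smooth_on UNIV (\<lambda>x. ?g (b c / 2 - b x))" by simp
  then have s\<rho>: "smooth_on UNIV \<rho>"
    unfolding \<rho>_def by (intro smooth_on_minus smooth_on_mult smooth_on_const open_UNIV)
  have out: "\<rho> x = 0" if "x \<notin> ball c r" for x
  proof -
    have "r \<le> norm (x - c)" using that by (simp add: dist_norm norm_minus_commute)
    then have "r\<^sup>2 \<le> (norm (x - c))\<^sup>2" using assms by (intro power_mono) auto
    then have "b x = 0" by (simp add: b_def flat_exp_def power2_norm_eq_inner)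
    then show ?thesis using bc by (simp add: \<rho>_def flat_exp_def)
  qed
  have "open {x. b c / 2 < b x}"
    using smooth_on_continuous_on[OF sb] by (intro open_Collect_less) auto
  then obtain s where s: "0 < s" "ball c s \<subseteq> {x. b c / 2 < b x}"
    using bc by (force simp: open_contains_ball)
  have "\<rho> x = 1" if "x \<in> ball c (min s r)" for x
  proof -
    have "b c / 2 < b x" using s(2) that by auto
    then show ?thesis by (simp add: \<rho>_def flat_exp_def)
  qed
  then show thesis using that[OF s\<rho>, of "min s r"] s(1) assms out by auto
qed

text \<open>The model space is only known to have a finite spanning set, so compactness of balls is
  obtained from boxes, one coordinate at a time.\<close>

lemma compact_box_onb:
  assumes "finite (B::'e::real_normed_vector set)"
  shows "compact {\<Sum>b\<in>B. f b *\<^sub>R b | f. \<forall>b\<in>B. \<bar>f b\<bar> \<le> (R::real)}"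
  using assms
proof (induction B rule: finite_induct)
  case empty
  show ?case by simp
next
  case (insert a B)
  let ?K = "{\<Sum>b\<in>B. f b *\<^sub>R b | f. \<forall>b\<in>B. \<bar>f b\<bar> \<le> R}"
  have "{\<Sum>b\<in>insert a B. f b *\<^sub>R b | f. \<forall>b\<in>insert a B. \<bar>f b\<bar> \<le> R} =
      (\<lambda>(t, x). t *\<^sub>R a + x) ` ({-R..R} \<times> ?K)" (is "?L = ?M")
  proof
    show "?L \<subseteq> ?M"
    proof
      fix y assume "y \<in> ?L"
      then obtain f where f: "\<forall>b\<in>insert a B. \<bar>f b\<bar> \<le> R" "y = (\<Sum>b\<in>insert a B. f b *\<^sub>R b)" by auto
      then show "y \<in> ?M" using insert.hyps
        by (intro image_eqI[of _ _ "(f a, \<Sum>b\<in>B. f b *\<^sub>R b)"]) (auto simp: abs_le_iff)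
    qed
    show "?M \<subseteq> ?L"
    proof
      fix y assume "y \<in> ?M"
      then obtain t f where f: "\<bar>t\<bar> \<le> R" "\<forall>b\<in>B. \<bar>f b\<bar> \<le> R" "y = t *\<^sub>R a + (\<Sum>b\<in>B. f b *\<^sub>R b)"
        by (fastforce simp: abs_le_iff)
      have "(\<Sum>b\<in>B. (f(a := t)) b *\<^sub>R b) = (\<Sum>b\<in>B. f b *\<^sub>R b)"
        using insert.hyps by (intro sum.cong) auto
      then have "y = (\<Sum>b\<in>insert a B. (f(a := t)) b *\<^sub>R b)" using insert.hyps f(3) by simp
      then show "y \<in> ?L" using f(1,2) by (intro CollectI exI[of _ "f(a := t)"]) auto
    qed
  qed
  moreover have "compact (?M)"
    by (intro compact_continuous_image compact_Times insert.IH compact_Icc)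
       (auto simp: split_beta intro!: continuous_intros)
  ultimately show ?case by simp
qed

text \<open>The coordinates in an orthonormal basis are bounded by the norm, so a closed ball around
  0 is a closed subset of a compact box.\<close>

lemma compact_cball_onb:
  assumes "onb (B::'e::real_inner set)"
  shows "compact (cball (c::'e) r)"
proof -
  have B: "finite B" "\<And>x. (\<Sum>b\<in>B. (x \<bullet> b) *\<^sub>R b) = x" "\<And>b. b \<in> B \<Longrightarrow> norm b = 1"
    using assms by (auto simp: onb_def norm_eq_sqrt_inner)
  have "cball 0 r \<subseteq> {\<Sum>b\<in>B. f b *\<^sub>R b | f. \<forall>b\<in>B. \<bar>f b\<bar> \<le> r}"
  proof
    fix x :: 'e assume "x \<in> cball 0 r"
    then have "\<bar>x \<bullet> b\<bar> \<le> r" if "b \<in> B" for b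
      using Cauchy_Schwarz_ineq2[of x b] B(3)[OF that] by simp
    then show "x \<in> {\<Sum>b\<in>B. f b *\<^sub>R b | f. \<forall>b\<in>B. \<bar>f b\<bar> \<le> r}"
      using B(2)[of x] by (intro CollectI exI[of _ "\<lambda>b. x \<bullet> b"]) auto
  qed
  then have "compact (cball (0::'e) r)"
    using compact_Int_closed[OF compact_box_onb[OF B(1), of r] closed_cball[of 0 r]]
    by (simp add: Int_absorb1)
  then have "compact ((+) c ` cball 0 r)" by (rule compact_translation)
  then show ?thesis by (simp add: image_add_cball)
qed

section \<open>Elementary rules for tangent vectors, atlases and smooth functions\<close>

lemma sum_fun_apply: "(\<Sum>i\<in>I. f i) x = (\<Sum>i\<in>I. f i x)"
  by (induction I rule: infinite_finite_induct) simp_all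

lemma tangentD:
  assumes "v \<in> tangent A p"
  shows "smooth_fun A f \<Longrightarrow> smooth_fun A g \<Longrightarrow> v (f + g) = v f + v g"
    and "smooth_fun A f \<Longrightarrow> v (c *\<^sub>R f) = c * v f"
    and "smooth_fun A f \<Longrightarrow> smooth_fun A g \<Longrightarrow> v (f * g) = f p * v g + g p * v f"
    and "\<not> smooth_fun A f \<Longrightarrow> v f = 0"
  using assms by (auto simp: tangent_def Lin_def)

lemma smooth_atlasD:
  fixes A :: "('a::{t2_space,second_countable_topology}, 'e::{real_inner,banach}) atlas"
  assumes "smooth_atlas A"
  shows "\<exists>B::'e set. finite B \<and> span B = UNIV"
    and "\<exists>(U, \<phi>)\<in>A. p \<in> U"
    and "(U, \<phi>) \<in> A \<Longrightarrow> open U \<and> open (\<phi> ` U) \<and> homeomorphism U (\<phi> ` U) \<phi> (inv_into U \<phi>)"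
    and "(U, \<phi>) \<in> A \<Longrightarrow> (V, \<psi>) \<in> A \<Longrightarrow> smooth_on (\<phi> ` (U \<inter> V)) (\<psi> \<circ> inv_into U \<phi>)"
proof -
  note a = assms[unfolded smooth_atlas_def]
  show "\<exists>B::'e set. finite B \<and> span B = UNIV" by (rule a[THEN conjunct1])
  have "p \<in> (\<Union>(U, \<phi>)\<in>A. U)" unfolding a[THEN conjunct2, THEN conjunct1] by (rule UNIV_I)
  then show "\<exists>(U, \<phi>)\<in>A. p \<in> U" by blast
  show "(U, \<phi>) \<in> A \<Longrightarrow> open U \<and> open (\<phi> ` U) \<and> homeomorphism U (\<phi> ` U) \<phi> (inv_into U \<phi>)"
    using a[THEN conjunct2, THEN conjunct2, THEN conjunct1] by (rule ballE[where x="(U, \<phi>)"]) simp_all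
  show "(U, \<phi>) \<in> A \<Longrightarrow> (V, \<psi>) \<in> A \<Longrightarrow> smooth_on (\<phi> ` (U \<inter> V)) (\<psi> \<circ> inv_into U \<phi>)"
    using a[THEN conjunct2, THEN conjunct2, THEN conjunct2]
    by (elim ballE[where x="(U, \<phi>)"]) (auto elim: ballE[where x="(V, \<psi>)"])
qed

lemma atlas_open_image: "smooth_atlas A \<Longrightarrow> (U, \<phi>) \<in> A \<Longrightarrow> open (\<phi> ` U)"
  using smooth_atlasD(3) by metis

lemma smooth_fun_add:
  assumes "smooth_atlas A" "smooth_fun A f" "smooth_fun A g"
  shows "smooth_fun A (f + g)"
  unfolding smooth_fun_def
proof clarify
  fix U \<phi> assume U: "(U, \<phi>) \<in> A"
  then have "smooth_on (\<phi> ` U) (f \<circ> inv_into U \<phi>)" "smooth_on (\<phi> ` U) (g \<circ> inv_into U \<phi>)"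
    using assms unfolding smooth_fun_def by blast+
  from smooth_on_add[OF atlas_open_image[OF assms(1) U] this]
  show "smooth_on (\<phi> ` U) (f + g \<circ> inv_into U \<phi>)" by (simp add: o_def)
qed

lemma smooth_fun_mult:
  assumes "smooth_atlas A" "smooth_fun A f" "smooth_fun A g"
  shows "smooth_fun A (f * g)"
  unfolding smooth_fun_def
proof clarify
  fix U \<phi> assume U: "(U, \<phi>) \<in> A"
  then have "smooth_on (\<phi> ` U) (f \<circ> inv_into U \<phi>)" "smooth_on (\<phi> ` U) (g \<circ> inv_into U \<phi>)"
    using assms unfolding smooth_fun_def by blast+
  from smooth_on_mult[OF atlas_open_image[OF assms(1) U] this]
  show "smooth_on (\<phi> ` U) (f * g \<circ> inv_into U \<phi>)" by (simp add: o_def)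
qed

lemma smooth_fun_const: "smooth_atlas A \<Longrightarrow> smooth_fun A (\<lambda>p. c)"
  unfolding smooth_fun_def by (clarsimp simp: o_def smooth_on_const atlas_open_image)

section \<open>Smooth functions and tangent vectors on a manifold\<close>

locale smooth_manifold =
  fixes A :: "('a::{t2_space,second_countable_topology}, 'e::{real_inner,banach}) atlas"
  assumes atlas: "smooth_atlas A"
begin

lemma ex_onb: "\<exists>B::'e set. onb B"
  using smooth_atlasD(1)[OF atlas] onb_exists by blast

lemma chart:
  assumes "(U, \<phi>) \<in> A"
  shows "open U" "open (\<phi> ` U)" "inj_on \<phi> U" "continuous_on U \<phi>"
    "continuous_on (\<phi> ` U) (inv_into U \<phi>)" "p \<in> U \<Longrightarrow> inv_into U \<phi> (\<phi> p) = p"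
proof -
  have h: "open U" "open (\<phi> ` U)" "homeomorphism U (\<phi> ` U) \<phi> (inv_into U \<phi>)"
    using smooth_atlasD(3)[OF atlas assms] by auto
  then show "open U" "open (\<phi> ` U)" by auto
  from h(3) show "continuous_on U \<phi>" "continuous_on (\<phi> ` U) (inv_into U \<phi>)"
    "p \<in> U \<Longrightarrow> inv_into U \<phi> (\<phi> p) = p"
    by (auto simp: homeomorphism_def)
  from h(3) show "inj_on \<phi> U" 
    by (intro inj_on_inverseI[where g="inv_into U \<phi>"]) (simp add: homeomorphism_def)
qed

lemma chart_at: obtains U \<phi> where "(U, \<phi>) \<in> A" "p \<in> U"
  using smooth_atlasD(2)[OF atlas, of p] by blast

lemma chart_open_image:
  assumes "(U, \<phi>) \<in> A" "open V"
  shows "open (\<phi> ` (U \<inter> V))"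
proof -
  have "\<phi> ` (U \<inter> V) = \<phi> ` U \<inter> inv_into U \<phi> -` V"
    using chart(6)[OF assms(1)] by force
  then show ?thesis
    using continuous_open_preimage[OF chart(5,2)[OF assms(1)] assms(2)] by simp
qed

lemma chart_open_preimage: "(U, \<phi>) \<in> A \<Longrightarrow> open S \<Longrightarrow> open {q \<in> U. \<phi> q \<in> S}"
  using continuous_open_preimage[OF chart(4,1)] by (simp add: vimage_def Int_def)

section \<open>Cutting off functions given in a chart\<close>

text \<open>The preimage C of K is compact, hence closed because the manifold is Hausdorff. So U and
  the complement of C form an open cover: on the first the function is s in the chart, on the second
  it is 0.\<close>

lemma extend_by_0:
  assumes U: "(U, \<phi>) \<in> A" and s: "smooth_on (\<phi> ` U) s" and K: "compact K" "K \<subseteq> \<phi> ` U"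
    and 0: "\<And>x. x \<in> \<phi> ` U \<Longrightarrow> x \<notin> K \<Longrightarrow> s x = 0"
  shows "smooth_fun A (\<lambda>q. if q \<in> U then s (\<phi> q) else 0)" (is "smooth_fun A ?f")
  unfolding smooth_fun_def
proof clarify
  fix V \<psi> assume V: "(V, \<psi>) \<in> A"
  obtain B :: "'e set" where B: "onb B" using ex_onb by blast
  define C where "C = inv_into U \<phi> ` K"
  have "compact C" unfolding C_def
    using continuous_on_subset[OF chart(5)[OF U] K(2)] K(1) by (rule compact_continuous_image)
  then have "closed C" by (rule compact_imp_closed)
  show "smooth_on (\<psi> ` V) (?f \<circ> inv_into V \<psi>)"
  proof (rule smooth_on_local)
    fix y assume "y \<in> \<psi> ` V"
    then obtain q where q: "q \<in> V" "y = \<psi> q" by blast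
    show "\<exists>T. open T \<and> y \<in> T \<and> smooth_on T (?f \<circ> inv_into V \<psi>)"
    proof (cases "q \<in> U")
      case True
      have T: "open (\<psi> ` (V \<inter> U))" by (rule chart_open_image[OF V chart(1)[OF U]])
      have "smooth_on (\<psi> ` (V \<inter> U)) (\<phi> \<circ> inv_into V \<psi>)"
        by (rule smooth_atlasD(4)[OF atlas V U])
      then have "smooth_on (\<psi> ` (V \<inter> U)) (\<lambda>x. s ((\<phi> \<circ> inv_into V \<psi>) x))"
        using chart(6)[OF V] by (intro smooth_on_compose[OF B T chart(2)[OF U] _ s, of "\<phi> \<circ> inv_into V \<psi>"]) (assumption, auto)
      then have "smooth_on (\<psi> ` (V \<inter> U)) (?f \<circ> inv_into V \<psi>)"
        by (rule smooth_on_cong[OF T]) (use chart(6)[OF V] in auto)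
      then show ?thesis using T q True by blast
    next
      case False
      have T: "open (\<psi> ` (V \<inter> - C))" using \<open>closed C\<close> by (intro chart_open_image[OF V]) auto
      have "q \<notin> C" using False K(2) inv_into_into[of _ \<phi> U] by (auto simp: C_def)
      have zero: "?f r = 0" if "r \<notin> C" for r
      proof (cases "r \<in> U")
        case True
        then have "\<phi> r \<notin> K" using that chart(6)[OF U True] unfolding C_def by force
        then show ?thesis using 0 True by auto
      qed simp
      have "smooth_on (\<psi> ` (V \<inter> - C)) (?f \<circ> inv_into V \<psi>)"
      proof (rule smooth_on_cong[OF T smooth_on_const[OF T, of 0]])
        fix x assume "x \<in> \<psi> ` (V \<inter> - C)"
        then obtain r where r: "x = \<psi> r" "r \<in> V" "r \<notin> C" by blast
        show "0 = (?f \<circ> inv_into V \<psi>) x" unfolding o_def r(1) chart(6)[OF V r(2)] zero[OF r(3)] ..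
      qed
      then show ?thesis using T q \<open>q \<notin> C\<close> by blast
    qed
  qed
qed

text \<open>The function g is only given on a ball. The product is smooth on that ball of radius R
  and is 0 off the closed ball of radius r; as r < R, these two open sets cover everything.\<close>

lemma cutoff_smooth:
  assumes U: "(U, \<phi>) \<in> A" and R: "cball c r \<subseteq> \<phi> ` U" "r < R"
    and \<rho>: "smooth_on UNIV \<rho>" "\<And>x. x \<notin> ball c r \<Longrightarrow> \<rho> x = 0" and g: "smooth_on (ball c R) g"
  shows "smooth_fun A (\<lambda>q. if q \<in> U then \<rho> (\<phi> q) * g (\<phi> q) else 0)"
proof (rule extend_by_0[OF U _ _ R(1)])
  show "compact (cball c r)" using ex_onb compact_cball_onb by blast
  show "smooth_on (\<phi> ` U) (\<lambda>x. \<rho> x * g x)"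
  proof (rule smooth_on_local)
    fix x assume "x \<in> \<phi> ` U"
    show "\<exists>T. open T \<and> x \<in> T \<and> smooth_on T (\<lambda>x. \<rho> x * g x)"
    proof (cases "x \<in> ball c R")
      case True
      then show ?thesis
        using smooth_on_mult[OF open_ball smooth_on_subset[OF \<rho>(1)] g] by blast
    next
      case False
      then have "open (- cball c r)" "x \<in> - cball c r" using R(2) by auto
      moreover from this(1) have "smooth_on (- cball c r) (\<lambda>x. \<rho> x * g x)"
        by (rule smooth_on_cong[OF _ smooth_on_const[of _ 0]]) (use \<rho>(2) in auto)
      ultimately show ?thesis by blast
    qed
  qed
qed (use \<rho>(2) in \<open>auto simp: dist_norm\<close>)

lemma smooth_fun_chart: "smooth_fun A f \<Longrightarrow> (U, \<phi>) \<in> A \<Longrightarrow> smooth_on (\<phi> ` U) (f \<circ> inv_into U \<phi>)"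
  unfolding smooth_fun_def by blast

lemma ball_in_chart:
  assumes "(U, \<phi>) \<in> A" "p \<in> U" "open V" "p \<in> V"
  obtains r where "0 < r" "cball (\<phi> p) r \<subseteq> \<phi> ` (U \<inter> V)"
  using open_contains_cball chart_open_image[OF assms(1,3)] assms(2,4) by (metis IntI imageI)

lemma bump_function:
  assumes "open V" "p \<in> V"
  obtains \<rho> where "smooth_fun A \<rho>" "\<rho> p = 1" "\<And>q. q \<notin> V \<Longrightarrow> \<rho> q = 0"
proof -
  obtain U \<phi> where U: "(U, \<phi>) \<in> A" "p \<in> U" by (rule chart_at)
  obtain R where R: "0 < R" "cball (\<phi> p) R \<subseteq> \<phi> ` (U \<inter> V)"
    by (rule ball_in_chart[OF U assms])
  obtain \<rho> :: "'e \<Rightarrow> real" and s where \<rho>: "smooth_on UNIV \<rho>" "0 < s" "s \<le> R / 2"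
    "\<And>x. x \<in> ball (\<phi> p) s \<Longrightarrow> \<rho> x = 1" "\<And>x. x \<notin> ball (\<phi> p) (R / 2) \<Longrightarrow> \<rho> x = 0"
    by (rule bump_ball[OF half_gt_zero[OF R(1)], of "\<phi> p"]) (rule that)
  show thesis
  proof (rule that)
    have "cball (\<phi> p) (R / 2) \<subseteq> cball (\<phi> p) R" using R(1) by auto
    then have "cball (\<phi> p) (R / 2) \<subseteq> \<phi> ` U" using R(2) by blast
    from cutoff_smooth[OF U(1) this, of R, OF _ \<rho>(1,5) smooth_on_const[OF open_ball, of _ _ 1]]
    show "smooth_fun A (\<lambda>q. if q \<in> U then \<rho> (\<phi> q) * 1 else 0)" using R(1) by simp
    show "(if p \<in> U then \<rho> (\<phi> p) * 1 else 0) = 1" using U \<rho>(2,4) by simp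
    show "(if q \<in> U then \<rho> (\<phi> q) * 1 else 0) = 0" if "q \<notin> V" for q
    proof (cases "q \<in> U")
      case True
      have "\<phi> q \<notin> \<phi> ` (U \<inter> V)" using inj_onD[OF chart(3)[OF U(1)]] True that by blast
      then have "\<phi> q \<notin> cball (\<phi> p) R" using R(2) by blast
      then have "\<phi> q \<notin> ball (\<phi> p) (R / 2)" using R(1) by auto
      then show ?thesis using \<rho>(5) by simp
    qed simp
  qed
qed

section \<open>The algebra of smooth functions and its derivations\<close>

lemmas smooth_const = smooth_fun_const[OF atlas]
  and smooth_add = smooth_fun_add[OF atlas]
  and smooth_mult = smooth_fun_mult[OF atlas]

lemma smooth_zero: "smooth_fun A 0" and smooth_one: "smooth_fun A 1"
  using smooth_const[of 0] smooth_const[of 1] by (simp_all add: zero_fun_def one_fun_def)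

lemma smooth_scaleR: "smooth_fun A f \<Longrightarrow> smooth_fun A (c *\<^sub>R f)"
  using smooth_mult[OF smooth_const[of c]] by (simp add: scaleR_fun_def times_fun_def)

lemma smooth_uminus: "smooth_fun A f \<Longrightarrow> smooth_fun A (- f)"
  using smooth_scaleR[of f "-1"] by simp

lemma smooth_diff: "smooth_fun A f \<Longrightarrow> smooth_fun A g \<Longrightarrow> smooth_fun A (f - g)"
  using smooth_add[OF _ smooth_uminus] by fastforce

lemma smooth_sum: "(\<And>i. i \<in> I \<Longrightarrow> smooth_fun A (f i)) \<Longrightarrow> smooth_fun A (\<Sum>i\<in>I. f i)"
  by (induction I rule: infinite_finite_induct) (auto intro: smooth_zero smooth_add)

lemma tangent_const:
  assumes "v \<in> tangent A p" shows "v (\<lambda>q. c) = 0"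
proof -
  have "v (1 * 1) = 1 * v 1 + 1 * v 1"
    using tangentD(3)[OF assms smooth_one smooth_one] by simp
  then have "v 1 = 0" by simp
  moreover have "v (\<lambda>q. c) = v (c *\<^sub>R 1)" by (rule arg_cong[where f=v]) (simp add: scaleR_fun_def)
  ultimately show ?thesis using tangentD(2)[OF assms smooth_one] by simp
qed

text \<open>For a bump function \<rho> at p supported in V the products \<rho> f and \<rho> g agree
  everywhere; the Leibniz rule at p turns this into the claim.\<close>

lemma tangent_local:
  assumes v: "v \<in> tangent A p" and "open V" "p \<in> V" and fg: "smooth_fun A f" "smooth_fun A g"
    and eq: "\<And>q. q \<in> V \<Longrightarrow> f q = g q"
  shows "v f = v g"
proof -
  obtain \<rho> where \<rho>: "smooth_fun A \<rho>" "\<rho> p = 1" "\<And>q. q \<notin> V \<Longrightarrow> \<rho> q = 0"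
    using bump_function[OF assms(2,3)] by blast
  have "\<rho> * f = \<rho> * g"
  proof
    show "(\<rho> * f) q = (\<rho> * g) q" for q using eq \<rho>(3) by (cases "q \<in> V") auto
  qed
  then have "v (\<rho> * f) = v (\<rho> * g)" by simp
  then show ?thesis
    using tangentD(3)[OF v \<rho>(1) fg(1)] tangentD(3)[OF v \<rho>(1) fg(2)] \<rho>(2) eq[OF assms(3)] by simp
qed

lemma tangent_sum:
  assumes "v \<in> tangent A p" "\<And>i. i \<in> I \<Longrightarrow> smooth_fun A (f i)"
  shows "v (\<Sum>i\<in>I. f i) = (\<Sum>i\<in>I. v (f i))"
  using assms(2)
proof (induction I rule: infinite_finite_induct)
  case (insert i I)
  have "v (f i + sum f I) = v (f i) + v (sum f I)"
    using insert by (intro tangentD(1)[OF assms(1)] smooth_sum) auto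
  moreover have "v (sum f (insert i I)) = v (f i + sum f I)"
    by (rule arg_cong[where f=v]) (rule sum.insert[OF insert.hyps(1,2)])
  moreover have "(\<Sum>j\<in>insert i I. v (f j)) = v (f i) + (\<Sum>j\<in>I. v (f j))"
    by (rule sum.insert[OF insert.hyps(1,2)])
  ultimately show ?case using insert.IH insert.prems by (metis insertCI)
qed (use tangent_const[OF assms(1), of 0] in \<open>simp_all add: zero_fun_def\<close>)

text \<open>Hadamard's lemma, multiplied by the square of a cutoff function to make it a statement on
  global functions, shows that a derivation only sees first derivatives.\<close>

lemma tangent_expansion:
  assumes B: "onb (B::'e set)" and U: "(U, \<phi>) \<in> A" "q \<in> U"
  obtains Y where "\<And>b. smooth_fun A (Y b)"
    "\<And>v f. v \<in> tangent A q \<Longrightarrow> smooth_fun A f \<Longrightarrow>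
       v f = (\<Sum>b\<in>B. v (Y b) * frechet_derivative (f \<circ> inv_into U \<phi>) (at (\<phi> q)) b)"
proof -
  define c where "c = \<phi> q"
  obtain R where R: "0 < R" "cball c R \<subseteq> \<phi> ` (U \<inter> UNIV)"
    unfolding c_def by (rule ball_in_chart[OF U open_UNIV UNIV_I])
  obtain \<rho> :: "'e \<Rightarrow> real" and s where \<rho>: "smooth_on UNIV \<rho>" "0 < s" "s \<le> R / 2"
    "\<And>x. x \<in> ball c s \<Longrightarrow> \<rho> x = 1" "\<And>x. x \<notin> ball c (R / 2) \<Longrightarrow> \<rho> x = 0"
    by (rule bump_ball[OF half_gt_zero[OF R(1)], of c]) (rule that)
  define ext where "ext g = (\<lambda>p. if p \<in> U then \<rho> (\<phi> p) * g (\<phi> p) else 0)" for g :: "'e \<Rightarrow> real"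
  have "cball c (R / 2) \<subseteq> cball c R" using R(1) by auto
  then have "cball c (R / 2) \<subseteq> \<phi> ` U" using R(2) by blast
  then have ext: "smooth_fun A (ext g)" if "smooth_on (ball c R) g" for g
    unfolding ext_def by (rule cutoff_smooth[OF U(1) _ _ \<rho>(1,5) that]) (use R(1) in auto)
  have \<rho>c: "\<rho> c = 1" using \<rho>(2,4) by simp
  have ext_q: "ext g q = g c" for g using U(2) \<rho>c by (simp add: ext_def c_def)
  define Y where "Y b = ext (\<lambda>x. (x - c) \<bullet> b)" for b
  have lin: "smooth_on (ball c R) (\<lambda>x. (x - c) \<bullet> b)" for b
    using smooth_on_inner[OF open_ball smooth_on_add[OF open_ball smooth_on_ident[OF open_ball]
          smooth_on_const[OF open_ball, of _ _ "- c"]] smooth_on_const[OF open_ball, of _ _ b]] by simp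
  have Y: "smooth_fun A (Y b)" for b unfolding Y_def by (rule ext[OF lin])
  show thesis
  proof (rule that[OF Y])
    fix v f assume v: "v \<in> tangent A q" and f: "smooth_fun A f"
    let ?h = "f \<circ> inv_into U \<phi>"
    have h: "smooth_on (ball c R) ?h"
      by (rule smooth_on_subset[OF smooth_fun_chart[OF f U(1)]]) (use R(2) in auto)
    obtain g where g: "\<And>b. smooth_on (ball c R) (g b)"
      "\<And>b. g b c = frechet_derivative ?h (at c) b"
      "\<And>x. x \<in> ball c R \<Longrightarrow> ?h x = ?h c + (\<Sum>b\<in>B. ((x - c) \<bullet> b) * g b x)"
      using hadamard[OF B h] by blast
    define C where "C = ext (\<lambda>x. 1)"
    have C: "smooth_fun A C" "C q = 1"
      using ext[OF smooth_on_const[OF open_ball]] ext_q by (auto simp: C_def)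
    have sG: "smooth_fun A (ext (g b))" for b by (rule ext[OF g(1)])
    \<comment> \<open>One factor \<open>C\<close> cuts off the coordinate and the other cuts off
      \<open>g b\<close>, so that every product on the right is a global smooth function.\<close>
    have "C * C * f = f q *\<^sub>R (C * C) + (\<Sum>b\<in>B. Y b * ext (g b))"
    proof
      fix p
      show "(C * C * f) p = (f q *\<^sub>R (C * C) + (\<Sum>b\<in>B. Y b * ext (g b))) p"
      proof (cases "p \<in> U \<and> \<phi> p \<in> ball c R")
        case True
        then have "f p = f q + (\<Sum>b\<in>B. ((\<phi> p - c) \<bullet> b) * g b (\<phi> p))"
          using g(3)[of "\<phi> p"] chart(6)[OF U(1)] U(2) by (simp add: c_def)
        then show ?thesis using True
          by (simp add: C_def Y_def ext_def scaleR_fun_def sum_fun_apply algebra_simps sum_distrib_left)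
      next
        case False
        then have "ext k p = 0" for k using \<rho>(5)[of "\<phi> p"] R(1) by (auto simp: ext_def)
        then show ?thesis by (simp add: C_def Y_def scaleR_fun_def sum_fun_apply)
      qed
    qed
    then have "v (C * C * f) = v (f q *\<^sub>R (C * C) + (\<Sum>b\<in>B. Y b * ext (g b)))" by simp
    also have "\<dots> = f q * v (C * C) + (\<Sum>b\<in>B. v (Y b * ext (g b)))"
      by (simp add: tangentD(1,2)[OF v] tangent_sum[OF v] C Y sG smooth_scaleR smooth_mult smooth_sum)
    finally have "v (C * C * f) = f q * v (C * C) + (\<Sum>b\<in>B. v (Y b * ext (g b)))" .
    moreover have "v (C * C * f) = v f + f q * v (C * C)"
      using tangentD(3)[OF v smooth_mult[OF C(1) C(1)] f] C(2) by simp
    moreover have "v (Y b * ext (g b)) = v (Y b) * frechet_derivative ?h (at c) b" for b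
      using tangentD(3)[OF v Y[of b] sG[of b]] by (simp add: Y_def ext_q g(2))
    ultimately show "v f = (\<Sum>b\<in>B. v (Y b) * frechet_derivative ?h (at (\<phi> q)) b)"
      by (simp add: c_def)
  qed
qed

section \<open>Local frames\<close>

text \<open>The fields are coordinate derivatives and the functions are coordinates, both multiplied
  by a cutoff function. They are global, and they form a frame with its coordinates on the set W,
  where the cutoff is 1.\<close>

lemma local_frame:
  obtains U and I :: "'e set" and E :: "'e \<Rightarrow> 'a vfield" and x where
    "open U" "p \<in> U" "finite I" "\<And>i. i \<in> I \<Longrightarrow> vector_field A (E i)" "\<And>i. smooth_fun A (x i)"
    "\<And>q v. q \<in> U \<Longrightarrow> v \<in> tangent A q \<Longrightarrow> v = (\<Sum>i\<in>I. v (x i) *\<^sub>R E i q)"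
proof -
  obtain B :: "'e set" where B: "onb B" using ex_onb by blast
  obtain U \<phi> where U: "(U, \<phi>) \<in> A" "p \<in> U" by (rule chart_at)
  obtain R where R: "0 < R" "cball (\<phi> p) R \<subseteq> \<phi> ` (U \<inter> UNIV)"
    by (rule ball_in_chart[OF U open_UNIV UNIV_I])
  obtain \<rho> :: "'e \<Rightarrow> real" and s where \<rho>: "smooth_on UNIV \<rho>" "0 < s" "s \<le> R / 2"
    "\<And>x. x \<in> ball (\<phi> p) s \<Longrightarrow> \<rho> x = 1" "\<And>x. x \<notin> ball (\<phi> p) (R / 2) \<Longrightarrow> \<rho> x = 0"
    by (rule bump_ball[OF half_gt_zero[OF R(1)], of "\<phi> p"]) (rule that)
  define ext where "ext g = (\<lambda>p. if p \<in> U then \<rho> (\<phi> p) * g (\<phi> p) else 0)" for g :: "'e \<Rightarrow> real"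
  have "cball (\<phi> p) (R / 2) \<subseteq> cball (\<phi> p) R" using R(1) by auto
  then have "cball (\<phi> p) (R / 2) \<subseteq> \<phi> ` U" using R(2) by blast
  then have ext: "smooth_fun A (ext g)" if "smooth_on (ball (\<phi> p) R) g" for g
    unfolding ext_def by (rule cutoff_smooth[OF U(1) _ _ \<rho>(1,5) that]) (use R(1) in auto)
  define D where "D f y b = frechet_derivative (f \<circ> inv_into U \<phi>) (at y) b" for f :: "'a \<Rightarrow> real" and y b
  \<comment> \<open>The value 0 on non-smooth functions is what \<open>tangent\<close> demands of a
    derivation.\<close>
  define E :: "'e \<Rightarrow> 'a vfield" where
    "E b = (\<lambda>q f. if smooth_fun A f then ext (\<lambda>y. D f y b) q else 0)" for b
  define x where "x b = ext (\<lambda>y. y \<bullet> b)" for b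
  define W where "W = {q \<in> U. \<phi> q \<in> ball (\<phi> p) s}"
  have W: "open W" "p \<in> W" "W \<subseteq> U"
    using chart_open_preimage[OF U(1) open_ball] U(2) \<rho>(2) by (auto simp: W_def)
  have x: "smooth_fun A (x b)" for b
    unfolding x_def by (intro ext smooth_on_inner open_ball smooth_on_ident smooth_on_const)
  have fd: "(f \<circ> inv_into U \<phi> has_derivative D f (\<phi> q)) (at (\<phi> q))"
    if "smooth_fun A f" "q \<in> U" for f q
    unfolding D_def using smooth_on_has_derivative[OF smooth_fun_chart[OF that(1) U(1)]] that(2) by auto
  have D_eq: "D f (\<phi> q) = L" if "(f \<circ> inv_into U \<phi> has_derivative L) (at (\<phi> q))" for f q L
    unfolding D_def using frechet_derivative_at[OF that] by simp
  have E: "vector_field A (E b)" for b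
    unfolding vector_field_def
  proof safe
    fix q
    show "E b q \<in> tangent A q"
    proof (cases "q \<in> U")
      case False
      then show ?thesis by (auto simp: E_def ext_def tangent_def Lin_def)
    next
      case True
      have 1: "D (f + g) (\<phi> q) b = D f (\<phi> q) b + D g (\<phi> q) b" if "smooth_fun A f" "smooth_fun A g" for f g
      proof -
        have "(f + g \<circ> inv_into U \<phi> has_derivative (\<lambda>w. D f (\<phi> q) w + D g (\<phi> q) w)) (at (\<phi> q))"
          using has_derivative_add[OF fd[OF that(1) True] fd[OF that(2) True]] by (simp add: o_def)
        from D_eq[OF this] show ?thesis by simp
      qed
      have 2: "D (c *\<^sub>R f) (\<phi> q) b = c * D f (\<phi> q) b" if "smooth_fun A f" for f c
      proof -
        have "(c *\<^sub>R f \<circ> inv_into U \<phi> has_derivative (\<lambda>w. c *\<^sub>R D f (\<phi> q) w)) (at (\<phi> q))"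
          using has_derivative_scaleR_right[OF fd[OF that True], of c] by (simp add: o_def scaleR_fun_def)
        from D_eq[OF this] show ?thesis by simp
      qed
      have 3: "D (f * g) (\<phi> q) b = f q * D g (\<phi> q) b + g q * D f (\<phi> q) b"
        if "smooth_fun A f" "smooth_fun A g" for f g
      proof -
        have "(f * g \<circ> inv_into U \<phi> has_derivative (\<lambda>w. f q * D g (\<phi> q) w + D f (\<phi> q) w * g q)) (at (\<phi> q))"
          using has_derivative_mult[OF fd[OF that(1) True] fd[OF that(2) True]] chart(6)[OF U(1) True]
          by (simp add: o_def)
        from D_eq[OF this] show ?thesis by simp
      qed
      show ?thesis using True unfolding tangent_def Lin_def E_def ext_def
        by (auto simp: 1 2 3 smooth_add smooth_scaleR smooth_mult algebra_simps)
    qed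
  next
    fix f assume f: "smooth_fun A f"
    have "smooth_on (\<phi> ` U) (\<lambda>y. D f y b)"
      unfolding D_def by (rule smooth_on_derivative[OF smooth_fun_chart[OF f U(1)]])
    then have "smooth_fun A (ext (\<lambda>y. D f y b))"
      by (intro ext) (rule smooth_on_subset, assumption, use R(2) in auto)
    then show "smooth_fun A (E b \<triangleright> f)" using f by (simp add: E_def deriv_along_def)
  qed
  have span: "v = (\<Sum>b\<in>B. v (x b) *\<^sub>R E b q)" if q: "q \<in> W" and v: "v \<in> tangent A q" for q v
  proof
    fix f
    have qU: "q \<in> U" and \<rho>q: "\<rho> (\<phi> q) = 1" using q \<rho>(4) by (auto simp: W_def)
    obtain Y where Y: "\<And>b. smooth_fun A (Y b)"
      "\<And>v f. v \<in> tangent A q \<Longrightarrow> smooth_fun A f \<Longrightarrow> v f = (\<Sum>b\<in>B. v (Y b) * D f (\<phi> q) b)"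
      unfolding D_def using tangent_expansion[OF B U(1) qU] by blast
    \<comment> \<open>The functions \<open>Y\<close> of \<open>tangent_expansion\<close> are centred
      at q and change with it. Applying the expansion to the coordinate \<open>x b\<close>, whose
      derivative at q is the inner product with b, lets the fixed functions x take their
      place.\<close>
    have "v (x b) = v (Y b)" if b: "b \<in> B" for b
    proof -
      have "D (x b) (\<phi> q) = (\<lambda>w. w \<bullet> b)"
      proof (rule D_eq, rule has_derivative_transform_within_open[where s="ball (\<phi> p) s"])
        show "((\<lambda>y. y \<bullet> b) has_derivative (\<lambda>w. w \<bullet> b)) (at (\<phi> q))"
          by (auto intro!: derivative_eq_intros)
        show "y \<bullet> b = (x b \<circ> inv_into U \<phi>) y" if "y \<in> ball (\<phi> p) s" for y
        proof -
          have "y \<in> \<phi> ` U" using that R \<rho>(3) by (auto simp: subset_iff)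
          then show ?thesis using \<rho>(4)[OF that] chart(6)[OF U(1)]
            by (auto simp: x_def ext_def)
        qed
      qed (use q in \<open>auto simp: W_def\<close>)
      then have "v (x b) = (\<Sum>a\<in>B. v (Y a) * (a \<bullet> b))" using Y(2)[OF v x] by simp
      also have "\<dots> = (\<Sum>a\<in>B. if a = b then v (Y b) else 0)"
        using B b by (intro sum.cong) (auto simp: onb_def)
      finally show ?thesis using B b by (simp add: onb_def)
    qed
    then show "v f = (\<Sum>b\<in>B. v (x b) *\<^sub>R E b q) f"
      using Y(2)[OF v, of f] tangentD(4)[OF v, of f] qU \<rho>q
      by (cases "smooth_fun A f") (auto simp: sum_fun_apply scaleR_fun_def E_def ext_def)
  qed
  show thesis by (rule that[OF W(1,2) _ E x span]) (use B in \<open>auto simp: onb_def\<close>)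
qed

end

section \<open>Tensor calculus\<close>

lemma ev_apply: "(s \<odot> t) p = s p (t p)"
  by (simp add: ev_def)

lemma deriv_along_apply: "(X \<triangleright> f) p = X p f"
  by (simp add: deriv_along_def)

lemma fscale_apply: "(f \<cdot> s) p = f p *\<^sub>R s p"
  by (simp add: fscale_def)

lemma scaleR_fun_apply: "(c *\<^sub>R f) p = c *\<^sub>R f p"
  by (simp add: scaleR_fun_def)

lemmas pointwise = ev_apply deriv_along_apply fscale_apply scaleR_fun_apply sum_fun_apply fun_eq_iff

lemma ev_left_simps:
  "(s + t) \<odot> X = s \<odot> X + t \<odot> X" "(s - t) \<odot> X = s \<odot> X - t \<odot> X" "(- s) \<odot> X = - (s \<odot> X)" "0 \<odot> X = 0"
  for s t :: "'a \<Rightarrow> 'b \<Rightarrow> 'c::ab_group_add"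
  by (simp_all add: pointwise)

lemma ev_left_fscale: "(f \<cdot> s) \<odot> X = f \<cdot> (s \<odot> X)" for s :: "'a \<Rightarrow> 'b \<Rightarrow> 'c::real_vector"
  by (simp add: pointwise)

lemma ev_left_scaleR: "(c *\<^sub>R s) \<odot> X = c *\<^sub>R (s \<odot> X)" for s :: "'a \<Rightarrow> 'b \<Rightarrow> 'c::real_vector"
  by (simp add: pointwise)

lemma ev_left_sum: "(\<Sum>i\<in>I. s i) \<odot> X = (\<Sum>i\<in>I. s i \<odot> X)" for s :: "'i \<Rightarrow> 'a \<Rightarrow> 'b \<Rightarrow> 'c::ab_group_add"
  using sum_comp_morphism[of "\<lambda>s. s \<odot> X" s I] by (simp add: ev_left_simps o_def)

lemma fscale_real: "f \<cdot> g = f * g" for f g :: "'a \<Rightarrow> real"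
  by (simp add: pointwise)

lemma deriv_along_left:
  "(X + Y) \<triangleright> f = X \<triangleright> f + Y \<triangleright> f" "(X - Y) \<triangleright> f = X \<triangleright> f - Y \<triangleright> f" "(- X) \<triangleright> f = - (X \<triangleright> f)"
  "0 \<triangleright> f = 0" "(g \<cdot> X) \<triangleright> f = g * (X \<triangleright> f)"
  by (simp_all add: pointwise)

lemma deriv_along_left_sum: "(\<Sum>i\<in>I. X i) \<triangleright> f = (\<Sum>i\<in>I. X i \<triangleright> f)"
  using sum_comp_morphism[of "\<lambda>X. X \<triangleright> f" X I] by (simp add: deriv_along_left o_def)

lemma tangentI:
  assumes "\<And>f g. smooth_fun A f \<Longrightarrow> smooth_fun A g \<Longrightarrow> v (f + g) = v f + v g"
    "\<And>f c. smooth_fun A f \<Longrightarrow> v (c *\<^sub>R f) = c * v f"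
    "\<And>f g. smooth_fun A f \<Longrightarrow> smooth_fun A g \<Longrightarrow> v (f * g) = f p * v g + g p * v f"
    "\<And>f. \<not> smooth_fun A f \<Longrightarrow> v f = 0"
  shows "v \<in> tangent A p"
  using assms by (simp add: tangent_def Lin_def)

lemma tangent_subspace:
  "0 \<in> tangent A p" "v \<in> tangent A p \<Longrightarrow> w \<in> tangent A p \<Longrightarrow> v + w \<in> tangent A p"
  "v \<in> tangent A p \<Longrightarrow> c *\<^sub>R v \<in> tangent A p"
  by (auto simp: tangent_def Lin_def scaleR_fun_apply algebra_simps)

lemma tangent_sum_mem: "(\<And>i. i \<in> I \<Longrightarrow> v i \<in> tangent A p) \<Longrightarrow> (\<Sum>i\<in>I. v i) \<in> tangent A p"
  by (induction I rule: infinite_finite_induct) (auto intro: tangent_subspace)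

lemma LinD:
  assumes "L \<in> Lin V W"
  shows "x \<in> V \<Longrightarrow> L x \<in> W" "x \<in> V \<Longrightarrow> y \<in> V \<Longrightarrow> L (x + y) = L x + L y" "x \<in> V \<Longrightarrow> L (c *\<^sub>R x) = c *\<^sub>R L x"
    "x \<notin> V \<Longrightarrow> L x = 0"
  using assms by (auto simp: Lin_def)

lemma Lin_0: "L \<in> Lin V W \<Longrightarrow> L 0 = 0"
  using LinD(3)[of L V W 0 0] LinD(4)[of L V W 0] by (cases "0 \<in> V") auto

lemma Lin_sum:
  assumes L: "L \<in> Lin V W" and V: "subspace V" and "\<And>i. i \<in> I \<Longrightarrow> v i \<in> V"
  shows "L (\<Sum>i\<in>I. c i *\<^sub>R v i) = (\<Sum>i\<in>I. c i *\<^sub>R L (v i))"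
  using assms(3)
proof (induction I rule: infinite_finite_induct)
  case (insert i I)
  have IH: "L (\<Sum>i\<in>I. c i *\<^sub>R v i) = (\<Sum>i\<in>I. c i *\<^sub>R L (v i))"
    by (rule insert.IH) (simp add: insert.prems)
  have v: "v i \<in> V" "c i *\<^sub>R v i \<in> V" "(\<Sum>i\<in>I. c i *\<^sub>R v i) \<in> V"
    using insert.prems V by (auto intro!: subspace_sum subspace_scale)
  show ?case
    unfolding sum.insert[OF insert.hyps(1,2)] LinD(2)[OF L v(2,3)] LinD(3)[OF L v(1)] IH ..
qed (use Lin_0[OF L] in simp_all)

lemma subspace_tangent: "subspace (tangent A p)"
  by (rule subspaceI) (rule tangent_subspace; assumption)+

lemma cotangentD:
  assumes "a \<in> cotangent A p"
  shows "v \<in> tangent A p \<Longrightarrow> w \<in> tangent A p \<Longrightarrow> a (v + w) = a v + a w"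
    "v \<in> tangent A p \<Longrightarrow> a (c *\<^sub>R v) = c * a v" "v \<notin> tangent A p \<Longrightarrow> a v = 0"
  using LinD[OF assms[unfolded cotangent_def]] by auto

lemma cotangent_subspace:
  "0 \<in> cotangent A p" "a \<in> cotangent A p \<Longrightarrow> b \<in> cotangent A p \<Longrightarrow> a + b \<in> cotangent A p"
  "a \<in> cotangent A p \<Longrightarrow> c *\<^sub>R a \<in> cotangent A p"
  by (auto simp: cotangent_def Lin_def scaleR_fun_apply algebra_simps)

lemma subspace_cotangent: "subspace (cotangent A p)"
  by (rule subspaceI) (rule cotangent_subspace; assumption)+

section \<open>Vector fields, 1-forms and Lie brackets\<close>

context smooth_manifold
begin

lemmas smooth_intros = smooth_zero smooth_one smooth_const smooth_add smooth_mult smooth_diff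
  smooth_uminus smooth_scaleR smooth_sum

lemma vfD:
  assumes "vector_field A X"
  shows "X p \<in> tangent A p" "smooth_fun A f \<Longrightarrow> smooth_fun A (X \<triangleright> f)"
  using assms by (auto simp: vector_field_def)

lemma formD:
  assumes "one_form A \<alpha>"
  shows "\<alpha> p \<in> cotangent A p" "vector_field A X \<Longrightarrow> smooth_fun A (\<alpha> \<odot> X)"
  using assms by (auto simp: one_form_def)

lemma deriv_along_right:
  assumes X: "vector_field A X" and f: "smooth_fun A f"
  shows "smooth_fun A g \<Longrightarrow> X \<triangleright> (f + g) = X \<triangleright> f + X \<triangleright> g"
    "smooth_fun A g \<Longrightarrow> X \<triangleright> (f - g) = X \<triangleright> f - X \<triangleright> g"
    "smooth_fun A g \<Longrightarrow> X \<triangleright> (f * g) = f * (X \<triangleright> g) + g * (X \<triangleright> f)"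
    "X \<triangleright> (- f) = - (X \<triangleright> f)" "X \<triangleright> (c *\<^sub>R f) = c *\<^sub>R (X \<triangleright> f)"
proof -
  note t = tangentD[OF vfD(1)[OF X]]
  show a: "X \<triangleright> (f + g) = X \<triangleright> f + X \<triangleright> g" if "smooth_fun A g" for g
    using t(1)[OF f that] by (simp add: fun_eq_iff deriv_along_apply)
  show "X \<triangleright> (f * g) = f * (X \<triangleright> g) + g * (X \<triangleright> f)" if "smooth_fun A g"
    using t(3)[OF f that] by (simp add: fun_eq_iff deriv_along_apply)
  show "X \<triangleright> (c *\<^sub>R f) = c *\<^sub>R (X \<triangleright> f)" for c
    using t(2)[OF f] by (simp add: fun_eq_iff deriv_along_apply scaleR_fun_apply)
  from this[of "-1"] show "X \<triangleright> (- f) = - (X \<triangleright> f)" by simp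
  have "X \<triangleright> (- g) = - (X \<triangleright> g)" if g: "smooth_fun A g" for g
    using tangentD(2)[OF vfD(1)[OF X] g, of _ "-1"] by (simp add: fun_eq_iff deriv_along_apply)
  then show "X \<triangleright> (f - g) = X \<triangleright> f - X \<triangleright> g" if "smooth_fun A g"
    using a[of "- g"] that smooth_uminus by simp
qed

lemma deriv_along_const: "vector_field A X \<Longrightarrow> X \<triangleright> (\<lambda>p. c) = 0"
  using tangent_const[OF vfD(1)] by (simp add: fun_eq_iff deriv_along_apply)

lemma deriv_along_0: "vector_field A X \<Longrightarrow> X \<triangleright> 0 = 0"
  and deriv_along_1: "vector_field A X \<Longrightarrow> X \<triangleright> 1 = 0"
  using deriv_along_const[of X 0] deriv_along_const[of X 1] by (simp_all add: zero_fun_def one_fun_def)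

lemma deriv_along_sum:
  assumes "vector_field A X" "\<And>i. i \<in> I \<Longrightarrow> smooth_fun A (f i)"
  shows "X \<triangleright> (\<Sum>i\<in>I. f i) = (\<Sum>i\<in>I. X \<triangleright> f i)"
  using tangent_sum[OF vfD(1)[OF assms(1)], of I f] assms(2)
  by (simp add: fun_eq_iff deriv_along_apply sum_fun_apply)

lemma vf_zero: "vector_field A 0"
  by (simp add: vector_field_def tangent_subspace deriv_along_left smooth_zero)

lemma vf_add: "vector_field A X \<Longrightarrow> vector_field A Y \<Longrightarrow> vector_field A (X + Y)"
  by (auto simp: vector_field_def tangent_subspace deriv_along_left smooth_add)

lemma vf_fscale: "smooth_fun A f \<Longrightarrow> vector_field A X \<Longrightarrow> vector_field A (f \<cdot> X)"
  by (auto simp: vector_field_def tangent_subspace deriv_along_left smooth_mult fscale_apply)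

lemma vf_uminus: "vector_field A X \<Longrightarrow> vector_field A (- X)"
  using vf_fscale[OF smooth_const[of "-1"], of X] by (simp add: fscale_def fun_Compl_def)

lemma vf_diff: "vector_field A X \<Longrightarrow> vector_field A Y \<Longrightarrow> vector_field A (X - Y)"
  using vf_add[OF _ vf_uminus, of X Y] by simp

lemma vf_sum: "(\<And>i. i \<in> I \<Longrightarrow> vector_field A (X i)) \<Longrightarrow> vector_field A (\<Sum>i\<in>I. X i)"
  by (induction I rule: infinite_finite_induct) (auto intro: vf_zero vf_add)

lemma vf_eqI:
  assumes "vector_field A X" "vector_field A Y" "\<And>f. smooth_fun A f \<Longrightarrow> X \<triangleright> f = Y \<triangleright> f"
  shows "X = Y"
proof (intro ext)
  fix p f
  show "X p f = Y p f"
    using assms(3)[of f] tangentD(4)[OF vfD(1)[OF assms(1)], of f p] tangentD(4)[OF vfD(1)[OF assms(2)], of f p]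
    by (cases "smooth_fun A f") (auto simp: fun_eq_iff deriv_along_apply)
qed

lemma lie_bracket_deriv: "lie_bracket X Y \<triangleright> f = X \<triangleright> Y \<triangleright> f - Y \<triangleright> X \<triangleright> f"
  by (simp add: lie_bracket_def deriv_along_def fun_diff_def)

lemma vf_lie: 
  assumes X: "vector_field A X" and Y: "vector_field A Y"
  shows "vector_field A (lie_bracket X Y)"
  unfolding vector_field_def
proof safe
  fix p
  have e: "lie_bracket X Y p f = X p (Y \<triangleright> f) - Y p (X \<triangleright> f)" for f
    by (simp add: lie_bracket_def)
  note t = tangentD[OF vfD(1)[OF X, of p]] tangentD[OF vfD(1)[OF Y, of p]]
  have ns: "Y \<triangleright> f = 0" "X \<triangleright> f = 0" if "\<not> smooth_fun A f" for f
    using tangentD(4)[OF vfD(1)[OF Y] that] tangentD(4)[OF vfD(1)[OF X] that]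
    by (auto simp: fun_eq_iff deriv_along_apply)
  have z: "X p 0 = 0" "Y p 0 = 0"
    using tangent_const[OF vfD(1)[OF X], of p 0] tangent_const[OF vfD(1)[OF Y], of p 0]
    by (simp_all add: zero_fun_def)
  show "lie_bracket X Y p \<in> tangent A p"
  proof (rule tangentI)
    fix f g assume f: "smooth_fun A f" and g: "smooth_fun A g"
    note r = deriv_along_right[OF X f] deriv_along_right[OF Y f]
    show "lie_bracket X Y p (f + g) = lie_bracket X Y p f + lie_bracket X Y p g"
      unfolding e r(1,6)[OF g] by (simp add: t(1,5) f g vfD X Y)
    show "lie_bracket X Y p (c *\<^sub>R f) = c * lie_bracket X Y p f" for c
      unfolding e r(5,10) by (simp add: t(2,6) f vfD X Y algebra_simps)
    show "lie_bracket X Y p (f * g) = f p * lie_bracket X Y p g + g p * lie_bracket X Y p f"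
      unfolding e r(3,8)[OF g]
      by (simp add: t(1,5) t(3,7) f g vfD X Y smooth_mult deriv_along_apply algebra_simps)
  next
    show "lie_bracket X Y p f = 0" if "\<not> smooth_fun A f" for f
      unfolding e ns[OF that] z by simp
  qed
next
  fix f assume "smooth_fun A f"
  then show "smooth_fun A (lie_bracket X Y \<triangleright> f)"
    by (simp add: lie_bracket_deriv vfD X Y smooth_diff)
qed

lemma form_zero: "one_form A 0"
  by (simp add: one_form_def cotangent_subspace ev_left_simps smooth_zero)

lemma form_add: "one_form A \<alpha> \<Longrightarrow> one_form A \<beta> \<Longrightarrow> one_form A (\<alpha> + \<beta>)"
  by (auto simp: one_form_def cotangent_subspace ev_left_simps smooth_add)

lemma form_fscale: "smooth_fun A f \<Longrightarrow> one_form A \<alpha> \<Longrightarrow> one_form A (f \<cdot> \<alpha>)"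
  by (auto simp: one_form_def cotangent_subspace ev_left_fscale fscale_real smooth_mult fscale_apply)

lemma form_scaleR: "one_form A \<alpha> \<Longrightarrow> one_form A (c *\<^sub>R \<alpha>)"
  using form_fscale[OF smooth_const[of c], of \<alpha>] by (simp add: fscale_def scaleR_fun_def)

lemma form_uminus: "one_form A \<alpha> \<Longrightarrow> one_form A (- \<alpha>)"
  using form_scaleR[of \<alpha> "-1"] by simp

lemma form_diff: "one_form A \<alpha> \<Longrightarrow> one_form A \<beta> \<Longrightarrow> one_form A (\<alpha> - \<beta>)"
  using form_add[OF _ form_uminus, of \<alpha> \<beta>] by simp

lemma form_sum: "(\<And>i. i \<in> I \<Longrightarrow> one_form A (\<alpha> i)) \<Longrightarrow> one_form A (\<Sum>i\<in>I. \<alpha> i)"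
  by (induction I rule: infinite_finite_induct) (auto intro: form_zero form_add)

lemma dfun_ev: "vector_field A X \<Longrightarrow> dfun A f \<odot> X = X \<triangleright> f"
  using vfD(1) by (auto simp: fun_eq_iff ev_apply deriv_along_apply dfun_def)

lemma form_dfun: "smooth_fun A f \<Longrightarrow> one_form A (dfun A f)"
  unfolding one_form_def
  by (auto simp: dfun_ev vfD) (auto simp: cotangent_def Lin_def dfun_def tangent_subspace scaleR_fun_apply)

lemma form_ev_right:
  assumes a: "one_form A \<alpha>" and X: "vector_field A X"
  shows "vector_field A Y \<Longrightarrow> \<alpha> \<odot> (X + Y) = \<alpha> \<odot> X + \<alpha> \<odot> Y" 
    "vector_field A Y \<Longrightarrow> \<alpha> \<odot> (X - Y) = \<alpha> \<odot> X - \<alpha> \<odot> Y" 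
    "\<alpha> \<odot> (f \<cdot> X) = f * (\<alpha> \<odot> X)" "\<alpha> \<odot> (- X) = - (\<alpha> \<odot> X)"
proof -
  note t = cotangentD[OF formD(1)[OF a]] and x = vfD(1)[OF X]
  show 1: "\<alpha> \<odot> (X + Y) = \<alpha> \<odot> X + \<alpha> \<odot> Y" if "vector_field A Y" for Y
    using t(1)[OF x vfD(1)[OF that]] by (simp add: fun_eq_iff ev_apply)
  show "\<alpha> \<odot> (f \<cdot> X) = f * (\<alpha> \<odot> X)"
    using t(2)[OF x] by (simp add: fun_eq_iff ev_apply fscale_apply)
  have 2: "\<alpha> \<odot> (- X) = - (\<alpha> \<odot> X)" if "vector_field A X" for X
    using t(2)[OF vfD(1)[OF that], of _ "-1"] by (simp add: fun_eq_iff ev_apply)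
  show "\<alpha> \<odot> (- X) = - (\<alpha> \<odot> X)" by (rule 2[OF X])
  show "\<alpha> \<odot> (X - Y) = \<alpha> \<odot> X - \<alpha> \<odot> Y" if "vector_field A Y"
    using 1[OF vf_uminus[OF that]] 2[OF that] by simp
qed

lemma form_ev_0: "one_form A \<alpha> \<Longrightarrow> \<alpha> \<odot> 0 = 0"
  using Lin_0[OF formD(1)[unfolded cotangent_def]] by (simp add: fun_eq_iff ev_apply)

lemma form_ev_sum: "one_form A \<alpha> \<Longrightarrow> (\<And>i. i \<in> I \<Longrightarrow> vector_field A (X i)) \<Longrightarrow>
    \<alpha> \<odot> (\<Sum>i\<in>I. X i) = (\<Sum>i\<in>I. \<alpha> \<odot> X i)"
  by (induction I rule: infinite_finite_induct)
     (simp_all add: form_ev_0 form_ev_right vf_sum)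

text \<open>Differentials of functions are test forms enough.\<close>

lemma vf_eqI_form:
  assumes "vector_field A X" "vector_field A Y" "\<And>\<alpha>. one_form A \<alpha> \<Longrightarrow> \<alpha> \<odot> X = \<alpha> \<odot> Y"
  shows "X = Y"
  using assms(3)[OF form_dfun] by (intro vf_eqI assms(1,2)) (simp add: dfun_ev assms(1,2))

lemma lie_bracket_simps:
  assumes X: "vector_field A X" and Y: "vector_field A Y"
  shows "vector_field A Z \<Longrightarrow> lie_bracket X (Y + Z) = lie_bracket X Y + lie_bracket X Z"
    "vector_field A Z \<Longrightarrow> lie_bracket (X + Z) Y = lie_bracket X Y + lie_bracket Z Y"
    "vector_field A Z \<Longrightarrow> lie_bracket X (Y - Z) = lie_bracket X Y - lie_bracket X Z"
    "vector_field A Z \<Longrightarrow> lie_bracket (X - Z) Y = lie_bracket X Y - lie_bracket Z Y"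
    "lie_bracket X (- Y) = - lie_bracket X Y" "lie_bracket (- X) Y = - lie_bracket X Y"
    "smooth_fun A f \<Longrightarrow> lie_bracket X (f \<cdot> Y) = (X \<triangleright> f) \<cdot> Y + f \<cdot> lie_bracket X Y"
    "smooth_fun A f \<Longrightarrow> lie_bracket (f \<cdot> X) Y = f \<cdot> lie_bracket X Y - (Y \<triangleright> f) \<cdot> X"
  by (rule vf_eqI;
      simp add: X Y vf_add vf_diff vf_uminus vf_fscale vf_lie vfD lie_bracket_deriv
        deriv_along_left deriv_along_right algebra_simps)+

lemma lie_bracket_swap: "lie_bracket X Y = - lie_bracket Y X"
  by (simp add: lie_bracket_def fun_eq_iff)

lemma lie_bracket_0:
  assumes "vector_field A X"
  shows "lie_bracket X 0 = 0" "lie_bracket 0 X = 0"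
  by (rule vf_eqI; simp add: assms vf_zero vf_lie lie_bracket_deriv deriv_along_left deriv_along_0)+

section \<open>Extension to global fields and tensoriality\<close>

text \<open>The frame fields of \<open>local_frame\<close> are global, so constant coefficients with
  the right values at p give an extension.\<close>

lemma extend_tangent:
  assumes "v \<in> tangent A p"
  obtains X where "vector_field A X" "X p = v"
proof -
  obtain U and I :: "'e set" and E :: "'e \<Rightarrow> 'a vfield" and x where f: "open U" "p \<in> U" "finite I"
    "\<And>i. i \<in> I \<Longrightarrow> vector_field A (E i)" "\<And>i. smooth_fun A (x i)"
    "\<And>q v. q \<in> U \<Longrightarrow> v \<in> tangent A q \<Longrightarrow> v = (\<Sum>i\<in>I. v (x i) *\<^sub>R E i q)"
    by (rule local_frame) (rule that)
  show thesis
  proof (rule that)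
    show "vector_field A (\<Sum>i\<in>I. (\<lambda>q. v (x i)) \<cdot> E i)"
      using f(4) by (intro vf_sum vf_fscale smooth_const)
    show "(\<Sum>i\<in>I. (\<lambda>q. v (x i)) \<cdot> E i) p = v"
      using f(6)[OF f(2) assms] by (simp add: sum_fun_apply fscale_apply)
  qed
qed

lemma form_eqI:
  assumes "one_form A \<alpha>" "one_form A \<beta>" "\<And>X. vector_field A X \<Longrightarrow> \<alpha> \<odot> X = \<beta> \<odot> X"
  shows "\<alpha> = \<beta>"
proof (intro ext)
  fix p v
  show "\<alpha> p v = \<beta> p v"
  proof (cases "v \<in> tangent A p")
    case True
    then obtain X where "vector_field A X" "X p = v" by (rule extend_tangent)
    then show ?thesis using fun_cong[OF assms(3)[of X], of p] by (simp add: ev_apply)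
  next
    case False
    then show ?thesis using cotangentD(3)[OF formD(1)] assms(1,2) by metis
  qed
qed

lemma cotangent_expansion:
  assumes f: "\<And>i. i \<in> I \<Longrightarrow> vector_field A (E i)" "\<And>i. smooth_fun A (x i)"
    "\<And>v. v \<in> tangent A q \<Longrightarrow> v = (\<Sum>i\<in>I. v (x i) *\<^sub>R E i q)"
    and a: "a \<in> cotangent A q"
  shows "a = (\<Sum>i\<in>I. a (E i q) *\<^sub>R dfun A (x i) q)"
proof
  fix v
  show "a v = (\<Sum>i\<in>I. a (E i q) *\<^sub>R dfun A (x i) q) v"
  proof (cases "v \<in> tangent A q")
    case True
    have "a v = a (\<Sum>i\<in>I. v (x i) *\<^sub>R E i q)" using f(3)[OF True] by simp
    also have "\<dots> = (\<Sum>i\<in>I. v (x i) * a (E i q))"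
      using Lin_sum[OF a[unfolded cotangent_def] subspace_tangent, of I "\<lambda>i. E i q" "\<lambda>i. v (x i)"] vfD(1)[OF f(1)] by simp
    finally show ?thesis using True by (simp add: sum_fun_apply scaleR_fun_apply dfun_def mult.commute)
  next
    case False
    then show ?thesis using cotangentD(3)[OF a False]
      by (simp add: sum_fun_apply scaleR_fun_apply dfun_def)
  qed
qed

lemma extend_cotangent:
  assumes "a \<in> cotangent A p"
  obtains \<alpha> where "one_form A \<alpha>" "\<alpha> p = a"
proof -
  obtain U and I :: "'e set" and E :: "'e \<Rightarrow> 'a vfield" and x where f: "open U" "p \<in> U" "finite I"
    "\<And>i. i \<in> I \<Longrightarrow> vector_field A (E i)" "\<And>i. smooth_fun A (x i)"
    "\<And>q v. q \<in> U \<Longrightarrow> v \<in> tangent A q \<Longrightarrow> v = (\<Sum>i\<in>I. v (x i) *\<^sub>R E i q)"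
    by (rule local_frame) (rule that)
  show thesis
  proof (rule that)
    show "one_form A (\<Sum>i\<in>I. (\<lambda>q. a (E i p)) \<cdot> dfun A (x i))"
      using f(5) by (intro form_sum form_fscale smooth_const form_dfun)
    show "(\<Sum>i\<in>I. (\<lambda>q. a (E i p)) \<cdot> dfun A (x i)) p = a"
      using cotangent_expansion[OF f(4,5) f(6)[OF f(2)] assms] by (simp add: sum_fun_apply fscale_apply)
  qed
qed

text \<open>The operators for which the description in \<open>form_of\<close> denotes
  something.\<close>

definition tensorial :: "('a vfield \<Rightarrow> 'a \<Rightarrow> real) \<Rightarrow> bool" where
  "tensorial \<Phi> \<longleftrightarrow>
     (\<forall>X Y. vector_field A X \<longrightarrow> vector_field A Y \<longrightarrow> \<Phi> (X + Y) = \<Phi> X + \<Phi> Y) \<and>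
     (\<forall>f X. smooth_fun A f \<longrightarrow> vector_field A X \<longrightarrow> \<Phi> (f \<cdot> X) = f * \<Phi> X) \<and>
     (\<forall>X. vector_field A X \<longrightarrow> smooth_fun A (\<Phi> X))"

lemma tensorial_sum:
  assumes "tensorial \<Phi>" "\<And>i. i \<in> I \<Longrightarrow> vector_field A (X i)"
  shows "\<Phi> (\<Sum>i\<in>I. X i) = (\<Sum>i\<in>I. \<Phi> (X i))"
  using assms(2)
proof (induction I rule: infinite_finite_induct)
  case (insert i I)
  have "\<Phi> (X i + (\<Sum>i\<in>I. X i)) = \<Phi> (X i) + \<Phi> (\<Sum>i\<in>I. X i)"
    using assms(1) insert.prems by (auto simp: tensorial_def vf_sum)
  moreover have "\<Phi> (\<Sum>i\<in>I. X i) = (\<Sum>i\<in>I. \<Phi> (X i))"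
    by (rule insert.IH) (simp add: insert.prems)
  ultimately show ?case unfolding sum.insert[OF insert.hyps(1,2)] by (simp only:)
next
  have "\<Phi> 0 = 0"
    using assms(1) vf_zero smooth_zero unfolding tensorial_def
    by (metis (no_types, lifting) add_cancel_right_right add_0)
  then show "\<Phi> (\<Sum>i\<in>I. X i) = (\<Sum>i\<in>I. \<Phi> (X i))" if "infinite I" for I :: "'b set" using that by simp
  show "\<Phi> (\<Sum>i\<in>{}. X i) = (\<Sum>i\<in>{}. \<Phi> (X i))" using \<open>\<Phi> 0 = 0\<close> by simp
qed

text \<open>If X vanishes at p, then \<rho> X is a global combination of frame fields whose
  coefficients vanish at p, and so does its image under \<Phi>. The general case is the difference
  of two fields.\<close>

lemma tensorial_pointwise:
  assumes t: "tensorial \<Phi>" and X: "vector_field A X" and Y: "vector_field A Y" and "X p = Y p"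
  shows "\<Phi> X p = \<Phi> Y p"
proof -
  have *: "\<Phi> X p = 0" if X: "vector_field A X" and 0: "X p = 0" for X
  proof -
    obtain U and I :: "'e set" and E :: "'e \<Rightarrow> 'a vfield" and x where f: "open U" "p \<in> U" "finite I"
      "\<And>i. i \<in> I \<Longrightarrow> vector_field A (E i)" "\<And>i. smooth_fun A (x i)"
      "\<And>q v. q \<in> U \<Longrightarrow> v \<in> tangent A q \<Longrightarrow> v = (\<Sum>i\<in>I. v (x i) *\<^sub>R E i q)"
      by (rule local_frame) (rule that)
    obtain \<rho> where \<rho>: "smooth_fun A \<rho>" "\<rho> p = 1" "\<And>q. q \<notin> U \<Longrightarrow> \<rho> q = 0"
      using bump_function[OF f(1,2)] by blast
    have "\<rho> \<cdot> X = (\<Sum>i\<in>I. (\<rho> * (X \<triangleright> x i)) \<cdot> E i)"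
    proof
      fix q
      show "(\<rho> \<cdot> X) q = (\<Sum>i\<in>I. (\<rho> * (X \<triangleright> x i)) \<cdot> E i) q"
      proof (cases "q \<in> U")
        case True
        have "\<rho> q *\<^sub>R X q = \<rho> q *\<^sub>R (\<Sum>i\<in>I. X q (x i) *\<^sub>R E i q)"
          using f(6)[OF True vfD(1)[OF X]] by simp
        then show ?thesis by (simp add: fscale_apply sum_fun_apply scaleR_sum_right deriv_along_apply)
      qed (simp add: fscale_apply sum_fun_apply \<rho>(3))
    qed
    then have "\<Phi> (\<rho> \<cdot> X) = (\<Sum>i\<in>I. (\<rho> * (X \<triangleright> x i)) * \<Phi> (E i))"
      using tensorial_sum[OF t, of I "\<lambda>i. (\<rho> * (X \<triangleright> x i)) \<cdot> E i"] t X f(4,5) \<rho>(1)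
      by (simp add: tensorial_def vf_fscale smooth_mult vfD)
    moreover have "\<Phi> (\<rho> \<cdot> X) = \<rho> * \<Phi> X" using t X \<rho>(1) by (simp add: tensorial_def)
    ultimately have "\<rho> * \<Phi> X = (\<Sum>i\<in>I. (\<rho> * (X \<triangleright> x i)) * \<Phi> (E i))" by simp
    from fun_cong[OF this, of p] show ?thesis
      by (simp add: \<rho>(2) sum_fun_apply deriv_along_apply 0)
  qed
  have "\<Phi> (X - Y) p = 0" by (rule *) (simp_all add: vf_diff X Y assms(4))
  moreover have "\<Phi> ((X - Y) + Y) = \<Phi> (X - Y) + \<Phi> Y"
    using t X Y vf_diff unfolding tensorial_def by blast
  ultimately show ?thesis by simp
qed

text \<open>The form is evaluated on a vector by choosing any global extension of it and applying
  \<Phi>; \<open>tensorial_pointwise\<close> makes the choice irrelevant.\<close>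

lemma form_of_tensorial:
  assumes t: "tensorial \<Phi>"
  shows "one_form A (form_of A \<Phi>)" "vector_field A X \<Longrightarrow> form_of A \<Phi> \<odot> X = \<Phi> X"
proof -
  define ex where "ex p v = (SOME X. vector_field A X \<and> X p = v)" for p v
  have ex: "vector_field A (ex p v)" "ex p v p = v" if "v \<in> tangent A p" for p v
    using someI_ex[of "\<lambda>X. vector_field A X \<and> X p = v"] extend_tangent[OF that] unfolding ex_def by blast+
  define \<gamma> where "\<gamma> p v = (if v \<in> tangent A p then \<Phi> (ex p v) p else 0)" for p v
  have eval: "\<gamma> p (X p) = \<Phi> X p" if "vector_field A X" for X p
    using tensorial_pointwise[OF t ex(1) that ex(2)] vfD(1)[OF that] by (simp add: \<gamma>_def)
  have \<gamma>X: "\<gamma> \<odot> X = \<Phi> X" if "vector_field A X" for X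
    using eval[OF that] by (simp add: fun_eq_iff ev_apply)
  have "one_form A \<gamma>"
    unfolding one_form_def
  proof safe
    fix p
    show "\<gamma> p \<in> cotangent A p"
      unfolding cotangent_def Lin_def
    proof (safe, simp)
      fix v w assume v: "v \<in> tangent A p" and w: "w \<in> tangent A p"
      have "\<gamma> p ((ex p v + ex p w) p) = \<gamma> p (ex p v p) + \<gamma> p (ex p w p)"
        using t ex v w unfolding eval[OF ex(1)[OF v]] eval[OF ex(1)[OF w]]
          eval[OF vf_add[OF ex(1)[OF v] ex(1)[OF w]]] by (simp add: tensorial_def)
      then show "\<gamma> p (v + w) = \<gamma> p v + \<gamma> p w" using ex(2) v w by simp
    next
      fix c v assume v: "v \<in> tangent A p"
      have "\<gamma> p (((\<lambda>q. c) \<cdot> ex p v) p) = c * \<gamma> p (ex p v p)"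
        using t ex v smooth_const[of c] unfolding eval[OF ex(1)[OF v]]
          eval[OF vf_fscale[OF smooth_const ex(1)[OF v]]] by (simp add: tensorial_def)
      then show "\<gamma> p (c *\<^sub>R v) = c *\<^sub>R \<gamma> p v" using ex(2) v by (simp add: fscale_apply)
    next
      fix v assume "v \<notin> tangent A p"
      then show "\<gamma> p v = 0" by (simp add: \<gamma>_def)
    qed
  qed (use t in \<open>simp add: \<gamma>X tensorial_def\<close>)
  note g1 = this
  have "one_form A (form_of A \<Phi>) \<and> (\<forall>X. vector_field A X \<longrightarrow> form_of A \<Phi> \<odot> X = \<Phi> X)"
    unfolding form_of_def
  proof (rule theI[of _ \<gamma>])
    show "one_form A \<gamma> \<and> (\<forall>X. vector_field A X \<longrightarrow> \<gamma> \<odot> X = \<Phi> X)"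
      using g1 \<gamma>X by blast
    show "\<beta> = \<gamma>" if "one_form A \<beta> \<and> (\<forall>X. vector_field A X \<longrightarrow> \<beta> \<odot> X = \<Phi> X)" for \<beta>
      by (rule form_eqI) (use that g1 \<gamma>X in simp_all)
  qed
  then show "one_form A (form_of A \<Phi>)" "vector_field A X \<Longrightarrow> form_of A \<Phi> \<odot> X = \<Phi> X" by auto
qed

text \<open>When Y is multiplied by a function f, the term with the derivative of f along X arises
  once from X acting on \<alpha>(Y) and once from the bracket, and cancels.\<close>

lemma lie_form:
  assumes X: "vector_field A X" and a: "one_form A \<alpha>"
  shows form_lie: "one_form A (lie_form A X \<alpha>)"
    and lie_form_ev: "vector_field A Y \<Longrightarrow> lie_form A X \<alpha> \<odot> Y = X \<triangleright> (\<alpha> \<odot> Y) - \<alpha> \<odot> lie_bracket X Y"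
proof -
  have "tensorial (\<lambda>Y. X \<triangleright> (\<alpha> \<odot> Y) - \<alpha> \<odot> lie_bracket X Y)"
    unfolding tensorial_def
    by (auto simp: form_ev_right lie_bracket_simps deriv_along_right vf_lie vf_fscale vf_add formD vfD X a
        smooth_intros algebra_simps)
  from form_of_tensorial[OF this]
  show "one_form A (lie_form A X \<alpha>)"
    "vector_field A Y \<Longrightarrow> lie_form A X \<alpha> \<odot> Y = X \<triangleright> (\<alpha> \<odot> Y) - \<alpha> \<odot> lie_bracket X Y"
    unfolding lie_form_def by auto
qed

end

section \<open>2-forms, endomorphisms and bivector fields\<close>

lemma flat_eq: "flat \<theta> = \<theta>"
  by (simp add: flat_def fun_eq_iff)

lemma Alt2D:
  assumes w: "\<omega> \<in> Alt2 V" and V: "\<And>x y. x \<in> V \<Longrightarrow> y \<in> V \<Longrightarrow> x + y \<in> V" and x: "x \<in> V" and y: "y \<in> V"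
  shows "\<omega> x \<in> Lin V UNIV" "\<omega> x y = - \<omega> y x" "\<omega> (x + y) = \<omega> x + \<omega> y" "\<omega> (c *\<^sub>R x) = c *\<^sub>R \<omega> x"
proof -
  have L: "\<omega> \<in> Lin V (Lin V UNIV)" and 0: "\<And>x. x \<in> V \<Longrightarrow> \<omega> x x = 0" using w by (auto simp: Alt2_def)
  note l = LinD[OF L]
  show "\<omega> x \<in> Lin V UNIV" by (rule l(1)[OF x])
  show "\<omega> (x + y) = \<omega> x + \<omega> y" "\<omega> (c *\<^sub>R x) = c *\<^sub>R \<omega> x" using l(2,3) x y by auto
  have "\<omega> (x + y) (x + y) = \<omega> x x + \<omega> x y + \<omega> y x + \<omega> y y"
    using l(2)[OF x y] LinD(2)[OF l(1)[OF x] x y] LinD(2)[OF l(1)[OF y] x y] by simp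
  then show "\<omega> x y = - \<omega> y x" using 0 x y V by simp
qed

context smooth_manifold
begin

lemma two_form_ev:
  assumes t: "two_form A \<theta>" and X: "vector_field A X"
  shows "one_form A (\<theta> \<odot> X)"
    and "vector_field A Y \<Longrightarrow> \<theta> \<odot> X \<odot> Y = - (\<theta> \<odot> Y \<odot> X)"
    and "vector_field A Y \<Longrightarrow> \<theta> \<odot> (X + Y) = \<theta> \<odot> X + \<theta> \<odot> Y"
    and "vector_field A Y \<Longrightarrow> \<theta> \<odot> (X - Y) = \<theta> \<odot> X - \<theta> \<odot> Y"
    and "\<theta> \<odot> (f \<cdot> X) = f \<cdot> (\<theta> \<odot> X)"
    and "\<theta> \<odot> (- X) = - (\<theta> \<odot> X)"
proof -
  have Alt: "\<theta> p \<in> Alt2 (tangent A p)" for p using t by (simp add: two_form_def)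
  note a = Alt2D[OF Alt tangent_subspace(2)]
  show "one_form A (\<theta> \<odot> X)"
    unfolding one_form_def cotangent_def
    using a(1)[OF _ _ vfD(1)[OF X] vfD(1)[OF X]] t X by (auto simp: ev_apply two_form_def)
  show "\<theta> \<odot> X \<odot> Y = - (\<theta> \<odot> Y \<odot> X)" if "vector_field A Y"
    unfolding fun_eq_iff ev_apply fun_Compl_def using a(2)[OF _ _ vfD(1)[OF X] vfD(1)[OF that]] by blast
  have add: "\<theta> \<odot> (X + Y) = \<theta> \<odot> X + \<theta> \<odot> Y" if "vector_field A X" "vector_field A Y" for X Y
    using a(3)[OF _ _ vfD(1)[OF that(1)] vfD(1)[OF that(2)]] by (intro ext) (simp add: ev_apply)
  show sc: "\<theta> \<odot> (f \<cdot> X) = f \<cdot> (\<theta> \<odot> X)" for f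
    using a(4)[OF _ _ vfD(1)[OF X] vfD(1)[OF X]] by (intro ext) (simp add: ev_apply fscale_apply)
  show "\<theta> \<odot> (X + Y) = \<theta> \<odot> X + \<theta> \<odot> Y" if "vector_field A Y" by (rule add[OF X that])
  have neg: "\<theta> \<odot> (- Y) = - (\<theta> \<odot> Y)" if "vector_field A Y" for Y
  proof
    fix p
    show "(\<theta> \<odot> (- Y)) p = (- (\<theta> \<odot> Y)) p"
      using a(4)[OF _ _ vfD(1)[OF that] vfD(1)[OF that], of p "-1"] by (simp add: ev_apply)
  qed
  show "\<theta> \<odot> (- X) = - (\<theta> \<odot> X)" by (rule neg[OF X])
  show "\<theta> \<odot> (X - Y) = \<theta> \<odot> X - \<theta> \<odot> Y" if "vector_field A Y"
    using add[OF X vf_uminus[OF that]] neg[OF that] by simp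
qed

lemma two_form_ev_0: "two_form A \<theta> \<Longrightarrow> \<theta> \<odot> 0 = 0"
  using two_form_ev(4)[OF _ vf_zero vf_zero] by simp

lemma two_form_smooth:
  "two_form A \<theta> \<Longrightarrow> vector_field A X \<Longrightarrow> vector_field A Y \<Longrightarrow> smooth_fun A (\<theta> \<odot> X \<odot> Y)"
  by (simp add: two_form_def)

lemma endo_ev:
  assumes F: "endo_field A F" and X: "vector_field A X"
  shows "vector_field A (F \<odot> X)"
    and "vector_field A Y \<Longrightarrow> F \<odot> (X + Y) = F \<odot> X + F \<odot> Y"
    and "vector_field A Y \<Longrightarrow> F \<odot> (X - Y) = F \<odot> X - F \<odot> Y"
    and "F \<odot> (f \<cdot> X) = f \<cdot> (F \<odot> X)"
    and "F \<odot> (- X) = - (F \<odot> X)"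
proof -
  have L: "F p \<in> Lin (tangent A p) (tangent A p)" for p using F by (simp add: endo_field_def)
  note l = LinD[OF L]
  show "vector_field A (F \<odot> X)" using F X by (simp add: endo_field_def)
  have add: "F \<odot> (X + Y) = F \<odot> X + F \<odot> Y" if "vector_field A X" "vector_field A Y" for X Y
    using l(2)[OF vfD(1)[OF that(1)] vfD(1)[OF that(2)]] by (intro ext) (simp add: ev_apply)
  show "F \<odot> (f \<cdot> X) = f \<cdot> (F \<odot> X)"
    using l(3)[OF vfD(1)[OF X]] by (intro ext) (simp add: ev_apply fscale_apply)
  have neg: "F \<odot> (- Y) = - (F \<odot> Y)" if "vector_field A Y" for Y
  proof
    fix p
    show "(F \<odot> (- Y)) p = (- (F \<odot> Y)) p"
      using l(3)[OF vfD(1)[OF that], of p "-1"] by (simp add: ev_apply)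
  qed
  show "F \<odot> (X + Y) = F \<odot> X + F \<odot> Y" if "vector_field A Y" by (rule add[OF X that])
  show "F \<odot> (- X) = - (F \<odot> X)" by (rule neg[OF X])
  show "F \<odot> (X - Y) = F \<odot> X - F \<odot> Y" if "vector_field A Y"
    using add[OF X vf_uminus[OF that]] neg[OF that] by simp
qed

lemma endo_ev_0: "endo_field A F \<Longrightarrow> F \<odot> 0 = 0"
  using endo_ev(3)[OF _ vf_zero vf_zero] by simp

lemma form_comp_ev: "form_comp \<alpha> F \<odot> X = \<alpha> \<odot> (F \<odot> X)"
  by (simp add: form_comp_def ev_def)

lemma form_form_comp:
  assumes F: "endo_field A F" and a: "one_form A \<alpha>"
  shows "one_form A (form_comp \<alpha> F)"
proof -
  have L: "F p \<in> Lin (tangent A p) (tangent A p)" for p using F by (simp add: endo_field_def)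
  note l = LinD[OF L] and c = cotangentD[OF formD(1)[OF a]]
  have "\<alpha> p (F p v) = 0" if "v \<notin> tangent A p" for p v
    using l(4)[OF that] Lin_0[OF formD(1)[OF a, unfolded cotangent_def]] by simp
  then show ?thesis
    unfolding one_form_def form_comp_ev using F a
    by (auto simp: formD endo_ev form_comp_def cotangent_def Lin_def l c)
qed

text \<open>The description is witnessed by the sum of P(a, dx) E over a local frame: expanding b in
  the differentials dx identifies its value there with P(a, b). Uniqueness holds because
  differentials separate tangent vectors.\<close>

lemma sharp:
  assumes P: "bivector_field A P" and a: "a \<in> cotangent A p"
  shows "sharp A P p a \<in> tangent A p" "b \<in> cotangent A p \<Longrightarrow> b (sharp A P p a) = P p a b"
proof -
  obtain U and I :: "'e set" and E :: "'e \<Rightarrow> 'a vfield" and x where f: "open U" "p \<in> U" "finite I"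
    "\<And>i. i \<in> I \<Longrightarrow> vector_field A (E i)" "\<And>i. smooth_fun A (x i)"
    "\<And>q v. q \<in> U \<Longrightarrow> v \<in> tangent A q \<Longrightarrow> v = (\<Sum>i\<in>I. v (x i) *\<^sub>R E i q)"
    by (rule local_frame) (rule that)
  have "P p \<in> Alt2 (cotangent A p)" using P by (simp add: bivector_field_def)
  from Alt2D(1)[OF this cotangent_subspace(2) a a]
  have La: "P p a \<in> Lin (cotangent A p) UNIV" .
  define v where "v = (\<Sum>i\<in>I. P p a (dfun A (x i) p) *\<^sub>R E i p)"
  have v: "v \<in> tangent A p"
    unfolding v_def by (intro tangent_sum_mem tangent_subspace(3) vfD(1) f(4))
  have dx: "dfun A (x i) p \<in> cotangent A p" for i by (rule formD(1)[OF form_dfun[OF f(5)]])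
  have bv: "b v = P p a b" if b: "b \<in> cotangent A p" for b
  proof -
    have "b v = (\<Sum>i\<in>I. P p a (dfun A (x i) p) * b (E i p))"
      unfolding v_def using Lin_sum[OF b[unfolded cotangent_def] subspace_tangent, of I "\<lambda>i. E i p"] vfD(1)[OF f(4)] by simp
    also have "\<dots> = P p a (\<Sum>i\<in>I. b (E i p) *\<^sub>R dfun A (x i) p)"
      using Lin_sum[OF La subspace_cotangent, of I "\<lambda>i. dfun A (x i) p" "\<lambda>i. b (E i p)"] dx
      by (simp add: mult.commute)
    finally show ?thesis using cotangent_expansion[OF f(4,5) f(6)[OF f(2)] b] by simp
  qed
  have u: "w = v" if w: "w \<in> tangent A p" "\<forall>b\<in>cotangent A p. b w = P p a b" for w
  proof
    fix g
    show "w g = v g"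
    proof (cases "smooth_fun A g")
      case True
      have "dfun A g p \<in> cotangent A p" by (rule formD(1)[OF form_dfun[OF True]])
      then have "dfun A g p w = dfun A g p v" using w(2) bv by simp
      then show ?thesis using v w(1) by (simp add: dfun_def)
    qed (simp add: tangentD(4)[OF v] tangentD(4)[OF w(1)])
  qed
  have "sharp A P p a \<in> tangent A p \<and> (\<forall>b\<in>cotangent A p. b (sharp A P p a) = P p a b)"
    unfolding sharp_def
  proof (rule theI[of _ v])
    show "v \<in> tangent A p \<and> (\<forall>b\<in>cotangent A p. b v = P p a b)" using v bv by blast
    show "w = v" if "w \<in> tangent A p \<and> (\<forall>b\<in>cotangent A p. b w = P p a b)" for w
      using u that by blast
  qed
  then show "sharp A P p a \<in> tangent A p" "b \<in> cotangent A p \<Longrightarrow> b (sharp A P p a) = P p a b" by auto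
qed

lemma sharp_ev:
  assumes P: "bivector_field A P" and a: "one_form A \<alpha>"
  shows "vector_field A (sharp A P \<odot> \<alpha>)"
    and "one_form A \<beta> \<Longrightarrow> P \<odot> \<alpha> \<odot> \<beta> = \<beta> \<odot> (sharp A P \<odot> \<alpha>)"
    and "one_form A \<beta> \<Longrightarrow> \<alpha> \<odot> (sharp A P \<odot> \<beta>) = - (\<beta> \<odot> (sharp A P \<odot> \<alpha>))"
    and "one_form A \<beta> \<Longrightarrow> sharp A P \<odot> (\<alpha> + \<beta>) = sharp A P \<odot> \<alpha> + sharp A P \<odot> \<beta>"
    and "one_form A \<beta> \<Longrightarrow> sharp A P \<odot> (\<alpha> - \<beta>) = sharp A P \<odot> \<alpha> - sharp A P \<odot> \<beta>"
    and "smooth_fun A f \<Longrightarrow> sharp A P \<odot> (f \<cdot> \<alpha>) = f \<cdot> (sharp A P \<odot> \<alpha>)"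
    and "sharp A P \<odot> (- \<alpha>) = - (sharp A P \<odot> \<alpha>)"
proof -
  have Alt: "P p \<in> Alt2 (cotangent A p)" for p using P by (simp add: bivector_field_def)
  note al = Alt2D[OF Alt cotangent_subspace(2)]
  have ev: "P \<odot> \<alpha> \<odot> \<beta> = \<beta> \<odot> (sharp A P \<odot> \<alpha>)" if "one_form A \<alpha>" "one_form A \<beta>" for \<alpha> \<beta>
    using sharp(2)[OF P formD(1)[OF that(1)] formD(1)[OF that(2)]] by (simp add: fun_eq_iff ev_apply)
  then show "P \<odot> \<alpha> \<odot> \<beta> = \<beta> \<odot> (sharp A P \<odot> \<alpha>)" if "one_form A \<beta>" using a that .
  have vf: "vector_field A (sharp A P \<odot> \<alpha>)" if a: "one_form A \<alpha>" for \<alpha>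
    unfolding vector_field_def
  proof safe
    show t: "(sharp A P \<odot> \<alpha>) p \<in> tangent A p" for p
      using sharp(1)[OF P formD(1)[OF a]] by (simp add: ev_apply)
    fix f assume f: "smooth_fun A f"
    \<comment> \<open>Smoothness of the field is smoothness of P on the forms \<alpha> and
      df.\<close>
    have "sharp A P \<odot> \<alpha> \<triangleright> f = dfun A f \<odot> (sharp A P \<odot> \<alpha>)"
      using t by (simp add: fun_eq_iff ev_apply deriv_along_apply dfun_def)
    also have "\<dots> = P \<odot> \<alpha> \<odot> dfun A f" using ev[OF a form_dfun[OF f]] by simp
    finally show "smooth_fun A (sharp A P \<odot> \<alpha> \<triangleright> f)"
      using P a form_dfun[OF f] by (simp add: bivector_field_def)
  qed
  show "vector_field A (sharp A P \<odot> \<alpha>)" by (rule vf[OF a])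
  show "\<alpha> \<odot> (sharp A P \<odot> \<beta>) = - (\<beta> \<odot> (sharp A P \<odot> \<alpha>))" if b: "one_form A \<beta>"
  proof -
    have "P \<odot> \<beta> \<odot> \<alpha> = - (P \<odot> \<alpha> \<odot> \<beta>)"
      using al(2)[OF _ _ formD(1)[OF b] formD(1)[OF a]] by (intro ext) (simp add: ev_apply)
    then show ?thesis using ev[OF a b] ev[OF b a] by simp
  qed
  have add: "sharp A P \<odot> (\<alpha> + \<beta>) = sharp A P \<odot> \<alpha> + sharp A P \<odot> \<beta>" if "one_form A \<alpha>" "one_form A \<beta>" for \<alpha> \<beta>
  proof (rule vf_eqI_form)
    show "vector_field A (sharp A P \<odot> (\<alpha> + \<beta>))" "vector_field A (sharp A P \<odot> \<alpha> + sharp A P \<odot> \<beta>)"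
      by (simp_all add: vf form_add vf_add that)
    fix \<gamma> assume g: "one_form A \<gamma>"
    have "P \<odot> (\<alpha> + \<beta>) = P \<odot> \<alpha> + P \<odot> \<beta>"
      using al(3)[OF _ _ formD(1)[OF that(1)] formD(1)[OF that(2)]] by (intro ext) (simp add: ev_apply)
    then have "P \<odot> (\<alpha> + \<beta>) \<odot> \<gamma> = P \<odot> \<alpha> \<odot> \<gamma> + P \<odot> \<beta> \<odot> \<gamma>" by (simp add: ev_left_simps)
    then show "\<gamma> \<odot> (sharp A P \<odot> (\<alpha> + \<beta>)) = \<gamma> \<odot> (sharp A P \<odot> \<alpha> + sharp A P \<odot> \<beta>)"
      by (simp add: ev form_add that g form_ev_right vf)
  qed
  have sc: "sharp A P \<odot> (f \<cdot> \<alpha>) = f \<cdot> (sharp A P \<odot> \<alpha>)" if f: "smooth_fun A f" and a: "one_form A \<alpha>" for f \<alpha>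
  proof (rule vf_eqI_form)
    show "vector_field A (sharp A P \<odot> (f \<cdot> \<alpha>))" "vector_field A (f \<cdot> (sharp A P \<odot> \<alpha>))"
      by (simp_all add: vf form_fscale vf_fscale f a)
    fix \<gamma> assume g: "one_form A \<gamma>"
    have "P \<odot> (f \<cdot> \<alpha>) = f \<cdot> (P \<odot> \<alpha>)"
      using al(4)[OF _ _ formD(1)[OF a] formD(1)[OF a]] by (intro ext) (simp add: ev_apply fscale_apply)
    then have "P \<odot> (f \<cdot> \<alpha>) \<odot> \<gamma> = f * (P \<odot> \<alpha> \<odot> \<gamma>)" by (simp add: ev_left_fscale fscale_real)
    then show "\<gamma> \<odot> (sharp A P \<odot> (f \<cdot> \<alpha>)) = \<gamma> \<odot> (f \<cdot> (sharp A P \<odot> \<alpha>))"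
      by (simp add: ev form_fscale f a g form_ev_right vf)
  qed
  have neg: "sharp A P \<odot> (- \<alpha>) = - (sharp A P \<odot> \<alpha>)" if "one_form A \<alpha>" for \<alpha>
    using sc[OF smooth_const[of "-1"] that] by (simp add: fscale_def fun_Compl_def)
  show "sharp A P \<odot> (\<alpha> + \<beta>) = sharp A P \<odot> \<alpha> + sharp A P \<odot> \<beta>" if "one_form A \<beta>" by (rule add[OF a that])
  show "smooth_fun A f \<Longrightarrow> sharp A P \<odot> (f \<cdot> \<alpha>) = f \<cdot> (sharp A P \<odot> \<alpha>)" by (rule sc[OF _ a])
  show "sharp A P \<odot> (- \<alpha>) = - (sharp A P \<odot> \<alpha>)" by (rule neg[OF a])
  show "sharp A P \<odot> (\<alpha> - \<beta>) = sharp A P \<odot> \<alpha> - sharp A P \<odot> \<beta>" if "one_form A \<beta>"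
    using add[OF a form_uminus[OF that]] neg[OF that] by simp
qed

lemma sharp_ev_0: "bivector_field A P \<Longrightarrow> sharp A P \<odot> 0 = 0"
  using sharp_ev(5)[OF _ form_zero form_zero] by simp

lemmas field_closure = vf_zero vf_add vf_diff vf_uminus vf_fscale vf_sum vf_lie vfD(2)
  form_zero form_add form_diff form_uminus form_fscale form_scaleR form_sum form_dfun formD(2) form_lie
  smooth_intros

section \<open>Exterior derivatives\<close>

lemma d1_left:
  assumes "one_form A \<xi>" "vector_field A X" "vector_field A Y"
  shows "vector_field A W \<Longrightarrow> d1 \<xi> (X + W) Y = d1 \<xi> X Y + d1 \<xi> W Y"
    "smooth_fun A f \<Longrightarrow> d1 \<xi> (f \<cdot> X) Y = f * d1 \<xi> X Y"
    "d1 \<xi> (- X) Y = - d1 \<xi> X Y"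
  using assms by (simp_all add: d1_def field_closure form_ev_right lie_bracket_simps deriv_along_left
      deriv_along_right algebra_simps)

lemma d1_swap: "one_form A \<xi> \<Longrightarrow> vector_field A X \<Longrightarrow> vector_field A Y \<Longrightarrow> d1 \<xi> X Y = - d1 \<xi> Y X"
  using lie_bracket_swap[of X Y] by (simp add: d1_def form_ev_right vf_lie)

lemma tensorial_d2:
  assumes t: "two_form A \<theta>" and X: "vector_field A X" and Y: "vector_field A Y"
  shows "tensorial (d2 \<theta> X Y)"
  unfolding tensorial_def
proof (intro conjI allI impI)
  note s = d2_def X Y field_closure two_form_ev(1,3-6)[OF t] form_ev_right lie_bracket_simps deriv_along_left
    deriv_along_right two_form_smooth[OF t] ev_left_simps ev_left_fscale fscale_real
  fix V W assume V: "vector_field A V" and W: "vector_field A W"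
  show "d2 \<theta> X Y (V + W) = d2 \<theta> X Y V + d2 \<theta> X Y W"
    by (simp add: s V W)
next
  note s = d2_def X Y field_closure two_form_ev(1,3-6)[OF t] form_ev_right lie_bracket_simps deriv_along_left
    deriv_along_right two_form_smooth[OF t] ev_left_simps ev_left_fscale fscale_real
  fix f W assume f: "smooth_fun A f" and W: "vector_field A W"
  show "d2 \<theta> X Y (f \<cdot> W) = f * d2 \<theta> X Y W"
    using two_form_ev(2)[OF t W Y] by (simp add: s f W algebra_simps)
next
  fix W assume W: "vector_field A W"
  show "smooth_fun A (d2 \<theta> X Y W)"
    by (simp add: d2_def X Y W field_closure two_form_smooth[OF t])
qed

lemma contr_d2:
  assumes "two_form A \<theta>" "vector_field A X" "vector_field A Y"
  shows "one_form A (contr_d2 A \<theta> X Y)" "vector_field A W \<Longrightarrow> contr_d2 A \<theta> X Y \<odot> W = d2 \<theta> X Y W"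
  unfolding contr_d2_def using form_of_tensorial[OF tensorial_d2[OF assms]] by auto

end

section \<open>The Schouten bracket of a bivector field with itself\<close>

context smooth_manifold
begin

text \<open>A decomposition of a bivector field holds only on an open set, so the brackets and
  derivatives in the Schouten rule must be seen to depend on germs alone.\<close>

lemma lie_bracket_local:
  assumes f: "vector_field A X" "vector_field A Y" "vector_field A X'" "vector_field A Y'"
    and U: "open U" "p \<in> U" and eq: "\<And>q. q \<in> U \<Longrightarrow> X q = X' q" "\<And>q. q \<in> U \<Longrightarrow> Y q = Y' q"
  shows "lie_bracket X Y p = lie_bracket X' Y' p"
proof
  fix f
  show "lie_bracket X Y p f = lie_bracket X' Y' p f"
  proof (cases "smooth_fun A f")
    case True
    have "X' p (Y \<triangleright> f) = X' p (Y' \<triangleright> f)"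
      by (rule tangent_local[OF vfD(1)[OF f(3)] U]) (simp_all add: f vfD(2) True deriv_along_apply eq)
    moreover have "Y' p (X \<triangleright> f) = Y' p (X' \<triangleright> f)"
      by (rule tangent_local[OF vfD(1)[OF f(4)] U]) (simp_all add: f vfD(2) True deriv_along_apply eq)
    ultimately show ?thesis by (simp add: lie_bracket_def eq U(2))
  next
    case False
    then show ?thesis
      using tangentD(4)[OF vfD(1)[OF vf_lie[OF f(1,2)]]] tangentD(4)[OF vfD(1)[OF vf_lie[OF f(3,4)]]] by simp
  qed
qed

lemma deriv_ev_local:
  assumes f: "one_form A \<gamma>" "vector_field A X" "vector_field A Y" "vector_field A X'" "vector_field A Y'"
    and U: "open U" "p \<in> U" and eq: "\<And>q. q \<in> U \<Longrightarrow> X q = X' q" "\<And>q. q \<in> U \<Longrightarrow> Y q = Y' q"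
  shows "(X \<triangleright> (\<gamma> \<odot> Y)) p = (X' \<triangleright> (\<gamma> \<odot> Y')) p"
proof -
  have "X' p (\<gamma> \<odot> Y) = X' p (\<gamma> \<odot> Y')"
    by (rule tangent_local[OF vfD(1)[OF f(4)] U]) (simp_all add: f formD(2) ev_apply eq)
  then show ?thesis by (simp add: deriv_along_apply eq U(2))
qed

lemma tangent_eqI:
  assumes "v \<in> tangent A p" "w \<in> tangent A p" "\<And>b. b \<in> cotangent A p \<Longrightarrow> b v = b w"
  shows "v = w"
proof
  fix f
  show "v f = w f"
  proof (cases "smooth_fun A f")
    case True
    then show ?thesis using assms(3)[OF formD(1)[OF form_dfun]] assms(1,2) by (simp add: dfun_def)
  qed (simp add: tangentD(4)[OF assms(1)] tangentD(4)[OF assms(2)])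
qed

text \<open>On differentials df, dg, dk this is the Jacobi sum {f,{g,k}} + {g,{k,f}} + {k,{f,g}} of
  the bracket {f,g} = P(df,dg). For general forms it is half of [P,P], by
  \<open>schouten_sum_jacobiator\<close>.\<close>

definition jacobiator :: "'a bivec \<Rightarrow> 'a form1 \<Rightarrow> 'a form1 \<Rightarrow> 'a form1 \<Rightarrow> 'a \<Rightarrow> real" where
  "jacobiator P \<alpha> \<beta> \<gamma> = (let s = \<lambda>\<alpha>. sharp A P \<odot> \<alpha> in
     \<gamma> \<odot> lie_bracket (s \<alpha>) (s \<beta>) + \<alpha> \<odot> lie_bracket (s \<beta>) (s \<gamma>) + \<beta> \<odot> lie_bracket (s \<gamma>) (s \<alpha>)
     - s \<alpha> \<triangleright> (\<gamma> \<odot> s \<beta>) - s \<beta> \<triangleright> (\<alpha> \<odot> s \<gamma>) - s \<gamma> \<triangleright> (\<beta> \<odot> s \<alpha>))"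

text \<open>The polarization of twice the jacobiator: it is biadditive in the triples \<open>x\<close> and \<open>y\<close>, so that
  a decomposition of the bivector field reduces it to decomposable ones.\<close>

definition jacpol :: "'a form1 \<Rightarrow> 'a form1 \<Rightarrow> 'a form1 \<Rightarrow> ('a form1 \<Rightarrow> 'a vfield) \<Rightarrow> ('a form1 \<Rightarrow> 'a vfield)
    \<Rightarrow> 'a \<Rightarrow> real" where
  "jacpol \<alpha> \<beta> \<gamma> x y =
     \<gamma> \<odot> lie_bracket (x \<alpha>) (y \<beta>) - \<gamma> \<odot> lie_bracket (x \<beta>) (y \<alpha>)
     + \<alpha> \<odot> lie_bracket (x \<beta>) (y \<gamma>) - \<alpha> \<odot> lie_bracket (x \<gamma>) (y \<beta>)
     + \<beta> \<odot> lie_bracket (x \<gamma>) (y \<alpha>) - \<beta> \<odot> lie_bracket (x \<alpha>) (y \<gamma>)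
     - x \<alpha> \<triangleright> (\<gamma> \<odot> y \<beta>) - y \<alpha> \<triangleright> (\<gamma> \<odot> x \<beta>) - x \<beta> \<triangleright> (\<alpha> \<odot> y \<gamma>) - y \<beta> \<triangleright> (\<alpha> \<odot> x \<gamma>)
     - x \<gamma> \<triangleright> (\<beta> \<odot> y \<alpha>) - y \<gamma> \<triangleright> (\<beta> \<odot> x \<alpha>)"

text \<open>The map \<open>sharp\<close> of the decomposable bivector field with factors X and
  X'.\<close>

definition sharp_wedge :: "'a vfield \<Rightarrow> 'a vfield \<Rightarrow> 'a form1 \<Rightarrow> 'a vfield" where
  "sharp_wedge X X' \<alpha> = (\<alpha> \<odot> X) \<cdot> X' - (\<alpha> \<odot> X') \<cdot> X"

lemma jacpol_sharp:
  assumes P: "bivector_field A P" and a: "one_form A \<alpha>" "one_form A \<beta>" "one_form A \<gamma>"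
  shows "jacpol \<alpha> \<beta> \<gamma> ((\<odot>) (sharp A P)) ((\<odot>) (sharp A P)) = jacobiator P \<alpha> \<beta> \<gamma> + jacobiator P \<alpha> \<beta> \<gamma>"
proof -
  let ?s = "\<lambda>\<alpha>. sharp A P \<odot> \<alpha>"
  have l: "lie_bracket (?s \<beta>) (?s \<alpha>) = - lie_bracket (?s \<alpha>) (?s \<beta>)"
    "lie_bracket (?s \<gamma>) (?s \<beta>) = - lie_bracket (?s \<beta>) (?s \<gamma>)"
    "lie_bracket (?s \<alpha>) (?s \<gamma>) = - lie_bracket (?s \<gamma>) (?s \<alpha>)"
    by (rule lie_bracket_swap)+
  show ?thesis
    by (simp add: jacpol_def jacobiator_def Let_def l form_ev_right a field_closure sharp_ev(1)[OF P])
qed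

lemma jacpol_local:
  assumes a: "one_form A \<alpha>" "one_form A \<beta>" "one_form A \<gamma>"
    and f: "\<And>\<delta>. one_form A \<delta> \<Longrightarrow> vector_field A (x \<delta>) \<and> vector_field A (y \<delta>) \<and> vector_field A (x' \<delta>) \<and> vector_field A (y' \<delta>)"
    and U: "open U" "p \<in> U"
    and eq: "\<And>q \<delta>. q \<in> U \<Longrightarrow> one_form A \<delta> \<Longrightarrow> x \<delta> q = x' \<delta> q" "\<And>q \<delta>. q \<in> U \<Longrightarrow> one_form A \<delta> \<Longrightarrow> y \<delta> q = y' \<delta> q"
  shows "jacpol \<alpha> \<beta> \<gamma> x y p = jacpol \<alpha> \<beta> \<gamma> x' y' p"
proof -
  have l: "lie_bracket (x \<delta>) (y \<epsilon>) p = lie_bracket (x' \<delta>) (y' \<epsilon>) p" if "one_form A \<delta>" "one_form A \<epsilon>" for \<delta> \<epsilon>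
    by (rule lie_bracket_local[OF _ _ _ _ U]) (use f eq that in auto)
  have d: "(x \<delta> \<triangleright> (\<zeta> \<odot> y \<epsilon>)) p = (x' \<delta> \<triangleright> (\<zeta> \<odot> y' \<epsilon>)) p" "(y \<delta> \<triangleright> (\<zeta> \<odot> x \<epsilon>)) p = (y' \<delta> \<triangleright> (\<zeta> \<odot> x' \<epsilon>)) p"
    if "one_form A \<delta>" "one_form A \<epsilon>" "one_form A \<zeta>" for \<delta> \<epsilon> \<zeta>
    by (rule deriv_ev_local[OF _ _ _ _ _ U]; use f eq that in auto)+
  show ?thesis
    by (simp add: jacpol_def ev_apply l d a)
qed

lemma jacpol_sum:
  fixes x :: "nat \<Rightarrow> 'a form1 \<Rightarrow> 'a vfield" and y :: "nat \<Rightarrow> 'a form1 \<Rightarrow> 'a vfield"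
  assumes a: "one_form A \<alpha>" "one_form A \<beta>" "one_form A \<gamma>"
    and x: "\<And>i \<delta>. i < n \<Longrightarrow> one_form A \<delta> \<Longrightarrow> vector_field A (x i \<delta>)"
    and y: "\<And>j \<delta>. j < m \<Longrightarrow> one_form A \<delta> \<Longrightarrow> vector_field A (y j \<delta>)"
  shows "jacpol \<alpha> \<beta> \<gamma> (\<lambda>\<delta>. \<Sum>i<n. x i \<delta>) (\<lambda>\<delta>. \<Sum>j<m. y j \<delta>) = (\<Sum>i<n. \<Sum>j<m. jacpol \<alpha> \<beta> \<gamma> (x i) (y j))"
proof -
  have xs: "vector_field A (\<Sum>i<n. x i \<delta>)" and ys: "vector_field A (\<Sum>j<m. y j \<delta>)" if "one_form A \<delta>" for \<delta>
    using x y that by (auto intro!: vf_sum)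
  have e1: "\<zeta> \<odot> (\<Sum>i<k. z i \<epsilon>) = (\<Sum>i<k. \<zeta> \<odot> z i \<epsilon>)"
    if "\<And>i. i < k \<Longrightarrow> vector_field A (z i \<epsilon>)" "one_form A \<zeta>"
    for k \<epsilon> \<zeta> and z :: "nat \<Rightarrow> 'a form1 \<Rightarrow> 'a vfield"
    by (rule form_ev_sum) (use that in auto)
  have e2: "W \<triangleright> (\<Sum>i<k. \<zeta> \<odot> z i \<epsilon>) = (\<Sum>i<k. W \<triangleright> (\<zeta> \<odot> z i \<epsilon>))"
    if "\<And>i. i < k \<Longrightarrow> vector_field A (z i \<epsilon>)" "one_form A \<zeta>" "vector_field A W"
    for k \<epsilon> \<zeta> W and z :: "nat \<Rightarrow> 'a form1 \<Rightarrow> 'a vfield"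
    by (rule deriv_along_sum) (use that in \<open>auto intro: formD\<close>)
  have e3: "W \<triangleright> (\<Sum>i<k. z i \<epsilon> \<triangleright> f) = (\<Sum>i<k. W \<triangleright> z i \<epsilon> \<triangleright> f)"
    if "\<And>i. i < k \<Longrightarrow> vector_field A (z i \<epsilon>)" "smooth_fun A f" "vector_field A W"
    for k \<epsilon> f W and z :: "nat \<Rightarrow> 'a form1 \<Rightarrow> 'a vfield"
    by (rule deriv_along_sum) (use that in \<open>auto intro: vfD\<close>)
  have d1: "(\<Sum>i<n. x i \<delta>) \<triangleright> (\<zeta> \<odot> (\<Sum>j<m. y j \<epsilon>)) = (\<Sum>i<n. \<Sum>j<m. x i \<delta> \<triangleright> (\<zeta> \<odot> y j \<epsilon>))"
    if "one_form A \<delta>" "one_form A \<epsilon>" "one_form A \<zeta>" for \<delta> \<epsilon> \<zeta>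
    by (simp add: deriv_along_left_sum e1 e2 that x y)
  have d2: "(\<Sum>j<m. y j \<delta>) \<triangleright> (\<zeta> \<odot> (\<Sum>i<n. x i \<epsilon>)) = (\<Sum>i<n. \<Sum>j<m. y j \<delta> \<triangleright> (\<zeta> \<odot> x i \<epsilon>))"
    if "one_form A \<delta>" "one_form A \<epsilon>" "one_form A \<zeta>" for \<delta> \<epsilon> \<zeta>
    by (subst sum.swap) (simp add: deriv_along_left_sum e1 e2 that x y)
  have l: "\<zeta> \<odot> lie_bracket (\<Sum>i<n. x i \<delta>) (\<Sum>j<m. y j \<epsilon>) = (\<Sum>i<n. \<Sum>j<m. \<zeta> \<odot> lie_bracket (x i \<delta>) (y j \<epsilon>))"
    if "one_form A \<delta>" "one_form A \<epsilon>" "one_form A \<zeta>" for \<delta> \<epsilon> \<zeta>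
  proof -
    have "lie_bracket (\<Sum>i<n. x i \<delta>) (\<Sum>j<m. y j \<epsilon>) = (\<Sum>i<n. \<Sum>j<m. lie_bracket (x i \<delta>) (y j \<epsilon>))"
    proof (rule vf_eqI)
      show "vector_field A (lie_bracket (\<Sum>i<n. x i \<delta>) (\<Sum>j<m. y j \<epsilon>))"
        by (intro vf_lie xs ys that)
      show "vector_field A (\<Sum>i<n. \<Sum>j<m. lie_bracket (x i \<delta>) (y j \<epsilon>))"
        by (intro vf_sum vf_lie x y that) auto
      fix f assume f: "smooth_fun A f"
      have s: "(\<Sum>i<n. \<Sum>j<m. y j \<epsilon> \<triangleright> x i \<delta> \<triangleright> f) = (\<Sum>j<m. \<Sum>i<n. y j \<epsilon> \<triangleright> x i \<delta> \<triangleright> f)"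
        by (rule sum.swap)
      show "lie_bracket (\<Sum>i<n. x i \<delta>) (\<Sum>j<m. y j \<epsilon>) \<triangleright> f = (\<Sum>i<n. \<Sum>j<m. lie_bracket (x i \<delta>) (y j \<epsilon>)) \<triangleright> f"
        by (simp add: lie_bracket_deriv deriv_along_left_sum e3 sum_subtractf x y that f s)
    qed
    moreover have "\<zeta> \<odot> (\<Sum>i<n. \<Sum>j<m. lie_bracket (x i \<delta>) (y j \<epsilon>)) = (\<Sum>i<n. \<zeta> \<odot> (\<Sum>j<m. lie_bracket (x i \<delta>) (y j \<epsilon>)))"
      by (rule form_ev_sum) (auto intro!: vf_sum vf_lie that x y)
    moreover have "\<dots> = (\<Sum>i<n. \<Sum>j<m. \<zeta> \<odot> lie_bracket (x i \<delta>) (y j \<epsilon>))"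
      by (intro sum.cong refl form_ev_sum) (auto intro!: vf_lie that x y)
    ultimately show ?thesis by simp
  qed
  show ?thesis
    by (simp add: jacpol_def d1 d2 l a sum.distrib sum_subtractf)
qed

text \<open>The terms that differentiate coefficients such as \<alpha>(X) cancel; what is left is
  precisely the rule for the Schouten bracket of decomposable bivector fields.\<close>

lemma jacpol_wedge:
  assumes a: "one_form A \<alpha>" "one_form A \<beta>" "one_form A \<gamma>"
    and f: "vector_field A X" "vector_field A X'" "vector_field A Y" "vector_field A Y'"
  shows "jacpol \<alpha> \<beta> \<gamma> (sharp_wedge X X') (sharp_wedge Y Y') p =
       wedge3 (lie_bracket X Y p) (X' p) (Y' p) (\<alpha> p) (\<beta> p) (\<gamma> p)
     - wedge3 (lie_bracket X Y' p) (X' p) (Y p) (\<alpha> p) (\<beta> p) (\<gamma> p)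
     - wedge3 (lie_bracket X' Y p) (X p) (Y' p) (\<alpha> p) (\<beta> p) (\<gamma> p)
     + wedge3 (lie_bracket X' Y' p) (X p) (Y p) (\<alpha> p) (\<beta> p) (\<gamma> p)"
proof -
  define w3 where "w3 U V W = (\<alpha> \<odot> U) * ((\<beta> \<odot> V) * (\<gamma> \<odot> W) - (\<beta> \<odot> W) * (\<gamma> \<odot> V))
      - (\<alpha> \<odot> V) * ((\<beta> \<odot> U) * (\<gamma> \<odot> W) - (\<beta> \<odot> W) * (\<gamma> \<odot> U))
      + (\<alpha> \<odot> W) * ((\<beta> \<odot> U) * (\<gamma> \<odot> V) - (\<beta> \<odot> V) * (\<gamma> \<odot> U))" for U V W
  have w: "wedge3 (U p) (V p) (W p) (\<alpha> p) (\<beta> p) (\<gamma> p) = w3 U V W p" for U V W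
    by (simp add: w3_def wedge3_def wedge2_def ev_apply)
  have "jacpol \<alpha> \<beta> \<gamma> (sharp_wedge X X') (sharp_wedge Y Y') =
      w3 (lie_bracket X Y) X' Y' - w3 (lie_bracket X Y') X' Y - w3 (lie_bracket X' Y) X Y' + w3 (lie_bracket X' Y') X Y"
    by (simp add: jacpol_def sharp_wedge_def w3_def a f field_closure form_ev_right lie_bracket_simps
       deriv_along_left deriv_along_right algebra_simps)
  then show ?thesis by (simp add: w)
qed

section \<open>Consistency of the Schouten rule\<close>

text \<open>A name for the right-hand side of the rule in \<open>schouten_bracket\<close>.\<close>

definition schouten_sum :: "nat \<Rightarrow> (nat \<Rightarrow> 'a vfield) \<Rightarrow> (nat \<Rightarrow> 'a vfield) \<Rightarrow> nat \<Rightarrow> (nat \<Rightarrow> 'a vfield)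
    \<Rightarrow> (nat \<Rightarrow> 'a vfield) \<Rightarrow> 'a trivec" where
  "schouten_sum n X X' m Y Y' p \<alpha> \<beta> \<gamma> = (\<Sum>i<n. \<Sum>j<m.
             wedge3 (lie_bracket (X i) (Y j) p) (X' i p) (Y' j p) \<alpha> \<beta> \<gamma>
           - wedge3 (lie_bracket (X i) (Y' j) p) (X' i p) (Y j p) \<alpha> \<beta> \<gamma>
           - wedge3 (lie_bracket (X' i) (Y j) p) (X i p) (Y' j p) \<alpha> \<beta> \<gamma>
           + wedge3 (lie_bracket (X' i) (Y' j) p) (X i p) (Y j p) \<alpha> \<beta> \<gamma>)"

lemma vf_sharp_wedge: "one_form A \<delta> \<Longrightarrow> vector_field A X \<Longrightarrow> vector_field A X' \<Longrightarrow> vector_field A (sharp_wedge X X' \<delta>)"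
  by (simp add: sharp_wedge_def field_closure)

lemma sharp_decomposes:
  assumes P: "bivector_field A P" and d: "decomposes_on A U P n X X'" and q: "q \<in> U" and de: "one_form A \<delta>"
  shows "(sharp A P \<odot> \<delta>) q = (\<Sum>i<n. sharp_wedge (X i) (X' i) \<delta>) q"
proof (rule tangent_eqI)
  have f: "vector_field A (X i)" "vector_field A (X' i)" if "i < n" for i
    using d that by (auto simp: decomposes_on_def)
  have sw: "vector_field A (sharp_wedge (X i) (X' i) \<delta>)" if "i < n" for i
    using f[OF that] de by (simp add: vf_sharp_wedge)
  show "(sharp A P \<odot> \<delta>) q \<in> tangent A q" by (rule vfD(1)[OF sharp_ev(1)[OF P de]])
  show "(\<Sum>i<n. sharp_wedge (X i) (X' i) \<delta>) q \<in> tangent A q"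
    by (intro vfD(1) vf_sum sw) simp
  fix b assume b: "b \<in> cotangent A q"
  obtain \<beta> where be: "one_form A \<beta>" "\<beta> q = b" by (rule extend_cotangent[OF b])
  have "b ((sharp A P \<odot> \<delta>) q) = P q (\<delta> q) b"
    using sharp(2)[OF P formD(1)[OF de] b] by (simp add: ev_apply)
  also have "\<dots> = (\<Sum>i<n. wedge2 (X i q) (X' i q) (\<delta> q) b)"
    using d q b formD(1)[OF de, of q] unfolding decomposes_on_def by blast
  also have "\<dots> = (\<Sum>i<n. \<beta> \<odot> sharp_wedge (X i) (X' i) \<delta>) q"
    by (simp add: sum_fun_apply sharp_wedge_def form_ev_right de be f field_closure wedge2_def ev_apply)
  also have "\<dots> = (\<beta> \<odot> (\<Sum>i<n. sharp_wedge (X i) (X' i) \<delta>)) q"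
    by (subst form_ev_sum[OF be(1)]) (simp_all add: sw)
  finally show "b ((sharp A P \<odot> \<delta>) q) = b ((\<Sum>i<n. sharp_wedge (X i) (X' i) \<delta>) q)"
    by (simp add: ev_apply be)
qed

text \<open>The two decompositions may differ, and neither occurs on the right: this is the
  independence that makes the defining rule of the Schouten bracket consistent.\<close>

lemma schouten_sum_jacobiator:
  assumes P: "bivector_field A P" and U: "open U" "p \<in> U"
    and d: "decomposes_on A U P n X X'" "decomposes_on A U P m Y Y'"
    and a: "one_form A \<alpha>" "one_form A \<beta>" "one_form A \<gamma>"
  shows "schouten_sum n X X' m Y Y' p (\<alpha> p) (\<beta> p) (\<gamma> p) = 2 * jacobiator P \<alpha> \<beta> \<gamma> p"
proof -
  have f: "vector_field A (X i)" "vector_field A (X' i)" if "i < n" for i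
    using d(1) that by (auto simp: decomposes_on_def)
  have g: "vector_field A (Y i)" "vector_field A (Y' i)" if "i < m" for i
    using d(2) that by (auto simp: decomposes_on_def)
  let ?x = "\<lambda>i. sharp_wedge (X i) (X' i)" and ?y = "\<lambda>i. sharp_wedge (Y i) (Y' i)"
  have "2 * jacobiator P \<alpha> \<beta> \<gamma> p = jacpol \<alpha> \<beta> \<gamma> ((\<odot>) (sharp A P)) ((\<odot>) (sharp A P)) p"
    by (simp add: jacpol_sharp[OF P a])
  also have "\<dots> = jacpol \<alpha> \<beta> \<gamma> (\<lambda>\<delta>. \<Sum>i<n. ?x i \<delta>) (\<lambda>\<delta>. \<Sum>i<m. ?y i \<delta>) p"
    by (rule jacpol_local[OF a _ U])
       (auto intro!: vf_sum vf_sharp_wedge f g sharp_ev(1)[OF P] sharp_decomposes[OF P] d)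
  also have "\<dots> = (\<Sum>i<n. \<Sum>j<m. jacpol \<alpha> \<beta> \<gamma> (?x i) (?y j) p)"
    by (subst jacpol_sum[OF a]) (simp_all add: vf_sharp_wedge f g sum_fun_apply)
  also have "\<dots> = schouten_sum n X X' m Y Y' p (\<alpha> p) (\<beta> p) (\<gamma> p)"
    unfolding schouten_sum_def by (intro sum.cong refl jacpol_wedge a f g) auto
  finally show ?thesis by simp
qed

text \<open>The fields E of a frame are wedged with half of sharp(dx). Each of the two terms of the
  wedge product then contributes half of P.\<close>

lemma decomposition_exists:
  assumes P: "bivector_field A P"
  obtains U n X X' where "open U" "p \<in> U" "decomposes_on A U P n X X'"
proof -
  obtain U and I :: "'e set" and E :: "'e \<Rightarrow> 'a vfield" and x where f: "open U" "p \<in> U" "finite I"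
    "\<And>i. i \<in> I \<Longrightarrow> vector_field A (E i)" "\<And>i. smooth_fun A (x i)"
    "\<And>q v. q \<in> U \<Longrightarrow> v \<in> tangent A q \<Longrightarrow> v = (\<Sum>i\<in>I. v (x i) *\<^sub>R E i q)"
    by (rule local_frame) (rule that)
  \<comment> \<open>\<open>decomposes_on\<close> indexes its summands by an initial segment of the
    natural numbers, so the frame has to be enumerated.\<close>
  obtain e where e: "bij_betw e {..<card I} I"
    using ex_bij_betw_nat_finite[OF f(3)] atLeast0LessThan by metis
  define W where "W i = (1/2) *\<^sub>R (sharp A P \<odot> dfun A (x i))" for i
  have W: "vector_field A (W i)" for i
    using vf_fscale[OF smooth_const[of "1/2"] sharp_ev(1)[OF P form_dfun[OF f(5)]]]
    by (simp add: W_def fscale_def scaleR_fun_def)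
  have Pw: "P q a b = (\<Sum>i\<in>I. wedge2 (E i q) (W i q) a b)"
    if q: "q \<in> U" and a: "a \<in> cotangent A q" and b: "b \<in> cotangent A q" for q a b
  proof -
    have Alt: "P q \<in> Alt2 (cotangent A q)" using P by (simp add: bivector_field_def)
    have al: "P q a \<in> Lin (cotangent A q) UNIV" "P q a b = - P q b a"
      if "a \<in> cotangent A q" "b \<in> cotangent A q" for a b
      using Alt2D(1,2)[OF Alt cotangent_subspace(2)] that by blast+
    have dx: "dfun A (x i) q \<in> cotangent A q" for i by (rule formD(1)[OF form_dfun[OF f(5)]])
    have ex: "P q b' a' = (\<Sum>i\<in>I. a' (E i q) * P q b' (dfun A (x i) q))"
      if "a' \<in> cotangent A q" "b' \<in> cotangent A q" for a' b'
      using Lin_sum[OF al(1)[OF that(2,2)] subspace_cotangent, where I=I and v="\<lambda>i. dfun A (x i) q" and c="\<lambda>i. a' (E i q)"] dx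
        cotangent_expansion[OF f(4,5) f(6)[OF q] that(1)] by simp
    have Wq: "c (W i q) = 1/2 * P q (dfun A (x i) q) c" if c: "c \<in> cotangent A q" for c i
      using sharp(2)[OF P dx[of i] c] cotangentD(2)[OF c sharp(1)[OF P dx[of i]]]
      by (simp add: W_def scaleR_fun_apply ev_apply)
    have "(\<Sum>i\<in>I. wedge2 (E i q) (W i q) a b)
        = 1/2 * (\<Sum>i\<in>I. b (E i q) * P q a (dfun A (x i) q)) - 1/2 * (\<Sum>i\<in>I. a (E i q) * P q b (dfun A (x i) q))"
      by (simp add: wedge2_def Wq a b al(2)[OF dx a] al(2)[OF dx b] sum_subtractf[symmetric] sum_distrib_left algebra_simps)
    also have "\<dots> = P q a b"
      using ex[OF a b] ex[OF b a] al(2)[OF a b] by simp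
    finally show ?thesis by simp
  qed
  show thesis
  proof (rule that[OF f(1,2)])
    show "decomposes_on A U P (card I) (\<lambda>i. E (e i)) (\<lambda>i. W (e i))"
      unfolding decomposes_on_def
    proof (intro conjI allI impI ballI)
      fix q a b assume "q \<in> U" "a \<in> cotangent A q" "b \<in> cotangent A q"
      then show "P q a b = (\<Sum>i<card I. wedge2 (E (e i) q) (W (e i) q) a b)"
        using Pw sum.reindex_bij_betw[OF e, where g="\<lambda>i. wedge2 (E i q) (W i q) a b"] by simp
    qed (use f(4) W e in \<open>auto simp: bij_betw_def\<close>)
  qed
qed

text \<open>Elements of \<open>Alt3\<close> vanish off V, so a multilinear expression that makes
  sense everywhere is cut down to V first.\<close>

lemma Alt3I:
  fixes G :: "'a covec \<Rightarrow> 'a covec \<Rightarrow> 'a covec \<Rightarrow> real"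
  assumes V: "subspace V"
    and add: "\<And>a a' b c. G (a + a') b c = G a b c + G a' b c" "\<And>a b b' c. G a (b + b') c = G a b c + G a b' c"
      "\<And>a b c c'. G a b (c + c') = G a b c + G a b c'"
    and scale: "\<And>r a b c. G (r *\<^sub>R a) b c = r * G a b c" "\<And>r a b c. G a (r *\<^sub>R b) c = r * G a b c"
      "\<And>r a b c. G a b (r *\<^sub>R c) = r * G a b c"
    and alt: "\<And>a c. G a a c = 0" "\<And>a b. G a b b = 0"
  shows "(\<lambda>a b c. if a \<in> V \<and> b \<in> V \<and> c \<in> V then G a b c else 0) \<in> Alt3 V"
proof -
  have "(\<lambda>b c. if a \<in> V \<and> b \<in> V \<and> c \<in> V then G a b c else 0) \<in> Alt2 V" if "a \<in> V" for a
    using that V unfolding Alt2_def Lin_def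
    by (auto simp: add scale alt fun_eq_iff scaleR_fun_apply subspace_add subspace_scale)
  moreover have "(\<lambda>b c. if r *\<^sub>R a \<in> V \<and> b \<in> V \<and> c \<in> V then G (r *\<^sub>R a) b c else 0)
      = r *\<^sub>R (\<lambda>b c. if a \<in> V \<and> b \<in> V \<and> c \<in> V then G a b c else 0)" if "a \<in> V" for r a
    using that V by (auto simp: scale fun_eq_iff scaleR_fun_apply subspace_scale)
  ultimately show ?thesis
    using V unfolding Alt3_def Lin_def
    by (auto simp: add alt fun_eq_iff subspace_add)
qed

text \<open>The description is resolved by using, at each point, a decomposition chosen near that
  point. By \<open>schouten_sum_jacobiator\<close> the resulting S agrees with the rule for every
  other pair of decompositions, and its value on forms is twice the jacobiator.\<close>

lemma schouten_bracket_eq_0_iff: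
  assumes P: "bivector_field A P"
  shows "schouten_bracket A P P = 0 \<longleftrightarrow>
    (\<forall>\<alpha> \<beta> \<gamma>. one_form A \<alpha> \<longrightarrow> one_form A \<beta> \<longrightarrow> one_form A \<gamma> \<longrightarrow> jacobiator P \<alpha> \<beta> \<gamma> = 0)"
proof -
  have "\<forall>p. \<exists>U n X X'. open U \<and> p \<in> U \<and> decomposes_on A U P n X X'"
    by (intro allI, rule decomposition_exists[OF P]) (intro exI conjI)
  then have "\<exists>U n X X'. \<forall>p. open (U p) \<and> p \<in> U p \<and> decomposes_on A (U p) P (n p) (X p) (X' p)"
    by (simp only: choice_iff)
  then obtain U n X X' where U: "\<forall>p. open (U p) \<and> p \<in> U p \<and> decomposes_on A (U p) P (n p) (X p) (X' p)"
    by (elim exE) (rule that)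
  have d: "open (U p)" "p \<in> U p" "decomposes_on A (U p) P (n p) (X p) (X' p)" for p
    by (simp_all add: U)
  define G where "G p = schouten_sum (n p) (X p) (X' p) (n p) (X p) (X' p) p" for p
  define S :: "'a trivec" where
    "S p a b c = (if a \<in> cotangent A p \<and> b \<in> cotangent A p \<and> c \<in> cotangent A p then G p a b c else 0)" for p a b c
  have S: "S \<odot> \<alpha> \<odot> \<beta> \<odot> \<gamma> = jacobiator P \<alpha> \<beta> \<gamma> + jacobiator P \<alpha> \<beta> \<gamma>" if "one_form A \<alpha>" "one_form A \<beta>" "one_form A \<gamma>" for \<alpha> \<beta> \<gamma>
  proof
    fix p
    show "(S \<odot> \<alpha> \<odot> \<beta> \<odot> \<gamma>) p = (jacobiator P \<alpha> \<beta> \<gamma> + jacobiator P \<alpha> \<beta> \<gamma>) p"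
      using schouten_sum_jacobiator[OF P d[of p] d(3)[of p] that] that[THEN formD(1), of p]
      by (simp add: S_def G_def ev_apply)
  qed
  have smooth: "smooth_fun A (jacobiator P \<alpha> \<beta> \<gamma>)" if "one_form A \<alpha>" "one_form A \<beta>" "one_form A \<gamma>" for \<alpha> \<beta> \<gamma>
    using that by (simp add: jacobiator_def Let_def field_closure sharp_ev(1)[OF P])
  have lin: "wedge3 u v w (a + a') b c = wedge3 u v w a b c + wedge3 u v w a' b c"
    "wedge3 u v w a (b + b') c = wedge3 u v w a b c + wedge3 u v w a b' c"
    "wedge3 u v w a b (c + c') = wedge3 u v w a b c + wedge3 u v w a b c'"
    "wedge3 u v w (r *\<^sub>R a) b c = r * wedge3 u v w a b c" "wedge3 u v w a (r *\<^sub>R b) c = r * wedge3 u v w a b c"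
    "wedge3 u v w a b (r *\<^sub>R c) = r * wedge3 u v w a b c" "wedge3 u v w a a c = 0" "wedge3 u v w a b b = 0"
    for u v w :: "'a tvec" and a b c a' b' c' r
    by (simp_all add: wedge3_def wedge2_def scaleR_fun_apply algebra_simps)
  have "S p \<in> Alt3 (cotangent A p)" for p
    unfolding S_def[abs_def]
    by (rule Alt3I[OF subspace_cotangent];
        simp add: G_def schouten_sum_def lin sum.distrib sum_subtractf sum_distrib_left algebra_simps)
  then have trivec: "trivector_field A S"
    unfolding trivector_field_def by (metis S smooth smooth_add)
  have rule: "S p a b c = schouten_sum m Y Y' k W W' p a b c"
    if v: "open V" "decomposes_on A V P m Y Y'" "decomposes_on A V P k W W'" "p \<in> V"
      "a \<in> cotangent A p" "b \<in> cotangent A p" "c \<in> cotangent A p" for V m Y Y' k W W' p a b c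
  proof -
    obtain \<alpha> where al: "one_form A \<alpha>" "\<alpha> p = a" by (rule extend_cotangent[OF v(5)])
    obtain \<beta> where be: "one_form A \<beta>" "\<beta> p = b" by (rule extend_cotangent[OF v(6)])
    obtain \<gamma> where ga: "one_form A \<gamma>" "\<gamma> p = c" by (rule extend_cotangent[OF v(7)])
    show ?thesis
      using schouten_sum_jacobiator[OF P v(1,4,2,3) al(1) be(1) ga(1)] fun_cong[OF S[OF al(1) be(1) ga(1)], of p]
      by (simp add: ev_apply al be ga)
  qed
  have "schouten_bracket A P P = S"
    unfolding schouten_bracket_def schouten_sum_def[symmetric]
  proof (rule the_equality)
    show "trivector_field A S \<and> (\<forall>V n X X' m Y Y'. open V \<longrightarrow> decomposes_on A V P n X X' \<longrightarrow> decomposes_on A V P m Y Y' \<longrightarrow>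
       (\<forall>p\<in>V. \<forall>a\<in>cotangent A p. \<forall>b\<in>cotangent A p. \<forall>c\<in>cotangent A p. S p a b c = schouten_sum n X X' m Y Y' p a b c))"
      using trivec rule by blast
    fix T assume T: "trivector_field A T \<and> (\<forall>V n X X' m Y Y'. open V \<longrightarrow> decomposes_on A V P n X X' \<longrightarrow> decomposes_on A V P m Y Y' \<longrightarrow>
       (\<forall>p\<in>V. \<forall>a\<in>cotangent A p. \<forall>b\<in>cotangent A p. \<forall>c\<in>cotangent A p. T p a b c = schouten_sum n X X' m Y Y' p a b c))"
    show "T = S"
    proof (intro ext)
      fix p a b c
      have T3: "T p \<in> Alt3 (cotangent A p)" using T by (simp add: trivector_field_def)
      \<comment> \<open>Equality of trivector fields as functions also concerns arguments that are
        not covectors at p; there both sides are 0.\<close>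
      have z: "T p a b c = 0" if "\<not> (a \<in> cotangent A p \<and> b \<in> cotangent A p \<and> c \<in> cotangent A p)"
      proof -
        have L: "T p \<in> Lin (cotangent A p) (Alt2 (cotangent A p))" using T3 by (simp add: Alt3_def)
        have L2: "T p a \<in> Lin (cotangent A p) (Lin (cotangent A p) UNIV)" if "a \<in> cotangent A p"
          using LinD(1)[OF L that] by (simp add: Alt2_def)
        consider "a \<notin> cotangent A p" | "a \<in> cotangent A p" "b \<notin> cotangent A p"
          | "a \<in> cotangent A p" "b \<in> cotangent A p" "c \<notin> cotangent A p" using \<open>\<not> _\<close> by blast
        then show ?thesis
        proof cases
          case 1 then show ?thesis using LinD(4)[OF L] by simp
        next
          case 2 then show ?thesis using LinD(4)[OF L2] by simp
        next
          case 3 then show ?thesis using LinD(4)[OF LinD(1)[OF L2]] by simp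
        qed
      qed
      show "T p a b c = S p a b c"
      proof (cases "a \<in> cotangent A p \<and> b \<in> cotangent A p \<and> c \<in> cotangent A p")
        case True
        then have "T p a b c = G p a b c"
          unfolding G_def using T d by blast
        then show ?thesis using True by (simp add: S_def)
      next
        case False
        show ?thesis unfolding S_def if_not_P[OF False] by (rule z[OF False])
      qed
    qed
  qed
  moreover have "S = 0 \<longleftrightarrow> (\<forall>\<alpha> \<beta> \<gamma>. one_form A \<alpha> \<longrightarrow> one_form A \<beta> \<longrightarrow> one_form A \<gamma> \<longrightarrow> jacobiator P \<alpha> \<beta> \<gamma> = 0)"
  proof
    assume "S = 0"
    then show "\<forall>\<alpha> \<beta> \<gamma>. one_form A \<alpha> \<longrightarrow> one_form A \<beta> \<longrightarrow> one_form A \<gamma> \<longrightarrow> jacobiator P \<alpha> \<beta> \<gamma> = 0"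
      using S by (simp add: ev_apply fun_eq_iff)
  next
    assume j: "\<forall>\<alpha> \<beta> \<gamma>. one_form A \<alpha> \<longrightarrow> one_form A \<beta> \<longrightarrow> one_form A \<gamma> \<longrightarrow> jacobiator P \<alpha> \<beta> \<gamma> = 0"
    show "S = 0"
    proof (intro ext)
      fix p a b c
      show "S p a b c = 0 p a b c"
      proof (cases "a \<in> cotangent A p \<and> b \<in> cotangent A p \<and> c \<in> cotangent A p")
        case True
        obtain \<alpha> where al: "one_form A \<alpha>" "\<alpha> p = a" using True extend_cotangent by blast
        obtain \<beta> where be: "one_form A \<beta>" "\<beta> p = b" using True extend_cotangent by blast
        obtain \<gamma> where ga: "one_form A \<gamma>" "\<gamma> p = c" using True extend_cotangent by blast
        show ?thesis
          using fun_cong[OF S[OF al(1) be(1) ga(1)], of p] j al be ga by (simp add: ev_apply)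
      next
        case False
        show ?thesis unfolding S_def if_not_P[OF False] by simp
      qed
    qed
  qed
  ultimately show ?thesis by simp
qed

end

section \<open>Generalized almost contact structures\<close>

locale contact_structure = smooth_manifold A
  for A :: "('a::{t2_space,second_countable_topology}, 'e::{real_inner,banach}) atlas" +
  fixes h :: nat
    and P :: "'a bivec" and \<theta> :: "'a form2" and F :: "'a endo"
    and Z :: "nat \<Rightarrow> 'a vfield" and \<xi> :: "nat \<Rightarrow> 'a form1"
  assumes contact: "gen_almost_contact A h P \<theta> F Z \<xi>"
begin

text \<open>The simplifier is to keep \<open>a \<in> {1..h}\<close> in the form in which the hypotheses on \<open>Z a\<close> and \<open>\<xi> a\<close> need it.\<close>

declare atLeastAtMost_iff [simp del] One_nat_def [simp del]

abbreviation sh :: "'a form1 \<Rightarrow> 'a vfield" where "sh \<alpha> \<equiv> sharp A P \<odot> \<alpha>"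

lemma contact_fields:
  shows P: "bivector_field A P" and \<theta>: "two_form A \<theta>" and F: "endo_field A F"
    and Z: "a \<in> {1..h} \<Longrightarrow> vector_field A (Z a)" and \<xi>: "a \<in> {1..h} \<Longrightarrow> one_form A (\<xi> a)"
  using contact unfolding gen_almost_contact_def by blast+

lemmas contact_closure = field_closure Z \<xi> endo_ev(1)[OF F] sharp_ev(1)[OF P] two_form_ev(1)[OF \<theta>]
  two_form_smooth[OF \<theta>] form_form_comp[OF F]

lemma contact_Z:
  assumes a: "a \<in> {1..h}"
  shows F_Z: "F \<odot> Z a = 0" and \<xi>_F: "\<xi> a \<odot> (F \<odot> X) = 0" and \<theta>_Z: "\<theta> \<odot> Z a = 0"
    and \<theta>_Z_right: "vector_field A X \<Longrightarrow> \<theta> \<odot> X \<odot> Z a = 0" and sh_\<xi>: "sh (\<xi> a) = 0"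
    and \<xi>_sh: "one_form A \<alpha> \<Longrightarrow> \<xi> a \<odot> sh \<alpha> = 0"
    and \<xi>_Z: "b \<in> {1..h} \<Longrightarrow> \<xi> a \<odot> Z b = (if a = b then 1 else 0)"
    and form_comp_\<xi>: "form_comp (\<xi> a) F = 0"
proof -
  have g: "F \<odot> Z a = 0 \<and> form_comp (\<xi> a) F = 0 \<and> \<theta> \<odot> Z a = 0 \<and> P \<odot> \<xi> a = 0"
    using contact a unfolding gen_almost_contact_def by blast
  then show "F \<odot> Z a = 0" and t: "\<theta> \<odot> Z a = 0" and fc: "form_comp (\<xi> a) F = 0" by auto
  show "\<xi> a \<odot> (F \<odot> X) = 0" using form_comp_ev[of "\<xi> a" F X] by (simp add: fc ev_left_simps)
  show "\<theta> \<odot> X \<odot> Z a = 0" if "vector_field A X"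
    using two_form_ev(2)[OF \<theta> that Z[OF a]] by (simp add: t ev_left_simps)
  show s: "sh (\<xi> a) = 0"
  proof (rule vf_eqI_form)
    fix \<alpha> assume al: "one_form A \<alpha>"
    have "\<alpha> \<odot> sh (\<xi> a) = P \<odot> \<xi> a \<odot> \<alpha>" using sharp_ev(2)[OF P \<xi>[OF a] al] by simp
    then show "\<alpha> \<odot> sh (\<xi> a) = \<alpha> \<odot> 0" using g by (simp add: ev_left_simps form_ev_0 al)
  qed (simp_all add: contact_closure a)
  show "\<xi> a \<odot> sh \<alpha> = 0" if al: "one_form A \<alpha>"
    using sharp_ev(3)[OF P \<xi>[OF a] al] by (simp add: s form_ev_0 al)
  have "\<xi> a p (Z b p) = (if a = b then 1 else 0)" if "b \<in> {1..h}" for b p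
    using contact a that unfolding gen_almost_contact_def by blast
  then show "\<xi> a \<odot> Z b = (if a = b then 1 else 0)" if "b \<in> {1..h}"
    using that by (auto simp: fun_eq_iff ev_apply)
qed

lemma \<theta>_F: 
  assumes "vector_field A X" "vector_field A Y"
  shows "\<theta> \<odot> (F \<odot> X) \<odot> Y = \<theta> \<odot> X \<odot> (F \<odot> Y)"
proof
  fix p
  have "\<theta> p (F p (X p)) (Y p) = \<theta> p (X p) (F p (Y p))"
    using contact vfD(1)[OF assms(1)] vfD(1)[OF assms(2)] unfolding gen_almost_contact_def by blast
  then show "(\<theta> \<odot> (F \<odot> X) \<odot> Y) p = (\<theta> \<odot> X \<odot> (F \<odot> Y)) p" by (simp add: ev_apply)
qed

lemma form_comp_\<theta>: "vector_field A X \<Longrightarrow> form_comp (\<theta> \<odot> X) F = \<theta> \<odot> (F \<odot> X)"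
  by (rule form_eqI) (simp_all add: contact_closure form_comp_ev \<theta>_F)

lemma sh_F:
  assumes al: "one_form A \<alpha>"
  shows "sh (form_comp \<alpha> F) = F \<odot> sh \<alpha>"
proof (rule vf_eqI_form)
  fix \<beta> assume be: "one_form A \<beta>"
  have "P \<odot> form_comp \<alpha> F \<odot> \<beta> = P \<odot> \<alpha> \<odot> form_comp \<beta> F"
  proof
    fix p
    have "P p (\<alpha> p \<circ> F p) (\<beta> p) = P p (\<alpha> p) (\<beta> p \<circ> F p)"
      using contact formD(1)[OF al] formD(1)[OF be] unfolding gen_almost_contact_def by blast
    then show "(P \<odot> form_comp \<alpha> F \<odot> \<beta>) p = (P \<odot> \<alpha> \<odot> form_comp \<beta> F) p"
      by (simp add: ev_apply form_comp_def)
  qed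
  then show "\<beta> \<odot> sh (form_comp \<alpha> F) = \<beta> \<odot> (F \<odot> sh \<alpha>)"
    using sharp_ev(2)[OF P] al be by (simp add: contact_closure form_comp_ev)
qed (simp_all add: contact_closure al)

lemma F_F:
  assumes X: "vector_field A X"
  shows "F \<odot> (F \<odot> X) = - X - sh (\<theta> \<odot> X) + (\<Sum>a\<in>{1..h}. (\<xi> a \<odot> X) \<cdot> Z a)"
proof
  fix p
  have "F p (F p (X p)) = - X p - sharp A P p (flat \<theta> p (X p)) + (\<Sum>a\<in>{1..h}. \<xi> a p (X p) *\<^sub>R Z a p)"
    using contact vfD(1)[OF X] unfolding gen_almost_contact_def by blast
  then show "(F \<odot> (F \<odot> X)) p = (- X - sh (\<theta> \<odot> X) + (\<Sum>a\<in>{1..h}. (\<xi> a \<odot> X) \<cdot> Z a)) p"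
    by (simp add: flat_eq ev_apply sum_fun_apply[of _ _ p] fscale_apply)
qed

lemma \<theta>_sh: "vector_field A X \<Longrightarrow> one_form A \<alpha> \<Longrightarrow> \<theta> \<odot> X \<odot> sh \<alpha> = - (\<alpha> \<odot> sh (\<theta> \<odot> X))"
  by (rule sharp_ev(3)[OF P]) (simp_all add: contact_closure)

text \<open>The transpose of \<open>F_F\<close>: since P and \<theta> are both skew, the two signs
  cancel and the transpose of sharp after flat is flat after sharp.\<close>

lemma form_comp_F_F:
  assumes al: "one_form A \<alpha>"
  shows "form_comp (form_comp \<alpha> F) F = - \<alpha> - \<theta> \<odot> sh \<alpha> + (\<Sum>a\<in>{1..h}. (\<alpha> \<odot> Z a) \<cdot> \<xi> a)"
proof (rule form_eqI)
  fix X assume X: "vector_field A X"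
  have "\<theta> \<odot> sh \<alpha> \<odot> X = \<alpha> \<odot> sh (\<theta> \<odot> X)"
    using two_form_ev(2)[OF \<theta> _ X, of "sh \<alpha>"] \<theta>_sh[OF X al] by (simp add: contact_closure al)
  then show "form_comp (form_comp \<alpha> F) F \<odot> X = (- \<alpha> - \<theta> \<odot> sh \<alpha> + (\<Sum>a\<in>{1..h}. (\<alpha> \<odot> Z a) \<cdot> \<xi> a)) \<odot> X"
    by (simp add: form_comp_ev F_F X contact_closure al form_ev_right form_ev_sum ev_left_simps ev_left_sum
       ev_left_fscale fscale_real mult.commute)
qed (simp_all add: contact_closure al)

section \<open>Sections of the big tangent bundle\<close>

abbreviation big :: "'a bsec \<Rightarrow> bool" where "big \<equiv> big_section A h"
abbreviation \<Phi> :: "'a bsec \<Rightarrow> 'a bsec" where "\<Phi> \<equiv> big_Phi A h P \<theta> F Z \<xi>"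
abbreviation cbr :: "'a bsec \<Rightarrow> 'a bsec \<Rightarrow> 'a bsec" where "cbr \<equiv> courant A h"

lemma big_sectionI:
  assumes "vector_field A X" "one_form A \<alpha>"
    "\<And>a. a \<in> {1..h} \<Longrightarrow> smooth_fun A (u a)" "\<And>a. a \<in> {1..h} \<Longrightarrow> smooth_fun A (v a)"
    "\<And>a. a \<notin> {1..h} \<Longrightarrow> u a = 0" "\<And>a. a \<notin> {1..h} \<Longrightarrow> v a = 0"
  shows "big ((X, u), (\<alpha>, v))"
  using assms by (simp add: big_section_def)

lemma big_sectionE:
  assumes "big e"
  obtains X u \<alpha> v where "e = ((X, u), (\<alpha>, v))" "vector_field A X" "one_form A \<alpha>"
    "\<And>a. a \<in> {1..h} \<Longrightarrow> smooth_fun A (u a)" "\<And>a. a \<in> {1..h} \<Longrightarrow> smooth_fun A (v a)"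
    "\<And>a. a \<notin> {1..h} \<Longrightarrow> u a = 0" "\<And>a. a \<notin> {1..h} \<Longrightarrow> v a = 0"
proof -
  obtain X u \<alpha> v where "e = ((X, u), (\<alpha>, v))" by (metis surj_pair)
  then show thesis using assms by (intro that[of X u \<alpha> v]) (auto simp: big_section_def)
qed

lemma \<Phi>_eq: "\<Phi> ((X, u), (\<alpha>, v)) =
    ((F \<odot> X + sh \<alpha> - (\<Sum>a\<in>{1..h}. v a \<cdot> Z a), \<lambda>a. if a \<in> {1..h} then \<alpha> \<odot> Z a else 0),
     (\<theta> \<odot> X - (\<Sum>a\<in>{1..h}. u a \<cdot> \<xi> a) - form_comp \<alpha> F, \<lambda>a. if a \<in> {1..h} then \<xi> a \<odot> X else 0))"
  by (simp add: big_Phi_def flat_eq)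

lemma courant_eq: "cbr ((X, u), (\<alpha>, v)) ((Y, u'), (\<beta>, v')) =
     ((lie_bracket X Y, \<lambda>a. X \<triangleright> u' a - Y \<triangleright> u a),
      (lie_form A X \<beta> - lie_form A Y \<alpha> + (1/2) *\<^sub>R dfun A (\<alpha> \<odot> Y - \<beta> \<odot> X)
        + (1/2) *\<^sub>R (\<Sum>a\<in>{1..h}. u' a \<cdot> dfun A (v a) + v' a \<cdot> dfun A (u a)
                               - u a \<cdot> dfun A (v' a) - v a \<cdot> dfun A (u' a)),
       \<lambda>a. X \<triangleright> v' a - Y \<triangleright> v a))"
  by (simp add: courant_def)

lemma big_\<Phi>: "big e \<Longrightarrow> big (\<Phi> e)"
  by (elim big_sectionE) (auto simp: \<Phi>_eq intro!: big_sectionI contact_closure)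

lemma big_courant: "big e \<Longrightarrow> big e' \<Longrightarrow> big (cbr e e')"
  by (elim big_sectionE) (auto simp: courant_eq deriv_along_0 intro!: big_sectionI contact_closure)

lemma big_add: "big e \<Longrightarrow> big e' \<Longrightarrow> big (e + e')"
  by (elim big_sectionE) (auto intro!: big_sectionI contact_closure)

lemma big_uminus: "big e \<Longrightarrow> big (- e)"
  by (elim big_sectionE) (auto intro!: big_sectionI contact_closure)

lemma big_diff: "big e \<Longrightarrow> big e' \<Longrightarrow> big (e - e')"
  using big_add[OF _ big_uminus, of e e'] by simp

lemmas big_closure = big_\<Phi> big_courant big_add big_uminus big_diff

lemma sum_\<delta>: "a \<in> {1..h} \<Longrightarrow> (\<Sum>b\<in>{1..h}. f b * (if a = b then 1 else 0)) = f a"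
  "a \<in> {1..h} \<Longrightarrow> (\<Sum>b\<in>{1..h}. f b * (if b = a then 1 else 0)) = f a"
  for f :: "nat \<Rightarrow> 'a \<Rightarrow> real"
  by (simp_all add: if_distrib cong: if_cong)

section \<open>The torsion of the endomorphism of the big tangent bundle\<close>

text \<open>Twice the metric G; the factor changes neither skewness nor nondegeneracy.\<close>

definition pair :: "'a bsec \<Rightarrow> 'a bsec \<Rightarrow> 'a \<Rightarrow> real" where
  "pair = (\<lambda>((X, u), (\<alpha>, v)) ((Y, u'), (\<beta>, v')).
     \<alpha> \<odot> Y + \<beta> \<odot> X + (\<Sum>a\<in>{1..h}. u a * v' a + v a * u' a))"

lemma pair_eq: "pair ((X, u), (\<alpha>, v)) ((Y, u'), (\<beta>, v')) =
    \<alpha> \<odot> Y + \<beta> \<odot> X + (\<Sum>a\<in>{1..h}. u a * v' a + v a * u' a)"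
  by (simp add: pair_def)

lemma pair_sym: "pair e e' = pair e' e"
  by (cases e rule: prod.exhaust; cases e' rule: prod.exhaust)
     (simp add: pair_def split_beta mult.commute add_ac)

lemma smooth_pair: "big e \<Longrightarrow> big e' \<Longrightarrow> smooth_fun A (pair e e')"
  by (elim big_sectionE) (auto simp: pair_eq intro!: contact_closure)

lemma pair_add: 
  assumes "big e" "big e'" "big g"
  shows "pair (e + e') g = pair e g + pair e' g" and "pair (e - e') g = pair e g - pair e' g"
    and "pair (- e) g = - pair e g"
proof -
  show "pair (e + e') g = pair e g + pair e' g"
    using assms by (elim big_sectionE)
      (simp add: pair_eq ev_left_simps form_ev_right sum.distrib algebra_simps)
  show "pair (e - e') g = pair e g - pair e' g"
    using assms by (elim big_sectionE)
      (simp add: pair_eq ev_left_simps form_ev_right sum.distrib sum_subtractf algebra_simps)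
  show "pair (- e) g = - pair e g"
    using assms by (elim big_sectionE)
      (simp add: pair_eq ev_left_simps form_ev_right sum.distrib sum_negf sum_subtractf algebra_simps)
qed

lemma sums_Z_\<xi>:
  assumes v: "\<And>a. a \<in> {1..h} \<Longrightarrow> smooth_fun A (v a)"
  shows "F \<odot> (\<Sum>a\<in>{1..h}. v a \<cdot> Z a) = 0" "\<theta> \<odot> (\<Sum>a\<in>{1..h}. v a \<cdot> Z a) = 0"
    "sh (\<Sum>a\<in>{1..h}. v a \<cdot> \<xi> a) = 0" "form_comp (\<Sum>a\<in>{1..h}. v a \<cdot> \<xi> a) F = 0"
proof -
  have W: "vector_field A (\<Sum>a\<in>{1..h}. v a \<cdot> Z a)" and om: "one_form A (\<Sum>a\<in>{1..h}. v a \<cdot> \<xi> a)"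
    by (auto intro!: contact_closure v)
  note s = W om contact_closure ev_left_simps ev_left_sum ev_left_fscale fscale_real
  show "F \<odot> (\<Sum>a\<in>{1..h}. v a \<cdot> Z a) = 0"
  proof (rule vf_eqI_form)
    fix \<beta> assume be: "one_form A \<beta>"
    have "\<beta> \<odot> (F \<odot> (\<Sum>a\<in>{1..h}. v a \<cdot> Z a)) = (\<Sum>a\<in>{1..h}. v a * (form_comp \<beta> F \<odot> Z a))"
      unfolding form_comp_ev[symmetric] by (simp add: form_ev_sum form_ev_right s v be)
    then show "\<beta> \<odot> (F \<odot> (\<Sum>a\<in>{1..h}. v a \<cdot> Z a)) = \<beta> \<odot> 0"
      by (simp add: form_comp_ev F_Z form_ev_0 be)
  qed (simp_all add: s)
  show "\<theta> \<odot> (\<Sum>a\<in>{1..h}. v a \<cdot> Z a) = 0"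
  proof (rule form_eqI)
    fix Y assume Y: "vector_field A Y"
    show "\<theta> \<odot> (\<Sum>a\<in>{1..h}. v a \<cdot> Z a) \<odot> Y = 0 \<odot> Y"
      using two_form_ev(2)[OF \<theta> W Y] by (simp add: form_ev_sum form_ev_right s v Y \<theta>_Z_right)
  qed (simp_all add: s)
  show "sh (\<Sum>a\<in>{1..h}. v a \<cdot> \<xi> a) = 0"
  proof (rule vf_eqI_form)
    fix \<beta> assume be: "one_form A \<beta>"
    show "\<beta> \<odot> sh (\<Sum>a\<in>{1..h}. v a \<cdot> \<xi> a) = \<beta> \<odot> 0"
      using sharp_ev(3)[OF P be om] by (simp add: s be \<xi>_sh form_ev_0)
  qed (simp_all add: s)
  show "form_comp (\<Sum>a\<in>{1..h}. v a \<cdot> \<xi> a) F = 0"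
    by (rule form_eqI) (simp_all add: s form_comp_ev \<xi>_F)
qed

lemma \<Phi>_\<Phi>:
  assumes "big e"
  shows "\<Phi> (\<Phi> e) = - e"
proof -
  obtain X u \<alpha> v where e: "e = ((X, u), (\<alpha>, v))" and X: "vector_field A X" and al: "one_form A \<alpha>"
    and u: "\<And>a. a \<in> {1..h} \<Longrightarrow> smooth_fun A (u a)" and v: "\<And>a. a \<in> {1..h} \<Longrightarrow> smooth_fun A (v a)"
    and 0: "\<And>a. a \<notin> {1..h} \<Longrightarrow> u a = 0" "\<And>a. a \<notin> {1..h} \<Longrightarrow> v a = 0"
    using assms by (rule big_sectionE) (rule that)
  let ?Z = "\<Sum>a\<in>{1..h}. v a \<cdot> Z a" and ?\<xi> = "\<Sum>a\<in>{1..h}. u a \<cdot> \<xi> a"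
  have W: "vector_field A ?Z" and om: "one_form A ?\<xi>" by (auto intro!: contact_closure u v)
  note s = X al W om contact_closure
  have "F \<odot> (F \<odot> X + sh \<alpha> - ?Z) + sh (\<theta> \<odot> X - ?\<xi> - form_comp \<alpha> F) - (\<Sum>a\<in>{1..h}. (\<xi> a \<odot> X) \<cdot> Z a) = - X"
    by (simp add: s endo_ev[OF F] sharp_ev[OF P] sums_Z_\<xi> u v sh_F F_F)
  moreover have "\<theta> \<odot> (F \<odot> X + sh \<alpha> - ?Z) - (\<Sum>a\<in>{1..h}. (\<alpha> \<odot> Z a) \<cdot> \<xi> a)
      - form_comp (\<theta> \<odot> X - ?\<xi> - form_comp \<alpha> F) F = - \<alpha>"
  proof -
    have "form_comp (\<theta> \<odot> X - ?\<xi> - form_comp \<alpha> F) F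
        = form_comp (\<theta> \<odot> X) F - form_comp ?\<xi> F - form_comp (form_comp \<alpha> F) F"
      by (rule form_eqI) (simp_all add: s form_comp_ev ev_left_simps)
    then show ?thesis
      by (simp add: s two_form_ev[OF \<theta>] sums_Z_\<xi> u v form_comp_\<theta> form_comp_F_F)
  qed
  moreover have "(\<theta> \<odot> X - ?\<xi> - form_comp \<alpha> F) \<odot> Z a = - u a" if "a \<in> {1..h}" for a
    using that by (simp add: s ev_left_simps ev_left_sum ev_left_fscale fscale_real form_comp_ev F_Z form_ev_0
        \<theta>_Z_right \<xi>_Z sum_\<delta>)
  moreover have "\<xi> a \<odot> (F \<odot> X + sh \<alpha> - ?Z) = - v a" if "a \<in> {1..h}" for a
    using that v by (simp add: s form_ev_right form_ev_sum \<xi>_F \<xi>_sh \<xi>_Z sum_\<delta>)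
  ultimately show ?thesis
    unfolding e \<Phi>_eq using 0 by (auto simp: fun_eq_iff)
qed

text \<open>Since -e is the square of \<Phi> at e, both sides are the third iterate of \<Phi> at
  e.\<close>

lemma \<Phi>_uminus: "big e \<Longrightarrow> \<Phi> (- e) = - \<Phi> e"
  using \<Phi>_\<Phi>[of "\<Phi> e"] by (simp add: \<Phi>_\<Phi> big_\<Phi>)

lemma pair_\<Phi>:
  assumes "big e" "big g"
  shows "pair (\<Phi> e) g = - pair e (\<Phi> g)"
proof -
  obtain X u \<alpha> v where e: "e = ((X, u), (\<alpha>, v))" and X: "vector_field A X" and al: "one_form A \<alpha>"
    and u: "\<And>a. a \<in> {1..h} \<Longrightarrow> smooth_fun A (u a)" and v: "\<And>a. a \<in> {1..h} \<Longrightarrow> smooth_fun A (v a)"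
    using assms(1) by (rule big_sectionE) (rule that)
  obtain Y u' \<beta> v' where g: "g = ((Y, u'), (\<beta>, v'))" and Y: "vector_field A Y" and be: "one_form A \<beta>"
    and u': "\<And>a. a \<in> {1..h} \<Longrightarrow> smooth_fun A (u' a)" and v': "\<And>a. a \<in> {1..h} \<Longrightarrow> smooth_fun A (v' a)"
    using assms(2) by (rule big_sectionE) (rule that)
  note s = X Y al be u v u' v' contact_closure
  show ?thesis
    unfolding e g \<Phi>_eq pair_eq using two_form_ev(2)[OF \<theta> X Y] sharp_ev(3)[OF P al be]
    by (simp add: s form_ev_right form_ev_sum ev_left_simps ev_left_sum ev_left_fscale fscale_real
      form_comp_ev sum.distrib algebra_simps)
qed

section \<open>Generating sections and nondegeneracy\<close>

definition vec :: "'a vfield \<Rightarrow> 'a bsec" where "vec X = ((X, 0), (0, 0))"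
definition cov :: "'a form1 \<Rightarrow> 'a bsec" where "cov \<alpha> = ((0, 0), (\<alpha>, 0))"
definition ubasis :: "nat \<Rightarrow> 'a bsec" where "ubasis a = ((0, \<lambda>b. if b = a then 1 else 0), (0, 0))"
definition vbasis :: "nat \<Rightarrow> 'a bsec" where "vbasis a = ((0, 0), (0, \<lambda>b. if b = a then 1 else 0))"

lemma big_gens: "vector_field A X \<Longrightarrow> big (vec X)" "one_form A \<alpha> \<Longrightarrow> big (cov \<alpha>)"
  "a \<in> {1..h} \<Longrightarrow> big (ubasis a)" "a \<in> {1..h} \<Longrightarrow> big (vbasis a)"
  by (auto simp: vec_def cov_def ubasis_def vbasis_def intro!: big_sectionI contact_closure)

definition gens :: "'a bsec set" where
  "gens = vec ` {X. vector_field A X} \<union> cov ` {\<alpha>. one_form A \<alpha>} \<union> ubasis ` {1..h} \<union> vbasis ` {1..h}"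

lemma gens_big: "g \<in> gens \<Longrightarrow> big g"
  by (auto simp: gens_def big_gens)

lemma pair_gens:
  assumes "big ((X, u), (\<alpha>, v))"
  shows "pair ((X, u), (\<alpha>, v)) (vec Y) = \<alpha> \<odot> Y" "pair ((X, u), (\<alpha>, v)) (cov \<beta>) = \<beta> \<odot> X"
    "a \<in> {1..h} \<Longrightarrow> pair ((X, u), (\<alpha>, v)) (ubasis a) = v a"
    "a \<in> {1..h} \<Longrightarrow> pair ((X, u), (\<alpha>, v)) (vbasis a) = u a"
proof -
  have X: "vector_field A X" and al: "one_form A \<alpha>" using assms by (auto simp: big_section_def)
  show "pair ((X, u), (\<alpha>, v)) (vec Y) = \<alpha> \<odot> Y" "pair ((X, u), (\<alpha>, v)) (cov \<beta>) = \<beta> \<odot> X"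
    "a \<in> {1..h} \<Longrightarrow> pair ((X, u), (\<alpha>, v)) (ubasis a) = v a"
    "a \<in> {1..h} \<Longrightarrow> pair ((X, u), (\<alpha>, v)) (vbasis a) = u a"
    by (simp_all add: pair_eq vec_def cov_def ubasis_def vbasis_def ev_left_simps sum_\<delta> form_ev_0 al)
qed

lemma pair_nondegenerate:
  assumes e: "big e" and z: "\<And>g. g \<in> gens \<Longrightarrow> pair e g = 0"
  shows "e = 0"
proof -
  obtain X u \<alpha> v where e': "e = ((X, u), (\<alpha>, v))" "vector_field A X" "one_form A \<alpha>"
    "\<And>a. a \<notin> {1..h} \<Longrightarrow> u a = 0" "\<And>a. a \<notin> {1..h} \<Longrightarrow> v a = 0"
    using e by (rule big_sectionE) (rule that)
  note g = pair_gens[OF e[unfolded e'(1)]]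
  have "X = 0" using z[of "cov _"] by (intro vf_eqI_form) (auto simp: e' gens_def g vf_zero form_ev_0)
  moreover have "\<alpha> = 0"
    using z[of "vec _"] by (intro form_eqI) (auto simp: e' gens_def g form_zero ev_left_simps)
  moreover have "u a = 0" for a
    using e'(4)[of a] z[of "vbasis a"] by (cases "a \<in> {1..h}") (auto simp: e'(1) gens_def g)
  moreover have "v a = 0" for a
    using e'(5)[of a] z[of "ubasis a"] by (cases "a \<in> {1..h}") (auto simp: e'(1) gens_def g)
  ultimately show ?thesis by (simp add: e'(1) zero_prod_def fun_eq_iff)
qed

section \<open>The Courant bracket against the pairing\<close>

definition bracket_pair :: "'a bsec \<Rightarrow> 'a bsec \<Rightarrow> 'a bsec \<Rightarrow> 'a \<Rightarrow> real" where
  "bracket_pair e1 e2 e3 = pair (cbr e1 e2) e3"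

lemma bracket_pair_eq:
  assumes "vector_field A X1" "vector_field A X2" "vector_field A X3"
    "one_form A \<alpha>1" "one_form A \<alpha>2" "one_form A \<alpha>3"
    "\<And>a. a \<in> {1..h} \<Longrightarrow> smooth_fun A (u1 a)" "\<And>a. a \<in> {1..h} \<Longrightarrow> smooth_fun A (v1 a)"
    "\<And>a. a \<in> {1..h} \<Longrightarrow> smooth_fun A (u2 a)" "\<And>a. a \<in> {1..h} \<Longrightarrow> smooth_fun A (v2 a)"
  shows "bracket_pair ((X1, u1), (\<alpha>1, v1)) ((X2, u2), (\<alpha>2, v2)) ((X3, u3), (\<alpha>3, v3)) =
     \<alpha>3 \<odot> lie_bracket X1 X2 + (X1 \<triangleright> (\<alpha>2 \<odot> X3) - \<alpha>2 \<odot> lie_bracket X1 X3)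
     - (X2 \<triangleright> (\<alpha>1 \<odot> X3) - \<alpha>1 \<odot> lie_bracket X2 X3)
     + (1/2) *\<^sub>R (X3 \<triangleright> (\<alpha>1 \<odot> X2) - X3 \<triangleright> (\<alpha>2 \<odot> X1))
     + (1/2) *\<^sub>R (\<Sum>a\<in>{1..h}. u2 a * (X3 \<triangleright> v1 a) + v2 a * (X3 \<triangleright> u1 a)
          - u1 a * (X3 \<triangleright> v2 a) - v1 a * (X3 \<triangleright> u2 a))
     + (\<Sum>a\<in>{1..h}. (X1 \<triangleright> u2 a - X2 \<triangleright> u1 a) * v3 a + (X1 \<triangleright> v2 a - X2 \<triangleright> v1 a) * u3 a)"
  by (simp add: bracket_pair_def courant_eq pair_eq assms contact_closure lie_form_ev dfun_ev ev_left_simps ev_left_sum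
      ev_left_fscale ev_left_scaleR fscale_real deriv_along_right)

lemma half_double: "2 * (1/2) *\<^sub>R f = f" for f :: "'b \<Rightarrow> real"
  by (simp add: mult_2 scaleR_add_left[symmetric])

abbreviation anchor :: "'a bsec \<Rightarrow> 'a vfield" where "anchor e \<equiv> fst (fst e)"

lemma vf_anchor: "big e \<Longrightarrow> vector_field A (anchor e)"
  by (erule big_sectionE) simp

lemma bracket_pair_swap: 
  assumes "big e1" "big e2" "big e3"
  shows "bracket_pair e2 e1 e3 = - bracket_pair e1 e2 e3"
proof -
  obtain X1 u1 \<alpha>1 v1 where e1: "e1 = ((X1, u1), (\<alpha>1, v1))" "vector_field A X1" "one_form A \<alpha>1"
    "\<And>a. a \<in> {1..h} \<Longrightarrow> smooth_fun A (u1 a)" "\<And>a. a \<in> {1..h} \<Longrightarrow> smooth_fun A (v1 a)"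
    using assms(1) by (rule big_sectionE) (rule that)
  obtain X2 u2 \<alpha>2 v2 where e2: "e2 = ((X2, u2), (\<alpha>2, v2))" "vector_field A X2" "one_form A \<alpha>2"
    "\<And>a. a \<in> {1..h} \<Longrightarrow> smooth_fun A (u2 a)" "\<And>a. a \<in> {1..h} \<Longrightarrow> smooth_fun A (v2 a)"
    using assms(2) by (rule big_sectionE) (rule that)
  obtain X3 u3 \<alpha>3 v3 where e3: "e3 = ((X3, u3), (\<alpha>3, v3))" "vector_field A X3" "one_form A \<alpha>3"
    "\<And>a. a \<in> {1..h} \<Longrightarrow> smooth_fun A (u3 a)" "\<And>a. a \<in> {1..h} \<Longrightarrow> smooth_fun A (v3 a)"
    using assms(3) by (rule big_sectionE) (rule that)
  have l: "lie_bracket X2 X1 = - lie_bracket X1 X2" by (rule lie_bracket_swap)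
  show ?thesis unfolding e1(1) e2(1) e3(1)
    by (simp add: bracket_pair_eq e1(2-) e2(2-) e3(2-) l form_ev_right vf_lie sum.distrib sum_subtractf algebra_simps)
qed

text \<open>The pairing is invariant under the non-skew Dorfman bracket, from which the Courant
  bracket differs by half the differential of the pairing of its arguments. This accounts for the
  two terms with 1/2.\<close>

lemma bracket_pair_sym:
  assumes "big e1" "big e2" "big e3"
  shows "bracket_pair e1 e2 e3 + bracket_pair e1 e3 e2 = anchor e1 \<triangleright> pair e2 e3
     - (1/2) *\<^sub>R (anchor e3 \<triangleright> pair e1 e2) - (1/2) *\<^sub>R (anchor e2 \<triangleright> pair e1 e3)"
proof -
  obtain X1 u1 \<alpha>1 v1 where e1: "e1 = ((X1, u1), (\<alpha>1, v1))" "vector_field A X1" "one_form A \<alpha>1"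
    "\<And>a. a \<in> {1..h} \<Longrightarrow> smooth_fun A (u1 a)" "\<And>a. a \<in> {1..h} \<Longrightarrow> smooth_fun A (v1 a)"
    using assms(1) by (rule big_sectionE) (rule that)
  obtain X2 u2 \<alpha>2 v2 where e2: "e2 = ((X2, u2), (\<alpha>2, v2))" "vector_field A X2" "one_form A \<alpha>2"
    "\<And>a. a \<in> {1..h} \<Longrightarrow> smooth_fun A (u2 a)" "\<And>a. a \<in> {1..h} \<Longrightarrow> smooth_fun A (v2 a)"
    using assms(2) by (rule big_sectionE) (rule that)
  obtain X3 u3 \<alpha>3 v3 where e3: "e3 = ((X3, u3), (\<alpha>3, v3))" "vector_field A X3" "one_form A \<alpha>3"
    "\<And>a. a \<in> {1..h} \<Longrightarrow> smooth_fun A (u3 a)" "\<And>a. a \<in> {1..h} \<Longrightarrow> smooth_fun A (v3 a)"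
    using assms(3) by (rule big_sectionE) (rule that)
  note c = e1(2-) e2(2-) e3(2-) contact_closure
  have l: "lie_bracket X3 X2 = - lie_bracket X2 X3" by (rule lie_bracket_swap)
  show ?thesis unfolding e1(1) e2(1) e3(1) fst_conv pair_eq
    by (simp add: bracket_pair_eq l c form_ev_right deriv_along_right deriv_along_sum sum.distrib sum_subtractf half_double
        algebra_simps)
qed

lemma pair_uminus_right: "big e \<Longrightarrow> big e' \<Longrightarrow> pair e (- e') = - pair e e'"
  using pair_add(3)[of e' e' e] by (simp add: pair_sym[of e])

text \<open>The sign is clear in the third slot, where only the pairing is involved;
  \<open>bracket_pair_sym\<close> carries it to the second and \<open>bracket_pair_swap\<close> to
  the first.\<close>

lemma bracket_pair_uminus:
  assumes "big e1" "big e2" "big e3"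
  shows "bracket_pair e1 e2 (- e3) = - bracket_pair e1 e2 e3" "bracket_pair e1 (- e2) e3 = - bracket_pair e1 e2 e3" "bracket_pair (- e1) e2 e3 = - bracket_pair e1 e2 e3"
proof -
  have 3: "bracket_pair e1 e2 (- e3) = - bracket_pair e1 e2 e3" if "big e1" "big e2" "big e3" for e1 e2 e3
    unfolding bracket_pair_def using that by (intro pair_uminus_right big_courant)
  have 2: "bracket_pair e1 (- e2) e3 = - bracket_pair e1 e2 e3" if b: "big e1" "big e2" "big e3" for e1 e2 e3
  proof -
    note s = bracket_pair_sym[OF b(1) big_uminus[OF b(2)] b(3)] bracket_pair_sym[OF b]
    from s(1) have "bracket_pair e1 (- e2) e3 = bracket_pair e1 e3 e2 - (anchor e1 \<triangleright> pair e2 e3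
        - (1/2) *\<^sub>R (anchor e3 \<triangleright> pair e1 e2) - (1/2) *\<^sub>R (anchor e2 \<triangleright> pair e1 e3))"
      by (simp add: 3 b pair_uminus_right pair_add(3)[OF b(2,2)] deriv_along_left deriv_along_right smooth_pair vf_anchor algebra_simps)
    then show ?thesis unfolding s(2)[symmetric] by simp
  qed
  show "bracket_pair e1 e2 (- e3) = - bracket_pair e1 e2 e3" "bracket_pair e1 (- e2) e3 = - bracket_pair e1 e2 e3"
    by (rule 3[OF assms], rule 2[OF assms])
  show "bracket_pair (- e1) e2 e3 = - bracket_pair e1 e2 e3"
    using bracket_pair_swap[OF big_uminus[OF assms(1)] assms(2,3)] bracket_pair_swap[OF assms] 2[OF assms(2,1,3)] by simp
qed

section \<open>The Nijenhuis torsion of \<Phi>\<close>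

text \<open>The last term of the usual torsion, the square of \<Phi> applied to the bracket, is
  replaced by minus the bracket.\<close>

definition big_nijenhuis :: "'a bsec \<Rightarrow> 'a bsec \<Rightarrow> 'a bsec" where
  "big_nijenhuis e1 e2 = cbr (\<Phi> e1) (\<Phi> e2) - \<Phi> (cbr (\<Phi> e1) e2) - \<Phi> (cbr e1 (\<Phi> e2)) - cbr e1 e2"

text \<open>The outer \<Phi> of the two middle terms of \<open>big_nijenhuis\<close> has been moved
  to the third section, which changes their sign.\<close>

definition torsion :: "'a bsec \<Rightarrow> 'a bsec \<Rightarrow> 'a bsec \<Rightarrow> 'a \<Rightarrow> real" where
  "torsion e1 e2 e3 = bracket_pair (\<Phi> e1) (\<Phi> e2) e3 + bracket_pair (\<Phi> e1) e2 (\<Phi> e3) + bracket_pair e1 (\<Phi> e2) (\<Phi> e3) - bracket_pair e1 e2 e3"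

lemma big_big_nijenhuis: "big e1 \<Longrightarrow> big e2 \<Longrightarrow> big (big_nijenhuis e1 e2)"
  by (simp add: big_nijenhuis_def big_closure)

lemma pair_big_nijenhuis: "big e1 \<Longrightarrow> big e2 \<Longrightarrow> big e3 \<Longrightarrow> pair (big_nijenhuis e1 e2) e3 = torsion e1 e2 e3"
  by (simp add: big_nijenhuis_def torsion_def pair_add big_closure pair_\<Phi> bracket_pair_def)

lemma torsion_swap: "big e1 \<Longrightarrow> big e2 \<Longrightarrow> big e3 \<Longrightarrow> torsion e2 e1 e3 = - torsion e1 e2 e3"
  using bracket_pair_swap[of "\<Phi> e1" "\<Phi> e2" e3] bracket_pair_swap[of "\<Phi> e1" e2 "\<Phi> e3"] bracket_pair_swap[of e1 "\<Phi> e2" "\<Phi> e3"] bracket_pair_swap[of e1 e2 e3]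
  by (simp add: torsion_def big_closure)

lemma torsion_swap': 
  assumes b: "big e1" "big e2" "big e3" 
  shows "torsion e1 e3 e2 = - torsion e1 e2 e3"
proof -
  note b' = b b[THEN big_\<Phi>]
  have d: "X \<triangleright> (- pair e e') = - (X \<triangleright> pair e e')" if "vector_field A X" "big e" "big e'" for X e e'
    using that by (simp add: deriv_along_right smooth_pair)
  have q: "pair (\<Phi> e) (\<Phi> e') = pair e e'" if "big e" "big e'" for e e'
    using that by (simp add: pair_\<Phi> \<Phi>_\<Phi> big_\<Phi> pair_uminus_right)
  \<comment> \<open>Each parenthesis is a left-hand side of \<open>bracket_pair_sym\<close>. The
    derivatives that result run along the anchors of the three sections and of their images under
    \<Phi>, and they cancel for each of the six anchors separately.\<close>
  have "torsion e1 e2 e3 + torsion e1 e3 e2 = 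
     (bracket_pair (\<Phi> e1) (\<Phi> e2) e3 + bracket_pair (\<Phi> e1) e3 (\<Phi> e2)) + (bracket_pair (\<Phi> e1) e2 (\<Phi> e3) + bracket_pair (\<Phi> e1) (\<Phi> e3) e2)
     + (bracket_pair e1 (\<Phi> e2) (\<Phi> e3) + bracket_pair e1 (\<Phi> e3) (\<Phi> e2)) - (bracket_pair e1 e2 e3 + bracket_pair e1 e3 e2)"
    by (simp add: torsion_def)
  also have "\<dots> = 0"
    unfolding bracket_pair_sym[OF b'(4,5,3)] bracket_pair_sym[OF b'(4,2,6)] bracket_pair_sym[OF b'(1,5,6)] bracket_pair_sym[OF b]
      q[OF b(1,2)] q[OF b(1,3)] q[OF b(2,3)] pair_\<Phi>[OF b(1,2)] pair_\<Phi>[OF b(1,3)] pair_\<Phi>[OF b(2,3)]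
    using b' by (simp add: d vf_anchor algebra_simps)
  finally show ?thesis by (simp add: eq_neg_iff_add_eq_0 add.commute)
qed

lemma torsion_rotate: "big e1 \<Longrightarrow> big e2 \<Longrightarrow> big e3 \<Longrightarrow> torsion e2 e3 e1 = torsion e1 e2 e3"
  using torsion_swap[of e1 e2 e3] torsion_swap'[of e2 e1 e3] by simp

text \<open>By nondegeneracy of the pairing, vanishing on generators in the last slot gives
  vanishing on all sections there. Rotating the freed slot away and repeating frees all three, so no
  section has to be expanded in generators.\<close>

lemma big_nijenhuis_eq_0_iff:
  "(\<forall>e1 e2. big e1 \<longrightarrow> big e2 \<longrightarrow> big_nijenhuis e1 e2 = 0) \<longleftrightarrow> (\<forall>g1\<in>gens. \<forall>g2\<in>gens. \<forall>g3\<in>gens. torsion g1 g2 g3 = 0)"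
proof
  have p: "pair 0 e = 0" if "big e" for e
    using pair_add(2)[OF that that that] by simp
  show "\<forall>g1\<in>gens. \<forall>g2\<in>gens. \<forall>g3\<in>gens. torsion g1 g2 g3 = 0" if "\<forall>e1 e2. big e1 \<longrightarrow> big e2 \<longrightarrow> big_nijenhuis e1 e2 = 0"
    using that gens_big p by (metis pair_big_nijenhuis)
  assume 0: "\<forall>g1\<in>gens. \<forall>g2\<in>gens. \<forall>g3\<in>gens. torsion g1 g2 g3 = 0"
  have n: "big_nijenhuis e1 e2 = 0" if "big e1" "big e2" "\<And>g. g \<in> gens \<Longrightarrow> torsion e1 e2 g = 0" for e1 e2
    using that by (intro pair_nondegenerate big_big_nijenhuis) (simp_all add: pair_big_nijenhuis gens_big)
  have t: "torsion e1 e2 e3 = 0" if "big e1" "big e2" "\<And>g. g \<in> gens \<Longrightarrow> torsion e1 e2 g = 0" "big e3" for e1 e2 e3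
  proof -
    have "big_nijenhuis e1 e2 = 0" by (rule n[OF that(1,2)]) (rule that(3))
    then show ?thesis unfolding pair_big_nijenhuis[OF that(1,2,4), symmetric] by (simp only: p[OF that(4)])
  qed
  have 1: "torsion g1 g2 e3 = 0" if "g1 \<in> gens" "g2 \<in> gens" "big e3" for g1 g2 e3
    by (rule t[OF gens_big[OF that(1)] gens_big[OF that(2)] _ that(3)]) (use 0 that in blast)
  have 2: "torsion e3 g1 e2 = 0" if "g1 \<in> gens" "big e2" "big e3" for g1 e2 e3
  proof (rule t[OF that(3) gens_big[OF that(1)] _ that(2)])
    show "torsion e3 g1 g = 0" if "g \<in> gens" for g
      using 1[OF \<open>g1 \<in> gens\<close> that \<open>big e3\<close>] torsion_rotate[of e3 g1 g] that \<open>g1 \<in> gens\<close> \<open>big e3\<close>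
      by (simp only: gens_big)
  qed
  show "\<forall>e1 e2. big e1 \<longrightarrow> big e2 \<longrightarrow> big_nijenhuis e1 e2 = 0"
  proof (intro allI impI n)
    fix e1 e2 g assume b: "big e1" "big e2" and g: "g \<in> gens"
    note r = torsion_rotate[OF b gens_big[OF g]] torsion_rotate[OF b(2) gens_big[OF g] b(1)]
    show "torsion e1 e2 g = 0" using 2[OF g b(1,2)] r by (simp only:)
  qed
qed

section \<open>Eigensections and normality\<close>

lemma big_eqI:
  assumes "big e" "big e'" "\<And>g. g \<in> gens \<Longrightarrow> pair e g = pair e' g"
  shows "e = e'"
proof -
  have "e - e' = 0"
    using assms by (intro pair_nondegenerate big_diff) (simp_all add: pair_add gens_big)
  then show ?thesis by simp
qed

text \<open>Follows from skewness and nondegeneracy of the pairing, without looking at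
  components.\<close>

lemma \<Phi>_add: "big e \<Longrightarrow> big e' \<Longrightarrow> \<Phi> (e + e') = \<Phi> e + \<Phi> e'"
  by (rule big_eqI) (simp_all add: big_closure pair_\<Phi> pair_add gens_big)

lemma courant_uminus:
  assumes "big e1" "big e2"
  shows "cbr e1 (- e2) = - cbr e1 e2" "cbr (- e1) e2 = - cbr e1 e2"
  using bracket_pair_uminus(2,3)[OF assms] assms
  by (intro big_eqI; simp add: big_closure pair_add gens_big bracket_pair_def)+

text \<open>The eigenvalue equation consists of \<Phi> e = - e' and \<Phi> e' = e; the second
  follows from the first because \<Phi> squares to -Id.\<close>

lemma i_eigensections_eq: "i_eigensections A h \<Phi> = {(e, - \<Phi> e) |e. big e}"
  unfolding i_eigensections_def times_i_def
  by (auto simp: \<Phi>_uminus \<Phi>_\<Phi> big_closure)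

text \<open>The bracket of two eigensections has real part x and imaginary part -y. It is again an
  eigensection iff y = \<Phi> x, that is iff x + \<Phi> y = 0, and x + \<Phi> y is minus the
  torsion.\<close>

lemma normal_iff_big_nijenhuis:
  "normal_structure A h P \<theta> F Z \<xi> \<longleftrightarrow> (\<forall>e1 e2. big e1 \<longrightarrow> big e2 \<longrightarrow> big_nijenhuis e1 e2 = 0)"
proof -
  have c: "courant_C A h (e1, - \<Phi> e1) (e2, - \<Phi> e2) \<in> i_eigensections A h \<Phi> \<longleftrightarrow> big_nijenhuis e1 e2 = 0"
    if b: "big e1" "big e2" for e1 e2
  proof -
    define x where "x = cbr e1 e2 - cbr (\<Phi> e1) (\<Phi> e2)"
    define y where "y = cbr e1 (\<Phi> e2) + cbr (\<Phi> e1) e2"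
    have xy: "big x" "big y" using b by (simp_all add: x_def y_def big_closure)
    have "courant_C A h (e1, - \<Phi> e1) (e2, - \<Phi> e2) = (x, - y)"
      by (simp add: courant_C_def courant_uminus b big_closure x_def y_def)
    then have "courant_C A h (e1, - \<Phi> e1) (e2, - \<Phi> e2) \<in> i_eigensections A h \<Phi> \<longleftrightarrow> y = \<Phi> x"
      using xy(1) by (auto simp: i_eigensections_eq simp del: split_paired_Ex)
    also have "\<dots> \<longleftrightarrow> x + \<Phi> y = 0"
    proof
      assume "y = \<Phi> x" then show "x + \<Phi> y = 0" by (simp add: \<Phi>_\<Phi> xy)
    next
      assume "x + \<Phi> y = 0"
      then have "x = - \<Phi> y" by (simp add: eq_neg_iff_add_eq_0)
      then show "y = \<Phi> x" by (simp add: \<Phi>_uminus \<Phi>_\<Phi> xy big_\<Phi>)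
    qed
    also have "x + \<Phi> y = - big_nijenhuis e1 e2"
      by (simp add: x_def y_def big_nijenhuis_def \<Phi>_add big_closure b)
    finally show ?thesis by simp
  qed
  show ?thesis
  proof
    assume n: "normal_structure A h P \<theta> F Z \<xi>"
    show "\<forall>e1 e2. big e1 \<longrightarrow> big e2 \<longrightarrow> big_nijenhuis e1 e2 = 0"
    proof (intro allI impI)
      fix e1 e2 assume b: "big e1" "big e2"
      have m: "(e1, - \<Phi> e1) \<in> i_eigensections A h \<Phi>" "(e2, - \<Phi> e2) \<in> i_eigensections A h \<Phi>"
        unfolding i_eigensections_eq by (rule CollectI, rule exI, rule conjI, rule refl, rule b)+
      show "big_nijenhuis e1 e2 = 0"
        by (rule iffD1[OF c[OF b] bspec[OF bspec[OF n[unfolded normal_structure_def] m(1)] m(2)]])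
    qed
  next
    assume n: "\<forall>e1 e2. big e1 \<longrightarrow> big e2 \<longrightarrow> big_nijenhuis e1 e2 = 0"
    show "normal_structure A h P \<theta> F Z \<xi>" unfolding normal_structure_def
    proof (intro ballI)
      fix s t assume "s \<in> i_eigensections A h \<Phi>" "t \<in> i_eigensections A h \<Phi>"
      then obtain e1 e2 where st: "s = (e1, - \<Phi> e1)" "t = (e2, - \<Phi> e2)" and b: "big e1" "big e2"
        unfolding i_eigensections_eq by (elim CollectE exE conjE) (rule that)
      show "courant_C A h s t \<in> i_eigensections A h \<Phi>" unfolding st c[OF b] using n b by blast
    qed
  qed
qed

section \<open>The torsion on generators\<close>

lemma \<Phi>_gens:
  "vector_field A X \<Longrightarrow> \<Phi> (vec X) = ((F \<odot> X, 0), (\<theta> \<odot> X, \<lambda>a. if a \<in> {1..h} then \<xi> a \<odot> X else 0))"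
  "one_form A \<alpha> \<Longrightarrow> \<Phi> (cov \<alpha>) = ((sh \<alpha>, \<lambda>a. if a \<in> {1..h} then \<alpha> \<odot> Z a else 0), (- form_comp \<alpha> F, 0))"
  "a \<in> {1..h} \<Longrightarrow> \<Phi> (ubasis a) = ((0, 0), (- \<xi> a, 0))"
  "a \<in> {1..h} \<Longrightarrow> \<Phi> (vbasis a) = ((- Z a, 0), (0, 0))"
proof -
  have 0: "(0 :: 'a \<Rightarrow> real) \<cdot> s = 0" "(1 :: 'a \<Rightarrow> real) \<cdot> s = s" for s :: "'a \<Rightarrow> 'b::real_vector"
    by (simp_all add: fscale_def zero_fun_def)
  have if0: "(if b = a then 1 else 0 :: 'a \<Rightarrow> real) \<cdot> s = (if b = a then s else 0)" for a b :: nat and s :: "'a \<Rightarrow> 'b::real_vector"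
    by (simp add: 0)
  have f0: "form_comp 0 F = 0" by (simp add: form_comp_def fun_eq_iff)
  note s = \<Phi>_eq vec_def cov_def ubasis_def vbasis_def 0 if0 f0 endo_ev_0[OF F] two_form_ev_0[OF \<theta>] sharp_ev_0[OF P] ev_left_simps
    form_ev_0 \<xi>
  show "\<Phi> (vec X) = ((F \<odot> X, 0), (\<theta> \<odot> X, \<lambda>a. if a \<in> {1..h} then \<xi> a \<odot> X else 0))" if "vector_field A X"
    using that by (simp add: s) (auto simp: fun_eq_iff ev_apply)
  show "\<Phi> (cov \<alpha>) = ((sh \<alpha>, \<lambda>a. if a \<in> {1..h} then \<alpha> \<odot> Z a else 0), (- form_comp \<alpha> F, 0))" if "one_form A \<alpha>"
    using that by (simp add: s) (auto simp: ev_left_simps form_ev_0 \<xi> fun_eq_iff)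
  show "\<Phi> (ubasis a) = ((0, 0), (- \<xi> a, 0))" if "a \<in> {1..h}"
    using that by (simp add: s) (auto simp: ev_left_simps form_ev_0 \<xi> fun_eq_iff)
  show "\<Phi> (vbasis a) = ((- Z a, 0), (0, 0))" if "a \<in> {1..h}"
    using that by (simp add: s) (auto simp: ev_left_simps form_ev_0 \<xi> fun_eq_iff)
qed

lemma half_double': "(1/2) *\<^sub>R (2 * f) = f" for f :: "'b \<Rightarrow> real"
  using half_double[of f] by (simp add: fun_eq_iff scaleR_fun_apply)

lemma deriv_along_delta: "vector_field A X \<Longrightarrow> X \<triangleright> (if b = a then 1 else 0) = 0" for a b :: nat
  by (simp add: deriv_along_0 deriv_along_1)

lemma smooth_delta: "smooth_fun A (if b = a then 1 else 0)" for a b :: nat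
  by (simp add: smooth_zero smooth_one)

lemmas torsion_simps = torsion_def \<Phi>_gens[unfolded vec_def cov_def ubasis_def vbasis_def] bracket_pair_eq contact_closure ev_left_simps form_ev_0 deriv_along_0 lie_bracket_0
  deriv_along_left lie_bracket_simps form_ev_right deriv_along_right deriv_along_delta mult_delta_left mult_delta_right
  smooth_delta endo_ev_0[OF F] two_form_ev_0[OF \<theta>] sharp_ev_0[OF P]
  form_comp_ev half_double half_double' sum_negf \<xi>_F \<theta>_Z \<theta>_Z_right \<xi>_sh \<xi>_Z F_Z sum.delta sum_\<delta>

lemmas gens_simps = torsion_simps vec_def cov_def ubasis_def vbasis_def

lemma \<theta>_swap: "vector_field A U \<Longrightarrow> vector_field A V \<Longrightarrow> \<theta> \<odot> U \<odot> V = - (\<theta> \<odot> V \<odot> U)"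
  by (rule two_form_ev(2)[OF \<theta>])

lemma \<theta>_lie: "vector_field A U \<Longrightarrow> vector_field A V \<Longrightarrow> vector_field A V' \<Longrightarrow>
    \<theta> \<odot> lie_bracket U V \<odot> V' = - (\<theta> \<odot> V' \<odot> lie_bracket U V)"
  by (intro \<theta>_swap vf_lie)

lemma form2_comp_ev: "form2_comp \<theta> F \<odot> U \<odot> V = \<theta> \<odot> (F \<odot> U) \<odot> V"
  by (simp add: form2_comp_def ev_def)

lemma torsion_XYW:
  assumes X: "vector_field A X" and Y: "vector_field A Y" and W: "vector_field A W"
  shows "torsion (vec X) (vec Y) (vec W) = 
    d2 \<theta> (F \<odot> X) Y W + d2 \<theta> (F \<odot> Y) W X + d2 \<theta> (F \<odot> W) X Y - d2 (form2_comp \<theta> F) X Y W"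
proof -
  \<comment> \<open>Skewness brings all brackets and all values of \<theta> to one order of their
    arguments, so that equal terms can cancel; the other torsion formulas do the same.\<close>
  have l: "lie_bracket Y (F \<odot> X) = - lie_bracket (F \<odot> X) Y" "lie_bracket W (F \<odot> X) = - lie_bracket (F \<odot> X) W" 
    "lie_bracket X (F \<odot> Y) = - lie_bracket (F \<odot> Y) X" "lie_bracket W (F \<odot> Y) = - lie_bracket (F \<odot> Y) W" 
    "lie_bracket X (F \<odot> W) = - lie_bracket (F \<odot> W) X" "lie_bracket Y (F \<odot> W) = - lie_bracket (F \<odot> W) Y" 
    "lie_bracket W X = - lie_bracket X W"
    by (rule lie_bracket_swap)+
  have t: "\<theta> \<odot> Y \<odot> X = - (\<theta> \<odot> X \<odot> Y)" "\<theta> \<odot> W \<odot> X = - (\<theta> \<odot> X \<odot> W)" "\<theta> \<odot> W \<odot> Y = - (\<theta> \<odot> Y \<odot> W)"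
    "\<theta> \<odot> Y \<odot> (F \<odot> X) = - (\<theta> \<odot> X \<odot> (F \<odot> Y))" "\<theta> \<odot> W \<odot> (F \<odot> X) = - (\<theta> \<odot> X \<odot> (F \<odot> W))" 
    "\<theta> \<odot> W \<odot> (F \<odot> Y) = - (\<theta> \<odot> Y \<odot> (F \<odot> W))"
    using \<theta>_swap[of Y X] \<theta>_swap[of W X] \<theta>_swap[of W Y] \<theta>_swap[of "F \<odot> X" Y]  \<theta>_swap[of "F \<odot> X" W]
       \<theta>_swap[of "F \<odot> Y" W] by (simp_all add: X Y W contact_closure \<theta>_F)
  show ?thesis
    by (simp add: gens_simps assms d2_def form2_comp_ev \<theta>_F \<theta>_lie l t two_form_ev(6)[OF \<theta>])
qed

text \<open>The torsion of \<Phi> contains -[X,Y] where that of F has the square of F on [X,Y].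
  \<open>F_F\<close> exchanges one for the other, and the surplus terms complete the derivatives of
  \<theta> and of the \<xi> a.\<close>

lemma torsion_XY\<alpha>:
  assumes X: "vector_field A X" and Y: "vector_field A Y" and al: "one_form A \<alpha>"
  shows "torsion (vec X) (vec Y) (cov \<alpha>) = \<alpha> \<odot> nijenhuis F X Y + d2 \<theta> X Y (sh \<alpha>)
    + (\<Sum>a\<in>{1..h}. d1 (\<xi> a) X Y * (\<alpha> \<odot> Z a))"
proof -
  have l: "lie_bracket (sh \<alpha>) X = - lie_bracket X (sh \<alpha>)" by (rule lie_bracket_swap)
  have t: "\<theta> \<odot> Y \<odot> X = - (\<theta> \<odot> X \<odot> Y)" "\<theta> \<odot> sh \<alpha> \<odot> X = - (\<theta> \<odot> X \<odot> sh \<alpha>)"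
     "\<theta> \<odot> lie_bracket X Y \<odot> sh \<alpha> = - (\<alpha> \<odot> sh (\<theta> \<odot> lie_bracket X Y))"
     "\<theta> \<odot> lie_bracket Y (sh \<alpha>) \<odot> X = - (\<theta> \<odot> X \<odot> lie_bracket Y (sh \<alpha>))"
     "\<theta> \<odot> lie_bracket X (sh \<alpha>) \<odot> Y = - (\<theta> \<odot> Y \<odot> lie_bracket X (sh \<alpha>))"
    by (intro \<theta>_swap \<theta>_sh X Y al contact_closure)+
  show ?thesis
    by (simp add: gens_simps assms nijenhuis_def d2_def d1_def l t F_F form_ev_sum sum.distrib sum_subtractf
        two_form_ev(6)[OF \<theta>] algebra_simps)
qed

lemma torsion_XYu:
  assumes X: "vector_field A X" and Y: "vector_field A Y"
  shows "a \<in> {1..h} \<Longrightarrow> torsion (vec X) (vec Y) (ubasis a) = d1 (\<xi> a) (F \<odot> X) Y + d1 (\<xi> a) X (F \<odot> Y)"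
  by (simp add: gens_simps assms d1_def)

lemma torsion_XYv:
  assumes X: "vector_field A X" and Y: "vector_field A Y"
  shows "a \<in> {1..h} \<Longrightarrow> torsion (vec X) (vec Y) (vbasis a) = - lie_form2 (Z a) \<theta> X Y"
  using lie_bracket_swap[of Y "Z a"] lie_bracket_swap[of X "Z a"] \<theta>_swap[OF Y X]
  by (simp add: gens_simps assms lie_form2_def \<theta>_lie)

lemma torsion_X\<alpha>\<beta>:
  assumes X: "vector_field A X" and al: "one_form A \<alpha>" and be: "one_form A \<beta>"
  shows "torsion (vec X) (cov \<alpha>) (cov \<beta>) = \<beta> \<odot> schouten_concomitant A P F \<alpha> X"
proof -
  have l: "lie_bracket (sh \<alpha>) (F \<odot> X) = - lie_bracket (F \<odot> X) (sh \<alpha>)" "lie_bracket (sh \<alpha>) X = - lie_bracket X (sh \<alpha>)" 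
    by (rule lie_bracket_swap)+
  have c: "vector_field A (lie_endo (sh \<alpha>) F X)" by (simp add: lie_endo_def al X contact_closure)
  \<comment> \<open>Skewness of P moves \<open>sh\<close> onto \<beta>, so that the Lie derivatives
    are evaluated on the field \<open>sh \<beta>\<close>.\<close>
  have r: "\<beta> \<odot> sh (lie_form A X (form_comp \<alpha> F) - lie_form A (F \<odot> X) \<alpha>)
      = - ((lie_form A X (form_comp \<alpha> F) - lie_form A (F \<odot> X) \<alpha>) \<odot> sh \<beta>)"
    by (intro sharp_ev(3)[OF P] be contact_closure X al)
  show ?thesis
    unfolding schouten_concomitant_def
    by (simp add: gens_simps assms c r lie_form_ev lie_endo_def endo_ev[OF F] l)
qed

text \<open>The right-hand side is \<open>jacobiator P \<alpha> \<beta> \<gamma>\<close> written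
  out; this is where the torsion meets the Schouten bracket.\<close>

lemma torsion_\<alpha>\<beta>\<gamma>:
  assumes al: "one_form A \<alpha>" and be: "one_form A \<beta>" and ga: "one_form A \<gamma>"
  shows "torsion (cov \<alpha>) (cov \<beta>) (cov \<gamma>) = \<gamma> \<odot> lie_bracket (sh \<alpha>) (sh \<beta>) + \<alpha> \<odot> lie_bracket (sh \<beta>) (sh \<gamma>)
    + \<beta> \<odot> lie_bracket (sh \<gamma>) (sh \<alpha>) - sh \<alpha> \<triangleright> (\<gamma> \<odot> sh \<beta>) - sh \<beta> \<triangleright> (\<alpha> \<odot> sh \<gamma>) - sh \<gamma> \<triangleright> (\<beta> \<odot> sh \<alpha>)"
  using lie_bracket_swap[of "sh \<gamma>" "sh \<alpha>"] sharp_ev(3)[OF P al be] sharp_ev(3)[OF P be ga]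
  by (simp add: gens_simps assms)

lemma torsion_X\<alpha>u:
  assumes X: "vector_field A X" and al: "one_form A \<alpha>"
  shows "a \<in> {1..h} \<Longrightarrow> torsion (vec X) (cov \<alpha>) (ubasis a) = - (lie_form A (sh \<alpha>) (\<xi> a) \<odot> X)"
  using lie_bracket_swap[of "sh \<alpha>" X] by (simp add: gens_simps assms lie_form_ev)

lemma torsion_X\<alpha>v:
  assumes X: "vector_field A X" and al: "one_form A \<alpha>"
  shows "a \<in> {1..h} \<Longrightarrow> torsion (vec X) (cov \<alpha>) (vbasis a) = - (\<alpha> \<odot> lie_endo (Z a) F X)"
  using lie_bracket_swap[of "Z a" X] lie_bracket_swap[of "Z a" "F \<odot> X"] 
  by (simp add: gens_simps assms lie_endo_def endo_ev[OF F])

lemma torsion_\<alpha>\<beta>v: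
  assumes al: "one_form A \<alpha>" and be: "one_form A \<beta>"
  shows "a \<in> {1..h} \<Longrightarrow> torsion (cov \<alpha>) (cov \<beta>) (vbasis a) = - lie_bivec A (Z a) P \<alpha> \<beta>"
proof -
  assume a: "a \<in> {1..h}"
  have l: "lie_bracket (sh \<alpha>) (Z a) = - lie_bracket (Z a) (sh \<alpha>)" "lie_bracket (sh \<beta>) (Z a) = - lie_bracket (Z a) (sh \<beta>)"
    by (rule lie_bracket_swap)+
  have r: "\<beta> \<odot> sh (lie_form A (Z a) \<alpha>) = - (lie_form A (Z a) \<alpha> \<odot> sh \<beta>)" "\<alpha> \<odot> sh \<beta> = - (\<beta> \<odot> sh \<alpha>)"
    by (intro sharp_ev(3)[OF P] be contact_closure a al)+
  show ?thesis
    using a by (simp add: gens_simps assms lie_bivec_def sharp_ev(2)[OF P] r l lie_form_ev)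
qed

text \<open>As \<xi> a (Z b) is constant, Cartan's formula identifies this value with minus the Lie
  derivative of \<xi> a along Z b, evaluated on X.\<close>

lemma torsion_Xuv:
  assumes X: "vector_field A X"
  shows "a \<in> {1..h} \<Longrightarrow> b \<in> {1..h} \<Longrightarrow> torsion (vec X) (ubasis a) (vbasis b) = d1 (\<xi> a) X (Z b)"
  by (simp add: gens_simps assms d1_def)

lemma torsion_\<alpha>vv:
  assumes al: "one_form A \<alpha>"
  shows "a \<in> {1..h} \<Longrightarrow> b \<in> {1..h} \<Longrightarrow> torsion (cov \<alpha>) (vbasis a) (vbasis b) = \<alpha> \<odot> lie_bracket (Z a) (Z b)"
  by (simp add: gens_simps assms)

lemma torsion_trivial:
  assumes "a \<in> {1..h}" "b \<in> {1..h}" "c \<in> {1..h}"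
  shows "vector_field A X \<Longrightarrow> torsion (vec X) (ubasis a) (ubasis b) = 0" "vector_field A X \<Longrightarrow> torsion (vec X) (vbasis a) (vbasis b) = 0"
    "one_form A \<alpha> \<Longrightarrow> one_form A \<beta> \<Longrightarrow> torsion (cov \<alpha>) (cov \<beta>) (ubasis a) = 0" "one_form A \<alpha> \<Longrightarrow> torsion (cov \<alpha>) (ubasis a) (ubasis b) = 0" "one_form A \<alpha> \<Longrightarrow> torsion (cov \<alpha>) (ubasis a) (vbasis b) = 0" 
    "torsion (ubasis a) (ubasis b) (ubasis c) = 0" "torsion (ubasis a) (ubasis b) (vbasis c) = 0"
    "torsion (ubasis a) (vbasis b) (vbasis c) = 0" "torsion (vbasis a) (vbasis b) (vbasis c) = 0"
  using assms by (simp_all add: gens_simps)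

lemma fscale_zero: "(0 :: 'b \<Rightarrow> real) \<cdot> s = 0" for s :: "'b \<Rightarrow> 'c::real_vector"
  by (simp add: fscale_def zero_fun_def)

lemma smooth_d1: "one_form A \<alpha> \<Longrightarrow> vector_field A X \<Longrightarrow> vector_field A Y \<Longrightarrow> smooth_fun A (d1 \<alpha> X Y)"
  by (simp add: d1_def contact_closure)

text \<open>Skewness of P turns the value of d\<theta> on \<open>sh \<alpha>\<close> into a value of
  \<alpha>. The torsion becomes \<alpha> applied to the difference of the two sides of the Nijenhuis
  condition.\<close>

lemma torsion_XY\<alpha>':
  assumes X: "vector_field A X" and Y: "vector_field A Y" and al: "one_form A \<alpha>"
  shows "torsion (vec X) (vec Y) (cov \<alpha>) =
    \<alpha> \<odot> (nijenhuis F X Y - (sh (contr_d2 A \<theta> X Y) - (\<Sum>a\<in>{1..h}. d1 (\<xi> a) X Y \<cdot> Z a)))"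
proof -
  have c: "one_form A (contr_d2 A \<theta> X Y)" by (rule contr_d2(1)[OF \<theta> X Y])
  have n: "vector_field A (nijenhuis F X Y)" by (simp add: nijenhuis_def contact_closure X Y)
  have "\<alpha> \<odot> sh (contr_d2 A \<theta> X Y) = - d2 \<theta> X Y (sh \<alpha>)"
    using sharp_ev(3)[OF P al c] contr_d2(2)[OF \<theta> X Y, of "sh \<alpha>"] by (simp add: contact_closure al)
  then show ?thesis
    by (simp add: torsion_XY\<alpha>[OF X Y al] form_ev_right form_ev_sum contact_closure c n al smooth_d1 X Y)
qed

section \<open>Reduction to sorted triples of generators\<close>

text \<open>Total skewness allows the three generators to be sorted by kind. Of the twenty sorted
  kinds of triples the premises cover eleven and \<open>torsion_trivial\<close> the other
  nine.\<close>

lemma torsion_gens_eq_0: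
  assumes
    "\<And>X Y W. vector_field A X \<Longrightarrow> vector_field A Y \<Longrightarrow> vector_field A W \<Longrightarrow> torsion (vec X) (vec Y) (vec W) = 0"
    "\<And>X Y \<alpha>. vector_field A X \<Longrightarrow> vector_field A Y \<Longrightarrow> one_form A \<alpha> \<Longrightarrow> torsion (vec X) (vec Y) (cov \<alpha>) = 0"
    "\<And>X Y a. vector_field A X \<Longrightarrow> vector_field A Y \<Longrightarrow> a \<in> {1..h} \<Longrightarrow> torsion (vec X) (vec Y) (ubasis a) = 0"
    "\<And>X Y a. vector_field A X \<Longrightarrow> vector_field A Y \<Longrightarrow> a \<in> {1..h} \<Longrightarrow> torsion (vec X) (vec Y) (vbasis a) = 0"
    "\<And>X \<alpha> \<beta>. vector_field A X \<Longrightarrow> one_form A \<alpha> \<Longrightarrow> one_form A \<beta> \<Longrightarrow> torsion (vec X) (cov \<alpha>) (cov \<beta>) = 0"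
    "\<And>\<alpha> \<beta> \<gamma>. one_form A \<alpha> \<Longrightarrow> one_form A \<beta> \<Longrightarrow> one_form A \<gamma> \<Longrightarrow> torsion (cov \<alpha>) (cov \<beta>) (cov \<gamma>) = 0"
    "\<And>X \<alpha> a. vector_field A X \<Longrightarrow> one_form A \<alpha> \<Longrightarrow> a \<in> {1..h} \<Longrightarrow> torsion (vec X) (cov \<alpha>) (ubasis a) = 0"
    "\<And>X \<alpha> a. vector_field A X \<Longrightarrow> one_form A \<alpha> \<Longrightarrow> a \<in> {1..h} \<Longrightarrow> torsion (vec X) (cov \<alpha>) (vbasis a) = 0"
    "\<And>\<alpha> \<beta> a. one_form A \<alpha> \<Longrightarrow> one_form A \<beta> \<Longrightarrow> a \<in> {1..h} \<Longrightarrow> torsion (cov \<alpha>) (cov \<beta>) (vbasis a) = 0"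
    "\<And>X a b. vector_field A X \<Longrightarrow> a \<in> {1..h} \<Longrightarrow> b \<in> {1..h} \<Longrightarrow> torsion (vec X) (ubasis a) (vbasis b) = 0"
    "\<And>\<alpha> a b. one_form A \<alpha> \<Longrightarrow> a \<in> {1..h} \<Longrightarrow> b \<in> {1..h} \<Longrightarrow> torsion (cov \<alpha>) (vbasis a) (vbasis b) = 0"
    and g: "g1 \<in> gens" "g2 \<in> gens" "g3 \<in> gens"
  shows "torsion g1 g2 g3 = 0"
proof -
  \<comment> \<open>The four kinds of generators are numbered, so that sorting a triple becomes a
    comparison of three numbers.\<close>
  define K where "K i = (if i = 0 then vec ` {X. vector_field A X} else if i = 1 then cov ` {\<alpha>. one_form A \<alpha>}
    else if i = 2 then ubasis ` {1..h} else vbasis ` {1..h})" for i :: nat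
  have K: "\<exists>i<4. g \<in> K i" if g: "g \<in> gens" for g
  proof -
    consider "g \<in> K 0" | "g \<in> K 1" | "g \<in> K 2" | "g \<in> K 3" using g unfolding gens_def K_def by auto
    then show ?thesis by cases (auto intro: exI[of _ 0] exI[of _ 1] exI[of _ 2] exI[of _ 3])
  qed
  have b: "big g" if "g \<in> K i" for g i
    using that by (auto simp: K_def big_gens split: if_splits)
  have sorted: "torsion g1 g2 g3 = 0" if "i \<le> j" "j \<le> k" "k < 4" "g1 \<in> K i" "g2 \<in> K j" "g3 \<in> K k" for i j k g1 g2 g3
  proof -
    have "i = 0 \<or> i = 1 \<or> i = 2 \<or> i = 3" "j = 0 \<or> j = 1 \<or> j = 2 \<or> j = 3" "k = 0 \<or> k = 1 \<or> k = 2 \<or> k = 3"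
      using that by auto
    then show ?thesis using that by (elim disjE) (auto simp: K_def assms torsion_trivial)
  qed
  have s: "torsion x y z = 0 \<longleftrightarrow> torsion y x z = 0" "torsion x y z = 0 \<longleftrightarrow> torsion x z y = 0" if "big x" "big y" "big z" for x y z
    using torsion_swap[OF that] torsion_swap'[OF that] by simp_all
  obtain i where i: "i < 4" "g1 \<in> K i" using K[OF g(1)] by blast
  obtain j where j: "j < 4" "g2 \<in> K j" using K[OF g(2)] by blast
  obtain k where k: "k < 4" "g3 \<in> K k" using K[OF g(3)] by blast
  note * = i j k
  note bb = b[OF *(2)] b[OF *(4)] b[OF *(6)]
  consider "i \<le> j" "j \<le> k" | "i \<le> k" "k \<le> j" | "j \<le> i" "i \<le> k" | "j \<le> k" "k \<le> i" | "k \<le> i" "i \<le> j" | "k \<le> j" "j \<le> i"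
    by linarith
  then show ?thesis
  proof cases
    case 1 then show ?thesis using sorted[OF _ _ k(1) i(2) j(2) k(2)] by blast
  next
    case 2 then have "torsion g1 g3 g2 = 0" using sorted[OF _ _ j(1) i(2) k(2) j(2)] by blast
    then show ?thesis using s(2)[OF bb] by simp
  next
    case 3 then have "torsion g2 g1 g3 = 0" using sorted[OF _ _ k(1) j(2) i(2) k(2)] by blast
    then show ?thesis using s(1)[OF bb] by simp
  next
    case 4 then have "torsion g2 g3 g1 = 0" using sorted[OF _ _ i(1) j(2) k(2) i(2)] by blast
    then show ?thesis using torsion_rotate[OF bb] by simp
  next
    case 5 then have "torsion g3 g1 g2 = 0" using sorted[OF _ _ j(1) k(2) i(2) j(2)] by blast
    then show ?thesis using torsion_rotate[OF bb(3,1,2)] by simp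
  next
    case 6 then have "torsion g3 g2 g1 = 0" using sorted[OF _ _ i(1) k(2) j(2) i(2)] by blast
    then show ?thesis using torsion_rotate[OF bb(3,2,1)] s(1)[OF bb] by simp
  qed
qed

section \<open>The three conditions that depend on the others\<close>

context
  assumes lie_\<theta>: "\<And>a X Y. a \<in> {1..h} \<Longrightarrow> vector_field A X \<Longrightarrow> vector_field A Y \<Longrightarrow> lie_form2 (Z a) \<theta> X Y = 0"
    and lie_\<xi>: "\<And>a \<alpha>. a \<in> {1..h} \<Longrightarrow> one_form A \<alpha> \<Longrightarrow> lie_form A (sh \<alpha>) (\<xi> a) = 0"
    and nij_F: "\<And>X Y. vector_field A X \<Longrightarrow> vector_field A Y \<Longrightarrow>
       nijenhuis F X Y = sh (contr_d2 A \<theta> X Y) - (\<Sum>a\<in>{1..h}. d1 (\<xi> a) X Y \<cdot> Z a)"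
begin

lemma d1_\<xi>_F_F:
  assumes b: "b \<in> {1..h}" and X: "vector_field A X" and Y: "vector_field A Y"
  shows "d1 (\<xi> b) (F \<odot> X) (F \<odot> Y) = d1 (\<xi> b) X Y"
proof -
  note c = b X Y contact_closure smooth_d1 contr_d2(1)[OF \<theta> X Y]
  \<comment> \<open>The other three terms of the torsion of F are images under F and are annihilated
    by \<xi> b.\<close>
  have "\<xi> b \<odot> nijenhuis F X Y = \<xi> b \<odot> lie_bracket (F \<odot> X) (F \<odot> Y)"
    by (simp add: nijenhuis_def form_ev_right c \<xi>_F)
  then have "d1 (\<xi> b) (F \<odot> X) (F \<odot> Y) = - (\<xi> b \<odot> nijenhuis F X Y)"
    by (simp add: d1_def[of _ "F \<odot> X"] \<xi>_F deriv_along_0 c)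
  also have "\<xi> b \<odot> nijenhuis F X Y = - d1 (\<xi> b) X Y"
    by (simp add: nij_F form_ev_right form_ev_sum c \<xi>_sh \<xi>_Z sum_\<delta>)
  finally show ?thesis by simp
qed

text \<open>Take X = Z a in \<open>d1_\<xi>_F_F\<close>: the left-hand side vanishes because F
  annihilates Z a.\<close>

lemma d1_\<xi>_Z:
  assumes "b \<in> {1..h}" "a \<in> {1..h}" "vector_field A Y"
  shows "d1 (\<xi> b) (Z a) Y = 0"
  using d1_\<xi>_F_F[OF assms(1) Z[OF assms(2)] assms(3)] assms
  by (simp add: F_Z d1_def[of _ 0] deriv_along_0 deriv_along_left form_ev_0 lie_bracket_0 contact_closure)

text \<open>By \<open>d1_\<xi>_F_F\<close> the pair (X, FY) may be replaced by (FX, FFY). In the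
  expansion of FFY the sharp term is killed by the condition on the Lie derivatives of \<xi> b and
  the Z terms by \<open>d1_\<xi>_Z\<close>, which leaves -Y.\<close>

lemma d1_\<xi>_F:
  assumes b: "b \<in> {1..h}" and X: "vector_field A X" and Y: "vector_field A Y"
  shows "d1 (\<xi> b) (F \<odot> X) Y + d1 (\<xi> b) X (F \<odot> Y) = 0"
proof -
  let ?W = "F \<odot> X" and ?S = "\<Sum>a\<in>{1..h}. (\<xi> a \<odot> Y) \<cdot> Z a"
  note c = X Y b contact_closure
  have t: "tensorial (\<lambda>U. d1 (\<xi> b) U ?W)"
    unfolding tensorial_def by (simp add: d1_left c smooth_d1)
  have S: "d1 (\<xi> b) ?S ?W = 0"
    using tensorial_sum[OF t, of "{1..h}" "\<lambda>a. (\<xi> a \<odot> Y) \<cdot> Z a"] by (simp add: d1_left d1_\<xi>_Z c)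
  have s: "d1 (\<xi> b) (sh \<alpha>) ?W = 0" if "one_form A \<alpha>" for \<alpha>
    using lie_form_ev[of "sh \<alpha>" "\<xi> b" ?W] by (simp add: that c lie_\<xi> ev_left_simps d1_def \<xi>_sh deriv_along_0)
  have "d1 (\<xi> b) X (F \<odot> Y) = d1 (\<xi> b) ?W (F \<odot> (F \<odot> Y))"
    by (simp add: d1_\<xi>_F_F c)
  also have "\<dots> = - d1 (\<xi> b) (- Y + - sh (\<theta> \<odot> Y) + ?S) ?W"
    by (subst d1_swap) (simp_all add: F_F c)
  also have "\<dots> = d1 (\<xi> b) Y ?W"
    using S s[of "\<theta> \<odot> Y"] by (simp add: d1_left c del: add_uminus_conv_diff uminus_add_conv_diff)
  also have "\<dots> = - d1 (\<xi> b) ?W Y" by (rule d1_swap) (simp_all add: c)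
  finally show ?thesis by simp
qed

lemma lie_endo_Z:
  assumes eig: "\<forall>x. \<not> eigenvalue_on (tangent A x) (sharp A P x \<circ> flat \<theta> x) (-1)"
    and a: "a \<in> {1..h}" and Y: "vector_field A Y"
  shows "lie_endo (Z a) F Y = 0"
proof -
  note c = a Y contact_closure
  let ?V = "lie_endo (Z a) F Y"
  have V: "vector_field A ?V" by (simp add: lie_endo_def c)
  \<comment> \<open>Since \<theta> annihilates Z a, this value of d\<theta> is the Lie derivative of
    \<theta> along Z a on Y and W.\<close>
  have "d2 \<theta> (Z a) Y W = 0" if W: "vector_field A W" for W
    using lie_\<theta>[OF a Y W] lie_bracket_swap[of W "Z a"]
    by (simp add: d2_def lie_form2_def \<theta>_lie \<theta>_Z \<theta>_Z_right c W ev_left_simps deriv_along_0 form_ev_right two_form_ev(6)[OF \<theta>])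
  then have "contr_d2 A \<theta> (Z a) Y = 0"
    by (intro form_eqI) (simp_all add: contr_d2[OF \<theta>] c ev_left_simps)
  then have "nijenhuis F (Z a) Y = 0"
    by (simp add: nij_F c d1_\<xi>_Z sharp_ev_0[OF P] fscale_zero)
  \<comment> \<open>As F annihilates Z a, the torsion of F on Z a and Y is - F V.\<close>
  then have FV: "F \<odot> ?V = 0"
    by (simp add: nijenhuis_def lie_endo_def F_Z lie_bracket_0 endo_ev_0[OF F] endo_ev[OF F] c)
  \<comment> \<open>\<xi> b annihilates images of F, and \<xi> b (Z a) is constant, so \<xi> b (V) =
    \<xi> b ([Z a, FY]) is minus a value of d\<xi> b with Z a inserted.\<close>
  have xV: "\<xi> b \<odot> ?V = 0" if b: "b \<in> {1..h}" for b
    using d1_\<xi>_Z[OF b a, of "F \<odot> Y"]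
    by (simp add: lie_endo_def form_ev_right \<xi>_F \<xi>_Z d1_def c b deriv_along_0 deriv_along_delta)
  have "0 = - ?V - sh (\<theta> \<odot> ?V)"
    using F_F[OF V] xV by (simp add: FV endo_ev_0[OF F] fscale_zero)
  then have e: "sh (\<theta> \<odot> ?V) p = - ?V p" for p
    by (simp add: fun_eq_iff)
  show ?thesis
  proof
    fix p
    show "?V p = 0 p"
      using eig vfD(1)[OF V, of p] e[of p] unfolding eigenvalue_on_def flat_eq
      by (auto simp: ev_apply)
  qed
qed

end

section \<open>The equivalence\<close>

text \<open>With the jacobiator in place of the Schouten bracket all eight conditions are tested on
  global fields and forms, as the torsion is. Conditions that equate fields or forms are recovered
  from torsion values by pairing with arbitrary test objects.\<close>

lemma normal_iff_jacobiator:
  assumes eig: "\<forall>x. \<not> eigenvalue_on (tangent A x) (sharp A P x \<circ> flat \<theta> x) (-1)"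
  shows "normal_structure A h P \<theta> F Z \<xi> \<longleftrightarrow>
     (\<forall>\<alpha> \<beta> \<gamma>. one_form A \<alpha> \<longrightarrow> one_form A \<beta> \<longrightarrow> one_form A \<gamma> \<longrightarrow> jacobiator P \<alpha> \<beta> \<gamma> = 0) \<and>
     (\<forall>\<alpha> X. one_form A \<alpha> \<longrightarrow> vector_field A X \<longrightarrow> schouten_concomitant A P F \<alpha> X = 0) \<and>
     (\<forall>a\<in>{1..h}. \<forall>\<alpha> \<beta>. one_form A \<alpha> \<longrightarrow> one_form A \<beta> \<longrightarrow> lie_bivec A (Z a) P \<alpha> \<beta> = 0) \<and>
     (\<forall>a\<in>{1..h}. \<forall>X Y. vector_field A X \<longrightarrow> vector_field A Y \<longrightarrow> lie_form2 (Z a) \<theta> X Y = 0) \<and>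
     (\<forall>a\<in>{1..h}. \<forall>\<alpha>. one_form A \<alpha> \<longrightarrow> lie_form A (sharp A P \<odot> \<alpha>) (\<xi> a) = 0) \<and>
     (\<forall>a\<in>{1..h}. \<forall>b\<in>{1..h}. lie_bracket (Z a) (Z b) = 0) \<and>
     (\<forall>X Y. vector_field A X \<longrightarrow> vector_field A Y \<longrightarrow>
        nijenhuis F X Y = sharp A P \<odot> contr_d2 A \<theta> X Y - (\<Sum>a\<in>{1..h}. d1 (\<xi> a) X Y \<cdot> Z a)) \<and>
     (\<forall>X Y W. vector_field A X \<longrightarrow> vector_field A Y \<longrightarrow> vector_field A W \<longrightarrow>
        d2 (form2_comp \<theta> F) X Y W = d2 \<theta> (F \<odot> X) Y W + d2 \<theta> (F \<odot> Y) W X + d2 \<theta> (F \<odot> W) X Y)"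
    (is "_ \<longleftrightarrow> ?conds")
  unfolding normal_iff_big_nijenhuis big_nijenhuis_eq_0_iff
proof
  assume "\<forall>g1\<in>gens. \<forall>g2\<in>gens. \<forall>g3\<in>gens. torsion g1 g2 g3 = 0"
  then have t: "torsion g1 g2 g3 = 0" if "g1 \<in> gens" "g2 \<in> gens" "g3 \<in> gens" for g1 g2 g3
    using that by blast
  have g: "vector_field A X \<Longrightarrow> vec X \<in> gens" "one_form A \<alpha> \<Longrightarrow> cov \<alpha> \<in> gens"
    "a \<in> {1..h} \<Longrightarrow> ubasis a \<in> gens" "a \<in> {1..h} \<Longrightarrow> vbasis a \<in> gens" for X \<alpha> a
    by (auto simp: gens_def)
  show ?conds
  proof (intro conjI allI ballI impI)
    show "jacobiator P \<alpha> \<beta> \<gamma> = 0" if "one_form A \<alpha>" "one_form A \<beta>" "one_form A \<gamma>" for \<alpha> \<beta> \<gamma>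
      using t[OF that[THEN g(2)]] torsion_\<alpha>\<beta>\<gamma>[OF that] by (simp only: jacobiator_def Let_def)
    show "lie_bivec A (Z a) P \<alpha> \<beta> = 0" if "a \<in> {1..h}" "one_form A \<alpha>" "one_form A \<beta>" for a \<alpha> \<beta>
      using t[OF g(2)[OF that(2)] g(2)[OF that(3)] g(4)[OF that(1)]] torsion_\<alpha>\<beta>v[OF that(2,3,1)] by simp
    show "lie_form2 (Z a) \<theta> X Y = 0" if "a \<in> {1..h}" "vector_field A X" "vector_field A Y" for a X Y
      using t[OF g(1)[OF that(2)] g(1)[OF that(3)] g(4)[OF that(1)]] torsion_XYv[OF that(2,3,1)] by simp
    show "d2 (form2_comp \<theta> F) X Y W = d2 \<theta> (F \<odot> X) Y W + d2 \<theta> (F \<odot> Y) W X + d2 \<theta> (F \<odot> W) X Y"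
      if "vector_field A X" "vector_field A Y" "vector_field A W" for X Y W
      using t[OF that[THEN g(1)]] torsion_XYW[OF that] by simp
    show "schouten_concomitant A P F \<alpha> X = 0" if al: "one_form A \<alpha>" and X: "vector_field A X" for \<alpha> X
    proof (rule vf_eqI_form)
      show "vector_field A (schouten_concomitant A P F \<alpha> X)"
        by (simp add: schouten_concomitant_def lie_endo_def contact_closure al X)
      fix \<beta> assume be: "one_form A \<beta>"
      show "\<beta> \<odot> schouten_concomitant A P F \<alpha> X = \<beta> \<odot> 0"
        using t[OF g(1)[OF X] g(2)[OF al] g(2)[OF be]] torsion_X\<alpha>\<beta>[OF X al be] by (simp add: form_ev_0 be)
    qed (rule vf_zero)
    show "lie_form A (sh \<alpha>) (\<xi> a) = 0" if a: "a \<in> {1..h}" and al: "one_form A \<alpha>" for a \<alpha>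
    proof (rule form_eqI)
      fix X assume X: "vector_field A X"
      show "lie_form A (sh \<alpha>) (\<xi> a) \<odot> X = 0 \<odot> X"
        using t[OF g(1)[OF X] g(2)[OF al] g(3)[OF a]] torsion_X\<alpha>u[OF X al a] by (simp add: ev_left_simps)
    qed (simp_all add: contact_closure a al)
    show "lie_bracket (Z a) (Z b) = 0" if a: "a \<in> {1..h}" and b: "b \<in> {1..h}" for a b
    proof (rule vf_eqI_form)
      fix \<alpha> assume al: "one_form A \<alpha>"
      show "\<alpha> \<odot> lie_bracket (Z a) (Z b) = \<alpha> \<odot> 0"
        using t[OF g(2)[OF al] g(4)[OF a] g(4)[OF b]] torsion_\<alpha>vv[OF al a b] by (simp add: form_ev_0 al)
    qed (simp_all add: contact_closure a b)
    show "nijenhuis F X Y = sh (contr_d2 A \<theta> X Y) - (\<Sum>a\<in>{1..h}. d1 (\<xi> a) X Y \<cdot> Z a)"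
      if X: "vector_field A X" and Y: "vector_field A Y" for X Y
    proof -
      have "nijenhuis F X Y - (sh (contr_d2 A \<theta> X Y) - (\<Sum>a\<in>{1..h}. d1 (\<xi> a) X Y \<cdot> Z a)) = 0" (is "?N = 0")
      proof (rule vf_eqI_form)
        show "vector_field A ?N"
          by (simp add: nijenhuis_def contact_closure X Y contr_d2[OF \<theta>] smooth_d1)
        fix \<alpha> assume al: "one_form A \<alpha>"
        show "\<alpha> \<odot> ?N = \<alpha> \<odot> 0"
          using t[OF g(1)[OF X] g(1)[OF Y] g(2)[OF al]] torsion_XY\<alpha>'[OF X Y al] by (simp add: form_ev_0 al)
      qed (rule vf_zero)
      then show ?thesis by (simp only: eq_iff_diff_eq_0[symmetric])
    qed
  qed
next
  assume ?conds
  then have 1: "\<And>\<alpha> \<beta> \<gamma>. one_form A \<alpha> \<Longrightarrow> one_form A \<beta> \<Longrightarrow> one_form A \<gamma> \<Longrightarrow> jacobiator P \<alpha> \<beta> \<gamma> = 0"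
    and 2: "\<And>\<alpha> X. one_form A \<alpha> \<Longrightarrow> vector_field A X \<Longrightarrow> schouten_concomitant A P F \<alpha> X = 0"
    and 3: "\<And>a \<alpha> \<beta>. a \<in> {1..h} \<Longrightarrow> one_form A \<alpha> \<Longrightarrow> one_form A \<beta> \<Longrightarrow> lie_bivec A (Z a) P \<alpha> \<beta> = 0"
    and 4: "\<And>a X Y. a \<in> {1..h} \<Longrightarrow> vector_field A X \<Longrightarrow> vector_field A Y \<Longrightarrow> lie_form2 (Z a) \<theta> X Y = 0"
    and 5: "\<And>a \<alpha>. a \<in> {1..h} \<Longrightarrow> one_form A \<alpha> \<Longrightarrow> lie_form A (sh \<alpha>) (\<xi> a) = 0"
    and 6: "\<And>a b. a \<in> {1..h} \<Longrightarrow> b \<in> {1..h} \<Longrightarrow> lie_bracket (Z a) (Z b) = 0"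
    and 7: "\<And>X Y. vector_field A X \<Longrightarrow> vector_field A Y \<Longrightarrow>
       nijenhuis F X Y = sh (contr_d2 A \<theta> X Y) - (\<Sum>a\<in>{1..h}. d1 (\<xi> a) X Y \<cdot> Z a)"
    and 8: "\<And>X Y W. vector_field A X \<Longrightarrow> vector_field A Y \<Longrightarrow> vector_field A W \<Longrightarrow>
        d2 (form2_comp \<theta> F) X Y W = d2 \<theta> (F \<odot> X) Y W + d2 \<theta> (F \<odot> Y) W X + d2 \<theta> (F \<odot> W) X Y"
    by blast+
  show "\<forall>g1\<in>gens. \<forall>g2\<in>gens. \<forall>g3\<in>gens. torsion g1 g2 g3 = 0"
  proof (intro ballI)
    fix g1 g2 g3 assume g: "g1 \<in> gens" "g2 \<in> gens" "g3 \<in> gens"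
    note s = form_ev_0 ev_left_simps
    show "torsion g1 g2 g3 = 0"
    proof (rule torsion_gens_eq_0[OF _ _ _ _ _ _ _ _ _ _ _ g])
      show "torsion (vec X) (ubasis a) (vbasis b) = 0" if "vector_field A X" "a \<in> {1..h}" "b \<in> {1..h}" for X a b
        using d1_swap[OF \<xi>[OF that(2)] that(1) Z[OF that(3)]] d1_\<xi>_Z[OF 4 5 7 that(2,3,1)]
        by (simp add: torsion_Xuv that)
      show "torsion (vec X) (vec Y) (cov \<alpha>) = 0" if "vector_field A X" "vector_field A Y" "one_form A \<alpha>" for X Y \<alpha>
        unfolding torsion_XY\<alpha>'[OF that] 7[OF that(1,2), symmetric] by (simp add: s that)
      show "torsion (vec X) (vec Y) (ubasis a) = 0" if "vector_field A X" "vector_field A Y" "a \<in> {1..h}" for X Y a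
        using d1_\<xi>_F[OF 4 5 7 that(3,1,2)] by (simp only: torsion_XYu[OF that])
      show "torsion (cov \<alpha>) (cov \<beta>) (cov \<gamma>) = 0" if "one_form A \<alpha>" "one_form A \<beta>" "one_form A \<gamma>" for \<alpha> \<beta> \<gamma>
        using 1[OF that] unfolding torsion_\<alpha>\<beta>\<gamma>[OF that] jacobiator_def Let_def .
      show "torsion (vec X) (cov \<alpha>) (vbasis a) = 0" if "vector_field A X" "one_form A \<alpha>" "a \<in> {1..h}" for X \<alpha> a
        using lie_endo_Z[OF 4 5 7 eig that(3,1)] by (simp add: torsion_X\<alpha>v that s)
    qed (simp_all add: torsion_XYW torsion_XYv torsion_X\<alpha>\<beta> torsion_X\<alpha>u torsion_\<alpha>\<beta>v torsion_\<alpha>vv s 2 3 4 5 6 8)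
  qed
qed

end

theorem theorem3p1:
  fixes A :: "('a::{t2_space,second_countable_topology}, 'e::{real_inner,banach}) atlas"
    and h :: nat
    and P :: "'a bivec" and \<theta> :: "'a form2" and F :: "'a endo"
    and Z :: "nat \<Rightarrow> 'a vfield" and \<xi> :: "nat \<Rightarrow> 'a form1"
  assumes "smooth_atlas A"
    and "gen_almost_contact A h P \<theta> F Z \<xi>"
    and "\<forall>x. \<not> eigenvalue_on (tangent A x) (sharp A P x \<circ> flat \<theta> x) (-1)"
  shows "normal_structure A h P \<theta> F Z \<xi> \<longleftrightarrow>
     schouten_bracket A P P = 0 \<and>
     (\<forall>\<alpha> X. one_form A \<alpha> \<longrightarrow> vector_field A X \<longrightarrow> schouten_concomitant A P F \<alpha> X = 0) \<and>
     (\<forall>a\<in>{1..h}. \<forall>\<alpha> \<beta>. one_form A \<alpha> \<longrightarrow> one_form A \<beta> \<longrightarrow> lie_bivec A (Z a) P \<alpha> \<beta> = 0) \<and>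
     (\<forall>a\<in>{1..h}. \<forall>X Y. vector_field A X \<longrightarrow> vector_field A Y \<longrightarrow> lie_form2 (Z a) \<theta> X Y = 0) \<and>
     (\<forall>a\<in>{1..h}. \<forall>\<alpha>. one_form A \<alpha> \<longrightarrow> lie_form A (sharp A P \<odot> \<alpha>) (\<xi> a) = 0) \<and>
     (\<forall>a\<in>{1..h}. \<forall>b\<in>{1..h}. lie_bracket (Z a) (Z b) = 0) \<and>
     (\<forall>X Y. vector_field A X \<longrightarrow> vector_field A Y \<longrightarrow>
        nijenhuis F X Y = sharp A P \<odot> contr_d2 A \<theta> X Y - (\<Sum>a\<in>{1..h}. d1 (\<xi> a) X Y \<cdot> Z a)) \<and>
     (\<forall>X Y W. vector_field A X \<longrightarrow> vector_field A Y \<longrightarrow> vector_field A W \<longrightarrow>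
        d2 (form2_comp \<theta> F) X Y W = d2 \<theta> (F \<odot> X) Y W + d2 \<theta> (F \<odot> Y) W X + d2 \<theta> (F \<odot> W) X Y)"
proof -
  interpret contact_structure A h P \<theta> F Z \<xi>
    using assms(1,2) by unfold_locales
  show ?thesis
    unfolding schouten_bracket_eq_0_iff[OF P] by (rule normal_iff_jacobiator[OF assms(3)])
qed

end
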